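(* Let $1<\alpha<2$, let $X_\alpha=(X_\alpha(t):t\ge 0)$ be a symmetric stable Lévy process on $\mathbb{R}$ of index $\alpha$ starting from zero, and let $a\in\mathbb{R}$ with $a\neq 0$. Then the first hitting time $T_{\{a\}}(X_\alpha)$ of the point $a$ by $X_\alpha$ is not self-decomposable.
   Context: A real random variable $X$ is self-decomposable if for every $c\in(0,1)$ there is a random variable $X_c$ such that $X\overset{d}{=}cX'+X_c$ (equality in distribution), where $X'$ has the same distribution as $X$ and is independent of $X_c$. A symmetric stable Lévy process of index $\alpha$ starting from zero is a one-dimensional Lévy process (with càdlàg paths) with $X_\alpha(0)=0$ and $\mathbb{E}[e^{i\theta X_\alpha(t)}]=e^{-\kappa t|\theta|^\alpha}$ for all $\theta\in\mathbb{R}$, $t\ge0$, for some constant $\kappa>0$. The first hitting time of $a$ is $T_{\{a\}}(X_\alpha)=\inf\{t>0: X_\alpha(t)=a\}$; it is known to be almost surely finite for $1<\alpha\le 2$. *)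

theory Defs
  imports "HOL-Probability.Probability"
begin

definition cadlag :: "(real \<Rightarrow> real) \<Rightarrow> bool" where
  "cadlag x \<longleftrightarrow>
     (\<forall>t\<ge>0. (x \<longlongrightarrow> x t) (at_right t)) \<and>
     (\<forall>t>0. \<exists>l. (x \<longlongrightarrow> l) (at_left t))"

text \<open>
  The process is indexed by \<^typ>\<open>real\<close>, but only times \<open>t \<ge> 0\<close> are constrained or used.
  Continuity in probability is not listed: it follows from right-continuity of the paths at
  time 0 together with stationarity of the increments.
\<close>

definition levy_process :: "'a measure \<Rightarrow> (real \<Rightarrow> 'a \<Rightarrow> real) \<Rightarrow> bool" where
  "levy_process M X \<longleftrightarrow>
     prob_space M \<and>
     (\<forall>t\<ge>0. X t \<in> borel_measurable M) \<and>
     (AE \<omega> in M. X 0 \<omega> = 0) \<and>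
     (\<forall>(n::nat) (t :: nat \<Rightarrow> real). 0 \<le> t 0 \<longrightarrow> (\<forall>i<n. t i < t (Suc i)) \<longrightarrow>
        prob_space.indep_vars M (\<lambda>_. borel) (\<lambda>i \<omega>. X (t (Suc i)) \<omega> - X (t i) \<omega>) {..<n}) \<and>
     (\<forall>s\<ge>0. \<forall>h\<ge>0. distr M borel (\<lambda>\<omega>. X (s + h) \<omega> - X s \<omega>) = distr M borel (X h)) \<and>
     (AE \<omega> in M. cadlag (\<lambda>t. X t \<omega>))"

definition symmetric_stable_levy_process ::
    "real \<Rightarrow> 'a measure \<Rightarrow> (real \<Rightarrow> 'a \<Rightarrow> real) \<Rightarrow> bool" where
  "symmetric_stable_levy_process \<alpha> M X \<longleftrightarrow>
     levy_process M X \<and>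
     (\<exists>\<kappa>>0. \<forall>t\<ge>0. \<forall>\<theta>.
        char (distr M borel (X t)) \<theta> = of_real (exp (- \<kappa> * t * \<bar>\<theta>\<bar> powr \<alpha>)))"

text \<open>Extended-real valued, so that the infimum of the empty set is \<open>\<infinity>\<close>.
  Even for cadlag paths the hitting time of a point is in general measurable only with respect
  to the completed sigma-algebra, so its law should be taken under \<^term>\<open>completion M\<close>.\<close>

definition hitting_time :: "(real \<Rightarrow> 'a \<Rightarrow> real) \<Rightarrow> real \<Rightarrow> 'a \<Rightarrow> ereal" where
  "hitting_time X a \<omega> = Inf (ereal ` {t. 0 < t \<and> X t \<omega> = a})"

text \<open>
  The pair \<open>X'\<close>, \<open>Xc\<close> may live on any probability space, independent of \<open>M\<close>. Fixing the type
  of its points to be \<^typ>\<open>real \<times> real\<close> loses nothing, since only the joint law of the pair matters.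
\<close>

definition self_decomposable :: "'a measure \<Rightarrow> ('a \<Rightarrow> real) \<Rightarrow> bool" where
  "self_decomposable M X \<longleftrightarrow>
     (\<forall>c\<in>{0<..<1}. \<exists>(N :: (real \<times> real) measure) X' Xc.
        prob_space N \<and>
        prob_space.indep_var N borel X' borel Xc \<and>
        distr N borel X' = distr M borel X \<and>
        distr M borel X = distr N borel (\<lambda>\<omega>. c * X' \<omega> + Xc \<omega>))"

end

theory Submission
  imports Defs "HOL-Complex_Analysis.Complex_Analysis" "HOL-Real_Asymp.Real_Asymp"
begin

text \<open>
  Let \<open>T\<close> be the hitting time of \<open>a\<close>, let \<open>\<phi> q = E exp (- q T)\<close>, and let
  \<open>W q x\<close> be the integral of \<open>cos (x \<theta>) / (q + \<kappa> \<bar>\<theta>\<bar> powr \<alpha>)\<close> over all real \<open>\<theta>\<close>, which is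
  \<open>2 pi\<close> times the density at \<open>x\<close> of the \<open>q\<close>-resolvent of the process.
  The proof compares two facts about \<open>g q = q powr (1 + 1 / \<alpha>) * \<phi> q\<close>.

  If \<open>T\<close> were self-decomposable, then \<open>\<phi> q / \<phi> (c q)\<close> would be the Laplace transform of \<open>X\<^sub>c\<close>.
  Since \<open>g\<close> has a positive limit at infinity, this quotient tends to \<open>c powr (1 + 1 / \<alpha>)\<close>; being
  bounded for large \<open>q\<close>, it forces \<open>X\<^sub>c \<ge> 0\<close>, hence it decreases in \<open>q\<close> and lies above its limit.
  That says \<open>g (c q) \<le> g q\<close>: the function \<open>g\<close> is nondecreasing and so never exceeds its limit
  (\<open>self_decomposable_Laplace_le_limit\<close>).

  On the other hand \<open>\<phi> q = W q a / W q 0\<close>, and \<open>W q 0\<close> is a constant times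
  \<open>q powr (1 / \<alpha> - 1)\<close> by scaling, so \<open>g q\<close> is a constant times \<open>q\<^sup>2 * W q a\<close>. Turning the
  line of integration to the imaginary axis expresses \<open>W q a\<close> for \<open>a > 0\<close> as a Laplace-type integral
  of \<open>exp (- a s)\<close> (\<open>resolvent_kernel_rotated\<close>), from which
  \<open>q\<^sup>2 * W q a = A + B / q + o (1 / q)\<close> can be read off. Here \<open>A\<close> is \<open>sin (pi \<alpha> / 2)\<close> and \<open>B\<close>
  is \<open>- sin (pi \<alpha> / 2) * cos (pi \<alpha> / 2)\<close>, up to positive factors; for \<open>1 < \<alpha> < 2\<close> both are
  positive. So \<open>g\<close> exceeds its limit for all large \<open>q\<close>, which is the contradiction
  (\<open>resolvent_kernel_asymptotics\<close>).

  The formula for \<open>\<phi>\<close> comes from the entry times \<open>T\<^sub>\<epsilon>\<close> into the balls of radius \<open>\<epsilon>\<close> about \<open>a\<close>.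
  They are limits of entry times along dyadic grids, for which the Markov property is just the
  independence of finitely many increments. Tested against the functions \<open>cos (\<theta> (x - a))\<close>, it
  identifies the discounted occupation measure after \<open>T\<^sub>\<epsilon>\<close> up to an error of order \<open>\<bar>\<theta>\<bar> \<epsilon>\<close>
  (\<open>entry_resolvent_approx\<close>). The occupation measure before \<open>T\<^sub>\<epsilon>\<close> does not charge the ball, so the
  integral over \<open>\<theta>\<close> of its Fourier transform centred at \<open>a\<close> vanishes
  (\<open>integral_cos_transform_eq_0\<close>); splitting the resolvent at \<open>T\<^sub>\<epsilon>\<close> and letting \<open>\<epsilon>\<close> tend to \<open>0\<close>
  gives \<open>W q a = E exp (- q T') * W q 0\<close> for \<open>T' = lim T\<^sub>\<epsilon>\<close>. The same identities show that the
  process is almost surely at \<open>a\<close> at time \<open>T'\<close>, so that \<open>T' = T\<close>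
  (\<open>AE_at_approach_time\<close>), and \<open>q \<rightarrow> 0\<close> shows that \<open>T'\<close> is almost surely finite
  (\<open>AE_approaches\<close>).
\<close>

section \<open>Laplace transforms of self-decomposable laws\<close>

text \<open>The Laplace transform \<open>\<psi> q = \<phi> q / \<phi> (c * q)\<close> of the innovation \<open>X\<^sub>c\<close> converges to
  \<open>c powr \<gamma>\<close>. Negative values of \<open>X\<^sub>c\<close> would make it grow exponentially, so \<open>X\<^sub>c\<close> is nonnegative,
  \<open>\<psi>\<close> is decreasing, and \<open>\<psi> q\<close> is at least its limit. Multiplied out this is the claim.\<close>

lemma self_decomposable_Laplace_mono:
  fixes M :: "'a measure" and T :: "'a \<Rightarrow> real" and c \<gamma> A :: real
  defines "\<phi> \<equiv> (\<lambda>q. LINT \<omega>|M. exp (- q * T \<omega>))"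
  assumes M: "prob_space M" and T: "T \<in> borel_measurable M" and T0: "AE \<omega> in M. 0 \<le> T \<omega>"
    and SD: "self_decomposable M T"
    and A: "0 < A" and lim: "((\<lambda>q. q powr \<gamma> * \<phi> q) \<longlongrightarrow> A) at_top"
    and c: "0 < c" "c < 1" and q: "0 < q"
  shows "(c * q) powr \<gamma> * \<phi> (c * q) \<le> q powr \<gamma> * \<phi> q"
proof -
  interpret M: prob_space M by (rule M)
  have int: "integrable M (\<lambda>\<omega>. exp (- q * T \<omega>))" if "0 < q" for q
    using T T0 that
    by (intro M.integrable_const_bound[where B=1]) (auto elim!: eventually_mono)
  have pos: "0 < \<phi> q" if "0 < q" for q
    unfolding \<phi>_def using int[OF that] by (intro M.expectation_greater[where a=0, simplified]) auto
  have nn: "(\<integral>\<^sup>+\<omega>. exp (- q * T \<omega>) \<partial>M) = \<phi> q" if "0 < q" for q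
    unfolding \<phi>_def using int[OF that] by (intro nn_integral_eq_integral) auto
  obtain N :: "(real \<times> real) measure" and X' Xc where N: "prob_space N"
    and ind: "prob_space.indep_var N borel X' borel Xc"
    and d1: "distr N borel X' = distr M borel T"
    and d2: "distr M borel T = distr N borel (\<lambda>\<omega>. c * X' \<omega> + Xc \<omega>)"
    using SD c unfolding self_decomposable_def by force
  interpret N: prob_space N by (rule N)
  have [measurable]: "X' \<in> borel_measurable N" "Xc \<in> borel_measurable N"
    using N.indep_var_rv1[OF ind] N.indep_var_rv2[OF ind] by auto
  note [measurable] = T
  define \<Psi> where "\<Psi> q = (\<integral>\<^sup>+\<omega>. ennreal (exp (- q * Xc \<omega>)) \<partial>N)" for q
  have fact: "ennreal (\<phi> q) = ennreal (\<phi> (c * q)) * \<Psi> q" if "0 < q" for q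
  proof -
    interpret D1: prob_space "distr N borel X'" by (intro N.prob_space_distr) auto
    interpret D2: prob_space "distr N borel Xc" by (intro N.prob_space_distr) auto
    have "ennreal (\<phi> q) = (\<integral>\<^sup>+x. exp (- q * x) \<partial>distr M borel T)"
      unfolding nn[OF that, symmetric] by (subst nn_integral_distr) auto
    also have "\<dots> = (\<integral>\<^sup>+\<omega>. exp (- q * (c * X' \<omega> + Xc \<omega>)) \<partial>N)"
      unfolding d2 by (subst nn_integral_distr) auto
    also have "\<dots> = (\<integral>\<^sup>+p. exp (- q * (c * fst p + snd p)) \<partial>distr N (borel \<Otimes>\<^sub>M borel) (\<lambda>\<omega>. (X' \<omega>, Xc \<omega>)))"
      by (subst nn_integral_distr) auto
    also have "\<dots> = (\<integral>\<^sup>+p. exp (- q * (c * fst p + snd p)) \<partial>(distr N borel X' \<Otimes>\<^sub>M distr N borel Xc))"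
      using ind unfolding N.indep_var_distribution_eq by auto
    also have "\<dots> = (\<integral>\<^sup>+x. \<integral>\<^sup>+y. exp (- q * (c * x + y)) \<partial>distr N borel Xc \<partial>distr N borel X')"
      by (subst D2.nn_integral_fst[symmetric]) auto
    also have "\<dots> = (\<integral>\<^sup>+x. exp (- (c * q) * x) * \<Psi> q \<partial>distr N borel X')"
    proof (intro nn_integral_cong)
      fix x
      have "(\<integral>\<^sup>+y. exp (- q * (c * x + y)) \<partial>distr N borel Xc) =
            (\<integral>\<^sup>+\<omega>. ennreal (exp (- (c * q) * x)) * ennreal (exp (- q * Xc \<omega>)) \<partial>N)"
        by (subst nn_integral_distr)
           (auto simp: exp_add[symmetric] ennreal_mult[symmetric] algebra_simps intro!: nn_integral_cong)
      also have "\<dots> = exp (- (c * q) * x) * \<Psi> q"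
        unfolding \<Psi>_def by (subst nn_integral_cmult) auto
      finally show "(\<integral>\<^sup>+y. exp (- q * (c * x + y)) \<partial>distr N borel Xc) = exp (- (c * q) * x) * \<Psi> q" .
    qed
    also have "\<dots> = (\<integral>\<^sup>+x. exp (- (c * q) * x) \<partial>distr M borel T) * \<Psi> q"
      unfolding d1 by (subst nn_integral_multc) auto
    also have "(\<integral>\<^sup>+x. exp (- (c * q) * x) \<partial>distr M borel T) = ennreal (\<phi> (c * q))"
      using nn[of "c * q"] that c by (subst nn_integral_distr) auto
    finally show ?thesis .
  qed
  define \<psi> where "\<psi> q = \<phi> q / \<phi> (c * q)" for q
  have \<Psi>: "\<Psi> q = ennreal (\<psi> q)" if "0 < q" for q
  proof -
    have "0 < \<phi> (c * q)" "0 < \<phi> q" using pos that c by auto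
    then have "ennreal (\<phi> (c * q)) * \<Psi> q = ennreal (\<phi> (c * q)) * ennreal (\<psi> q)"
      using fact[OF that] by (simp add: \<psi>_def ennreal_mult[symmetric])
    then show ?thesis
      using \<open>0 < \<phi> (c * q)\<close> by (subst (asm) ennreal_mult_cancel_left) auto
  qed
  have lim': "((\<lambda>q. (c * q) powr \<gamma> * \<phi> (c * q)) \<longlongrightarrow> A) at_top"
    using filterlim_compose[OF lim, of "\<lambda>q. c * q" at_top] c
      filterlim_tendsto_pos_mult_at_top[OF tendsto_const[of c] _ filterlim_ident] by simp
  have lim\<psi>: "(\<psi> \<longlongrightarrow> c powr \<gamma>) at_top"
  proof (rule Lim_transform_eventually)
    show "((\<lambda>q. c powr \<gamma> * ((q powr \<gamma> * \<phi> q) / ((c * q) powr \<gamma> * \<phi> (c * q)))) \<longlongrightarrow> c powr \<gamma>) at_top"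
      using tendsto_mult[OF tendsto_const tendsto_divide[OF lim lim'], of "c powr \<gamma>"] A by simp
    show "\<forall>\<^sub>F q in at_top. c powr \<gamma> * ((q powr \<gamma> * \<phi> q) / ((c * q) powr \<gamma> * \<phi> (c * q))) = \<psi> q"
      using eventually_gt_at_top[of 0]
      by eventually_elim (use c in \<open>auto simp: \<psi>_def powr_mult\<close>)
  qed
  have Xc0: "AE \<omega> in N. 0 \<le> Xc \<omega>"
  proof -
    \<comment> \<open>Mass of \<open>Xc\<close> below \<open>- (1 / Suc n)\<close> would make \<open>\<psi> q\<close> grow at least like \<open>exp (q / Suc n)\<close>.\<close>
    have "AE \<omega> in N. - (1 / Suc n) < Xc \<omega>" for n
    proof (rule ccontr)
      define B where "B = {\<omega> \<in> space N. Xc \<omega> \<le> - (1 / Suc n)}"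
      have [measurable]: "B \<in> sets N" unfolding B_def by auto
      assume "\<not> (AE \<omega> in N. - (1 / Suc n) < Xc \<omega>)"
      then have "emeasure N B \<noteq> 0"
        by (subst (asm) AE_iff_measurable[of B]) (auto simp: B_def not_less)
      then have B0: "0 < N.prob B"
        by (simp add: N.emeasure_eq_measure zero_less_measure_iff)
      have bound: "N.prob B * exp (q / Suc n) \<le> \<psi> q" if "0 < q" for q
      proof -
        have "ennreal (N.prob B * exp (q / Suc n)) = (\<integral>\<^sup>+\<omega>. ennreal (exp (q / Suc n)) * indicator B \<omega> \<partial>N)"
          by (subst nn_integral_cmult_indicator) (auto simp: N.emeasure_eq_measure ennreal_mult mult.commute)
        also have "\<dots> \<le> \<Psi> q"
          unfolding \<Psi>_def
        proof (intro nn_integral_mono)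
          fix \<omega>
          show "ennreal (exp (q / Suc n)) * indicator B \<omega> \<le> ennreal (exp (- q * Xc \<omega>))"
          proof (cases "\<omega> \<in> B")
            case True
            then have "q * (1 / Suc n) \<le> q * - Xc \<omega>"
              using that by (intro mult_left_mono) (auto simp: B_def)
            then show ?thesis using True by simp
          qed auto
        qed
        finally show ?thesis
          using \<Psi>[OF that] pos[of q] pos[of "c * q"] that c by (simp add: \<psi>_def)
      qed
      have "filterlim (\<lambda>q. N.prob B * exp (1 / Suc n * q)) at_top at_top"
        using B0
        by (intro filterlim_tendsto_pos_mult_at_top[OF tendsto_const] filterlim_compose[OF exp_at_top]
              filterlim_ident) auto
      then have "filterlim (\<lambda>q. N.prob B * exp (q / Suc n)) at_top at_top" by simp
      then have "filterlim \<psi> at_top at_top"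
        by (rule filterlim_at_top_mono) (rule eventually_mono[OF eventually_gt_at_top[of 0] bound])
      with lim\<psi> show False
        using not_tendsto_and_filterlim_at_infinity[of at_top \<psi> "c powr \<gamma>"]
        by (auto intro: filterlim_at_top_imp_at_infinity)
    qed
    then have "AE \<omega> in N. \<forall>n. - (1 / Suc n) < Xc \<omega>"
      by (simp add: AE_all_countable)
    then show ?thesis
    proof eventually_elim
      case (elim \<omega>)
      show ?case
      proof (rule ccontr)
        assume "\<not> 0 \<le> Xc \<omega>"
        then obtain n where "1 / Suc n < - Xc \<omega>"
          using reals_Archimedean[of "- Xc \<omega>"] by (auto simp: inverse_eq_divide)
        with elim[rule_format, of n] show False by linarith
      qed
    qed
  qed
  have "\<psi> q' \<le> \<psi> q" if "q \<le> q'" for q'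
  proof -
    have "\<Psi> q' \<le> \<Psi> q"
      unfolding \<Psi>_def using Xc0 that
      by (intro nn_integral_mono_AE) (auto elim!: eventually_mono intro!: mult_right_mono)
    then show ?thesis
      using \<Psi>[of q] \<Psi>[of q'] q that pos[of q] pos[of "c * q"] c by (simp add: \<psi>_def)
  qed
  then have "c powr \<gamma> \<le> \<psi> q"
    by (intro tendsto_upperbound[OF lim\<psi>] eventually_mono[OF eventually_ge_at_top[of q]]) auto
  then show ?thesis
    using pos[of "c * q"] q c by (simp add: \<psi>_def field_simps powr_mult)
qed

lemma self_decomposable_Laplace_le_limit:
  fixes M :: "'a measure" and T :: "'a \<Rightarrow> real" and \<gamma> A :: real
  defines "\<phi> \<equiv> (\<lambda>q. LINT \<omega>|M. exp (- q * T \<omega>))"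
  assumes M: "prob_space M" and T: "T \<in> borel_measurable M" and T0: "AE \<omega> in M. 0 \<le> T \<omega>"
    and SD: "self_decomposable M T"
    and A: "0 < A" and lim: "((\<lambda>q. q powr \<gamma> * \<phi> q) \<longlongrightarrow> A) at_top"
    and q: "0 < q"
  shows "q powr \<gamma> * \<phi> q \<le> A"
proof (rule tendsto_lowerbound[OF lim])
  show "\<forall>\<^sub>F r in at_top. q powr \<gamma> * \<phi> q \<le> r powr \<gamma> * \<phi> r"
    using eventually_gt_at_top[of q]
  proof eventually_elim
    case (elim r)
    show ?case
      using self_decomposable_Laplace_mono[OF M T T0 SD A, of \<gamma> "q / r" r] lim q elim
      by (simp add: \<phi>_def)
  qed
qed auto

section \<open>The resolvent kernel\<close>

lemma powr_add_const_ge: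
  fixes q \<kappa> \<alpha> \<theta> :: real
  assumes "0 < q" "0 < \<kappa>"
  shows "q \<le> q + \<kappa> * \<bar>\<theta>\<bar> powr \<alpha>" "0 < q + \<kappa> * \<bar>\<theta>\<bar> powr \<alpha>"
  using assms by (auto intro: add_pos_nonneg)

lemma integrable_resolvent_symbol:
  fixes q \<kappa> \<alpha> :: real
  assumes "0 < q" "0 < \<kappa>" "1 < \<alpha>"
  shows "integrable lborel (\<lambda>\<theta>. 1 / (q + \<kappa> * \<bar>\<theta>\<bar> powr \<alpha>))"
proof -
  have "(\<lambda>x. x powr - \<alpha>) absolutely_integrable_on {1::real..}"
    using has_integral_powr_to_inf[of "- \<alpha>" 1] assms
    by (intro nonnegative_absolutely_integrable_1) (auto simp: has_integral_iff)
  then have "integrable lborel (\<lambda>x. indicator {1..} x * x powr - \<alpha>)"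
    unfolding set_integrable_def by (subst (asm) integrable_completion) auto
  then have tail: "integrable lborel (\<lambda>x. indicator {1..} (0 + c * x) * (0 + c * x) powr - \<alpha>)" if "c \<noteq> 0" for c :: real
    by (rule lborel_integrable_real_affine[OF _ that])
  have mid: "integrable lborel (\<lambda>x::real. indicator {-1..1} x :: real)"
    by (intro integrable_real_indicator) (auto simp: less_top[symmetric])
  have "integrable lborel (\<lambda>x. 1 / q * indicator {-1..1} x
      + 1 / \<kappa> * (indicator {1..} (0 + 1 * x) * (0 + 1 * x) powr - \<alpha>)
      + 1 / \<kappa> * (indicator {1..} (0 + (-1) * x) * (0 + (-1) * x) powr - \<alpha>))" (is "integrable _ ?g")
    using mid tail[of 1] tail[of "-1"] by (intro Bochner_Integration.integrable_add integrable_mult_right) auto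
  then show ?thesis
  proof (rule Bochner_Integration.integrable_bound)
    show "AE \<theta> in lborel. norm (1 / (q + \<kappa> * \<bar>\<theta>\<bar> powr \<alpha>)) \<le> norm (?g \<theta>)"
    proof (rule AE_I2)
      fix \<theta> :: real
      have d: "0 < q + \<kappa> * \<bar>\<theta>\<bar> powr \<alpha>" by (rule powr_add_const_ge[OF assms(1,2)])
      have "1 / (q + \<kappa> * \<bar>\<theta>\<bar> powr \<alpha>) \<le> ?g \<theta>"
      proof (cases "\<bar>\<theta>\<bar> \<le> 1")
        case True
        have "1 / (q + \<kappa> * \<bar>\<theta>\<bar> powr \<alpha>) \<le> 1 / q"
          using powr_add_const_ge[OF assms(1,2), of \<theta> \<alpha>] assms by (intro divide_left_mono mult_pos_pos) auto
        also have "\<dots> \<le> ?g \<theta>"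
          using True assms by (auto simp: abs_le_iff indicator_def)
        finally show ?thesis .
      next
        case False
        have "1 / (q + \<kappa> * \<bar>\<theta>\<bar> powr \<alpha>) \<le> 1 / (\<kappa> * \<bar>\<theta>\<bar> powr \<alpha>)"
          using False assms d by (intro divide_left_mono mult_pos_pos) auto
        also have "\<dots> = 1 / \<kappa> * \<bar>\<theta>\<bar> powr - \<alpha>" by (simp add: powr_minus field_simps)
        also have "\<dots> \<le> ?g \<theta>"
          using False assms by (auto simp: abs_if indicator_def)
        finally show ?thesis .
      qed
      then show "norm (1 / (q + \<kappa> * \<bar>\<theta>\<bar> powr \<alpha>)) \<le> norm (?g \<theta>)"
        using d by (auto simp: abs_if)
    qed
  qed auto
qed

lemma integrable_cos_resolvent_symbol:
  fixes q \<kappa> \<alpha> x :: real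
  assumes "0 < q" "0 < \<kappa>" "1 < \<alpha>"
  shows "integrable lborel (\<lambda>\<theta>. cos (x * \<theta>) / (q + \<kappa> * \<bar>\<theta>\<bar> powr \<alpha>))"
  using integrable_resolvent_symbol[OF assms]
  by (rule Bochner_Integration.integrable_bound)
     (use powr_add_const_ge[OF assms(1,2), of _ \<alpha>] in \<open>auto simp: divide_simps abs_if less_le_not_le\<close>)

text \<open>Up to the factor \<open>2 * pi\<close> this is the density of the \<open>q\<close>-resolvent of the symmetric stable
  process with characteristic exponent \<open>\<kappa> * \<bar>\<theta>\<bar> powr \<alpha>\<close>, by Fourier inversion.\<close>

definition resolvent_kernel :: "real \<Rightarrow> real \<Rightarrow> real \<Rightarrow> real \<Rightarrow> real" where
  "resolvent_kernel \<kappa> \<alpha> q x = (LBINT \<theta>. cos (x * \<theta>) / (q + \<kappa> * \<bar>\<theta>\<bar> powr \<alpha>))"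

lemma resolvent_kernel_scaling:
  assumes "0 < q" "0 < \<alpha>"
  shows "resolvent_kernel \<kappa> \<alpha> q x = q powr (1 / \<alpha> - 1) * resolvent_kernel \<kappa> \<alpha> 1 (q powr (1 / \<alpha>) * x)"
proof -
  define c where "c = q powr (1 / \<alpha>)"
  have c: "0 < c" "c powr \<alpha> = q" using assms by (auto simp: c_def powr_powr)
  have "resolvent_kernel \<kappa> \<alpha> q x = c * (LBINT \<theta>. cos (x * (c * \<theta>)) / (q + \<kappa> * \<bar>c * \<theta>\<bar> powr \<alpha>))"
    unfolding resolvent_kernel_def using c
    by (subst lborel_integral_real_affine[where c = c and t = 0]) auto
  also have "(LBINT \<theta>. cos (x * (c * \<theta>)) / (q + \<kappa> * \<bar>c * \<theta>\<bar> powr \<alpha>))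
      = (LBINT \<theta>. (cos ((c * x) * \<theta>) / (1 + \<kappa> * \<bar>\<theta>\<bar> powr \<alpha>)) / q)"
    using c assms
    by (intro Bochner_Integration.integral_cong)
       (auto simp: abs_mult powr_mult field_simps)
  also have "\<dots> = resolvent_kernel \<kappa> \<alpha> 1 (c * x) / q"
    unfolding resolvent_kernel_def by (rule integral_divide_zero)
  finally show ?thesis
    using assms by (simp add: c_def powr_diff)
qed

lemma resolvent_kernel_0_pos:
  assumes "0 < q" "0 < \<kappa>" "1 < \<alpha>"
  shows "0 < resolvent_kernel \<kappa> \<alpha> q 0"
proof -
  have I: "integrable lborel (\<lambda>\<theta>. 1 / (q + \<kappa> * \<bar>\<theta>\<bar> powr \<alpha>))" (is "integrable _ ?f")
    by (rule integrable_resolvent_symbol[OF assms])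
  have f: "0 < ?f \<theta>" for \<theta>
    using powr_add_const_ge[OF assms(1,2), of \<theta> \<alpha>] by simp
  have "integral\<^sup>L lborel ?f \<noteq> 0"
    using f by (subst integral_nonneg_eq_0_iff_AE[OF I]) (auto intro: less_imp_le simp: less_imp_neq[symmetric] eventually_False ae_filter_eq_bot_iff)
  moreover have "0 \<le> integral\<^sup>L lborel ?f"
    using f by (intro integral_nonneg_AE AE_I2 less_imp_le)
  ultimately show ?thesis unfolding resolvent_kernel_def by simp
qed

lemma resolvent_kernel_tendsto_at_0:
  fixes x :: "nat \<Rightarrow> real"
  assumes "0 < q" "0 < \<kappa>" "1 < \<alpha>" and x: "x \<longlonglongrightarrow> 0"
  shows "(\<lambda>n. resolvent_kernel \<kappa> \<alpha> q (x n)) \<longlonglongrightarrow> resolvent_kernel \<kappa> \<alpha> q 0"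
  unfolding resolvent_kernel_def
proof (rule integral_dominated_convergence[where w = "\<lambda>\<theta>. 1 / (q + \<kappa> * \<bar>\<theta>\<bar> powr \<alpha>)"])
  show "integrable lborel (\<lambda>\<theta>. 1 / (q + \<kappa> * \<bar>\<theta>\<bar> powr \<alpha>))"
    by (rule integrable_resolvent_symbol[OF assms(1-3)])
  show "AE \<theta> in lborel. (\<lambda>n. cos (x n * \<theta>) / (q + \<kappa> * \<bar>\<theta>\<bar> powr \<alpha>)) \<longlonglongrightarrow> cos (0 * \<theta>) / (q + \<kappa> * \<bar>\<theta>\<bar> powr \<alpha>)"
    using powr_add_const_ge[OF assms(1,2), of _ \<alpha>]
    by (intro AE_I2 tendsto_intros x) (metis less_irrefl)
  show "\<And>i. AE \<theta> in lborel. norm (cos (x i * \<theta>) / (q + \<kappa> * \<bar>\<theta>\<bar> powr \<alpha>)) \<le> 1 / (q + \<kappa> * \<bar>\<theta>\<bar> powr \<alpha>)"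
    using powr_add_const_ge[OF assms(1,2), of _ \<alpha>]
    by (intro AE_I2) (auto simp: divide_simps abs_if less_le_not_le)
qed auto

lemma lborel_integral_even:
  fixes f :: "real \<Rightarrow> real"
  assumes f: "integrable lborel f" and even: "\<And>x. f (- x) = f x"
  shows "integral\<^sup>L lborel f = 2 * (LBINT x:{0..}. f x)"
proof -
  have I: "set_integrable lborel A f" if "A \<in> sets lborel" for A
    using f that unfolding set_integrable_def by (rule integrable_mult_indicator[rotated])
  have "integral\<^sup>L lborel f = (LBINT x:{0..} \<union> {..<0}. f x)"
    unfolding set_lebesgue_integral_def by (intro Bochner_Integration.integral_cong) (auto simp: indicator_def)
  also have "\<dots> = (LBINT x:{0..}. f x) + (LBINT x:{..<0}. f x)"
    by (rule set_integral_Un) (auto intro!: I)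
  also have "(LBINT x:{..<0}. f x) = (LBINT x. indicator {..<0} (- x) * f (- x))"
    unfolding set_lebesgue_integral_def
    by (subst lborel_integral_real_affine[where c = "-1" and t = 0]) auto
  also have "\<dots> = (LBINT x:{0..}. f x)"
    unfolding set_lebesgue_integral_def
  proof (rule integral_cong_AE)
    show "AE x in lborel. indicator {..<0} (- x) * f (- x) = indicator {0..} x *\<^sub>R f x"
      using AE_lborel_singleton[of "0::real"]
      by eventually_elim (auto simp: even indicator_def)
  qed (use f[THEN borel_measurable_integrable] in auto)
  finally show ?thesis by simp
qed

section \<open>Rotating the resolvent integral to the imaginary axis\<close>

lemma norm_add_rotated_sq:
  fixes q r \<beta> :: real
  shows "(norm (of_real q + of_real r * cis \<beta>))\<^sup>2 = q\<^sup>2 + 2 * q * r * cos \<beta> + r\<^sup>2"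
proof -
  have "(norm (of_real q + of_real r * cis \<beta>))\<^sup>2 = (q + r * cos \<beta>)\<^sup>2 + (r * sin \<beta>)\<^sup>2"
    by (simp add: cmod_power2)
  also have "\<dots> = q\<^sup>2 + 2 * q * r * cos \<beta> + r\<^sup>2"
    using sin_cos_squared_add[of \<beta>] by algebra
  finally show ?thesis .
qed

text \<open>The distance of \<open>q\<close> from the line through \<open>0\<close> in the direction \<open>cis \<beta>\<close>.\<close>

lemma norm_add_rotated_ge:
  fixes q r \<beta> :: real
  assumes "0 \<le> q"
  shows "q * \<bar>sin \<beta>\<bar> \<le> norm (of_real q + of_real r * cis \<beta>)"
proof (rule power2_le_imp_le)
  have "(q * \<bar>sin \<beta>\<bar>)\<^sup>2 = (q * sin \<beta>)\<^sup>2" by (simp only: power_mult_distrib power2_abs)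
  also have "\<dots> \<le> (q * sin \<beta>)\<^sup>2 + (q * cos \<beta> + r)\<^sup>2" by simp
  also have "\<dots> = q\<^sup>2 + 2 * q * r * cos \<beta> + r\<^sup>2"
    using sin_cos_squared_add[of \<beta>] by algebra
  finally show "(q * \<bar>sin \<beta>\<bar>)\<^sup>2 \<le> (norm (of_real q + of_real r * cis \<beta>))\<^sup>2"
    by (simp only: norm_add_rotated_sq)
qed simp

lemma continuous_on_powr_of_real_quadrant:
  fixes \<alpha> :: real
  assumes "0 < \<alpha>"
  shows "continuous_on {z::complex. 0 \<le> Re z \<and> 0 \<le> Im z} (\<lambda>z. z powr of_real \<alpha>)"
  unfolding continuous_on_eq_continuous_within
proof
  fix z :: complex assume z: "z \<in> {z. 0 \<le> Re z \<and> 0 \<le> Im z}"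
  show "continuous (at z within {z. 0 \<le> Re z \<and> 0 \<le> Im z}) (\<lambda>z. z powr of_real \<alpha>)"
  proof (cases "z = 0")
    case True
    have "((\<lambda>z::complex. norm z powr \<alpha>) \<longlongrightarrow> 0) (at 0)"
      using assms by (intro tendsto_eq_intros tendsto_powr') (auto intro!: tendsto_eq_intros)
    then have "((\<lambda>z::complex. z powr of_real \<alpha>) \<longlongrightarrow> 0) (at 0)"
      by (subst tendsto_norm_zero_iff[symmetric]) (simp add: norm_powr_real_powr')
    then show ?thesis using True by (simp add: continuous_within Lim_at_imp_Lim_at_within)
  next
    case False
    then have "z \<notin> \<real>\<^sub>\<le>\<^sub>0" using z by (auto simp: complex_nonpos_Reals_iff complex_eq_iff)
    then have "isCont (\<lambda>z. z powr of_real \<alpha>) z" by (intro continuous_intros) auto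
    then show ?thesis by (rule continuous_at_imp_continuous_at_within)
  qed
qed

lemma powr_of_real_polar:
  fixes \<alpha> :: real and z :: complex
  assumes "z \<noteq> 0"
  shows "z powr of_real \<alpha> = of_real (norm z powr \<alpha>) * cis (\<alpha> * Arg z)"
proof -
  have "z powr of_real \<alpha> = exp (of_real (\<alpha> * ln (norm z))) * exp (\<i> * of_real (\<alpha> * Arg z))"
    using assms unfolding exp_add[symmetric] by (simp add: powr_def Ln_Arg algebra_simps)
  also have "\<dots> = of_real (norm z powr \<alpha>) * cis (\<alpha> * Arg z)"
    using assms by (simp only: exp_of_real cis_conv_exp powr_def norm_eq_zero if_False)
  finally show ?thesis .
qed

text \<open>For \<open>z \<noteq> 0\<close> in the quadrant, the argument of \<open>z powr \<alpha>\<close> lies in \<open>[0, pi * \<alpha> / 2]\<close>, which does not reach \<open>pi\<close> because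
  \<open>\<alpha> < 2\<close>. Hence the resolvent integrand has no pole in the closed first quadrant.\<close>

lemma powr_of_real_quadrant_not_negative:
  fixes \<alpha> :: real and z :: complex
  assumes "0 < \<alpha>" "\<alpha> < 2" "0 \<le> Re z" "0 \<le> Im z" "0 < q" "0 < \<kappa>"
  shows "of_real q + of_real \<kappa> * z powr of_real \<alpha> \<noteq> 0"
proof (cases "z = 0")
  case False
  define \<phi> where "\<phi> = Arg z"
  have \<phi>: "0 \<le> \<phi>" "\<phi> \<le> pi / 2"
    using assms Arg_less_0[of z] Arg_Re_nonneg[of z] unfolding \<phi>_def by auto
  have zp: "z powr of_real \<alpha> = of_real (norm z powr \<alpha>) * cis (\<alpha> * \<phi>)"
    unfolding \<phi>_def using False by (rule powr_of_real_polar)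
  have r: "0 < norm z powr \<alpha>" using False by simp
  show ?thesis
  proof (cases "\<phi> = 0")
    case True
    have "0 < Re (of_real q + of_real \<kappa> * z powr of_real \<alpha>)"
      using True assms r by (simp add: zp add_pos_pos)
    then show ?thesis by (metis less_irrefl zero_complex.sel(1))
  next
    case False
    have "\<alpha> * \<phi> \<le> \<alpha> * (pi / 2)" using \<phi> assms by (intro mult_left_mono) auto
    also have "\<dots> < pi" using assms by simp
    finally have "0 < sin (\<alpha> * \<phi>)" using False \<phi> assms by (intro sin_gt_zero) auto
    then have "0 < Im (of_real q + of_real \<kappa> * z powr of_real \<alpha>)"
      using r assms by (simp add: zp)
    then show ?thesis by (metis less_irrefl zero_complex.sel(2))
  qed
qed (use assms in auto)

text \<open>Cauchy's theorem on the triangle with vertices \<open>0\<close>, \<open>R\<close> and \<open>\<i> * R\<close>. The integrand is only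
  continuous at the corner \<open>0\<close>, where \<open>z powr \<alpha>\<close> has its branch point, so the version of the theorem
  that asks for holomorphy in the interior is used. The bound is the contribution of the
  hypotenuse; it is of order \<open>R powr (1 - \<alpha>)\<close>.\<close>

lemma quadrant_contour_estimate:
  fixes q \<kappa> \<alpha> x R :: real
  defines "f \<equiv> \<lambda>z. exp (\<i> * of_real x * z) / (of_real q + of_real \<kappa> * z powr of_real \<alpha>)"
  assumes q: "0 < q" "0 < \<kappa>" "0 < \<alpha>" "\<alpha> < 2" and x: "0 \<le> x" and R: "0 < R" "q < \<kappa> * (R / 2) powr \<alpha>"
  shows "norm (integral {0..R} (\<lambda>t. f (of_real t)) - \<i> * integral {0..R} (\<lambda>t. f (\<i> * of_real t)))
    \<le> 2 * R / (\<kappa> * (R / 2) powr \<alpha> - q)"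
proof -
  define Q where "Q = {z::complex. 0 \<le> Re z \<and> 0 \<le> Im z}"
  define D where "D = convex hull {0, of_real R, \<i> * of_real R}"
  have "convex Q" unfolding Q_def
    using convex_Int[OF convex_halfspace_Re_ge[of 0] convex_halfspace_Im_ge[of 0]]
    by (simp add: Collect_conj_eq)
  then have DQ: "D \<subseteq> Q" unfolding D_def using R by (intro hull_minimal) (auto simp: Q_def)
  have nz: "of_real q + of_real \<kappa> * z powr of_real \<alpha> \<noteq> 0" if "z \<in> Q" for z
    using powr_of_real_quadrant_not_negative[OF q(3,4) _ _ q(1,2), of z] that by (auto simp: Q_def)
  have cont: "continuous_on Q f"
    unfolding f_def using continuous_on_powr_of_real_quadrant[OF q(3), folded Q_def] nz
    by (intro continuous_on_divide continuous_on_add continuous_on_mult continuous_on_exp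
          continuous_on_const continuous_on_id ballI)
  have "interior D \<subseteq> interior {z. (1::complex) \<bullet> z \<ge> 0}"
    using DQ by (intro interior_mono) (auto simp: Q_def inner_complex_def)
  also have "\<dots> = {z. Re z > 0}"
    by (subst interior_halfspace_ge) (auto simp: inner_complex_def)
  finally have Dp: "interior D \<subseteq> {z. Re z > 0}" .
  have DiQ: "interior D \<subseteq> Q" using DQ interior_subset by blast
  have hol: "f holomorphic_on interior D"
    unfolding f_def using DiQ nz Dp
    by (intro holomorphic_intros) (auto simp: complex_nonpos_Reals_iff)
  have cauchy: "(f has_contour_integral 0) (linepath 0 (of_real R) +++ linepath (of_real R) (\<i> * of_real R) +++ linepath (\<i> * of_real R) 0)"
    using cont DQ hol unfolding D_def
    by (intro Cauchy_theorem_triangle_interior) (auto intro: continuous_on_subset)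
  have seg: "f contour_integrable_on linepath a b" if "a \<in> Q" "b \<in> Q" for a b
    using that cont \<open>convex Q\<close>
    by (intro contour_integrable_continuous_linepath continuous_on_subset[OF cont] closed_segment_subset)
  have inQ: "0 \<in> Q" "of_real R \<in> Q" "\<i> * of_real R \<in> Q" using R by (auto simp: Q_def)
  then have zero: "contour_integral (linepath 0 (of_real R)) f + contour_integral (linepath (of_real R) (\<i> * of_real R)) f
    + contour_integral (linepath (\<i> * of_real R) 0) f = 0"
    using contour_integral_unique[OF cauchy] seg[OF inQ(1,2)] seg[OF inQ(2,3)] seg[OF inQ(3,1)]
    by (simp add: contour_integrable_joinI add.assoc)
  have h: "contour_integral (linepath 0 (of_real R)) f = integral {0..R} (\<lambda>t. f (of_real t))"
    using has_contour_integral_integral[OF seg[OF inQ(1,2)]] R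
    by (subst (asm) has_contour_integral_linepath_Reals_iff) (auto dest!: integral_unique)
  have "contour_integral (linepath 0 (\<i> * of_real R)) f = \<i> * integral {0..R} (\<lambda>t. f (\<i> * of_real t))"
    using has_contour_integral_integral[OF seg[OF inQ(1,3)]] R
    by (subst (asm) has_contour_integral_linepath_same_Re_iff[where c = 0 and a = 0 and b = R])
       (auto dest!: integral_unique simp: Complex_eq)
  moreover have "continuous_on (closed_segment (\<i> * of_real R) 0) f"
    by (intro continuous_on_subset[OF cont] closed_segment_subset inQ \<open>convex Q\<close>)
  ultimately have v: "contour_integral (linepath (\<i> * of_real R) 0) f = - (\<i> * integral {0..R} (\<lambda>t. f (\<i> * of_real t)))"
    by (simp only: contour_integral_reverse_linepath)
  have "norm (contour_integral (linepath (of_real R) (\<i> * of_real R)) f) \<le>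
    1 / (\<kappa> * (R / 2) powr \<alpha> - q) * norm (\<i> * of_real R - of_real R)"
  proof (rule has_contour_integral_bound_linepath[OF has_contour_integral_integral[OF seg[OF inQ(2,3)]]])
    fix z assume z: "z \<in> closed_segment (of_real R) (\<i> * of_real R)"
    then obtain u where u: "0 \<le> u" "u \<le> 1" "z = (1 - u) *\<^sub>R of_real R + u *\<^sub>R (\<i> * of_real R)"
      by (auto simp: in_segment)
    have "Re z + Im z = R" "0 \<le> Im z" using u(1) R by (simp_all add: u(3) left_diff_distrib)
    then have "R / 2 \<le> norm z"
      using complex_Re_le_cmod[of z] abs_Im_le_cmod[of z] by linarith
    then have "(R / 2) powr \<alpha> \<le> norm z powr \<alpha>" using q R by (intro powr_mono2) auto
    then have "\<kappa> * (R / 2) powr \<alpha> - q \<le> \<kappa> * norm z powr \<alpha> - q" using q by auto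
    also have "\<dots> = norm (of_real \<kappa> * z powr of_real \<alpha>) - norm (of_real q :: complex)"
      using q by (simp add: norm_mult norm_powr_real_powr')
    also have "\<dots> \<le> norm (of_real q + of_real \<kappa> * z powr of_real \<alpha>)"
      by (subst add.commute[of "of_real q"]) (rule norm_diff_ineq)
    finally have "\<kappa> * (R / 2) powr \<alpha> - q \<le> norm (of_real q + of_real \<kappa> * z powr of_real \<alpha>)" .
    moreover have "norm (exp (\<i> * of_real x * z)) \<le> 1"
      using x \<open>0 \<le> Im z\<close> by simp
    ultimately show "norm (f z) \<le> 1 / (\<kappa> * (R / 2) powr \<alpha> - q)"
      using R unfolding f_def norm_divide by (intro frac_le) auto
  next
    show "0 \<le> 1 / (\<kappa> * (R / 2) powr \<alpha> - q)" using R by simp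
  qed
  also have "\<dots> \<le> 1 / (\<kappa> * (R / 2) powr \<alpha> - q) * (2 * R)"
    using R norm_triangle_ineq4[of "\<i> * of_real R" "of_real R"] by (intro mult_left_mono) (auto simp: norm_mult)
  finally have "norm (contour_integral (linepath (of_real R) (\<i> * of_real R)) f) \<le> 2 * R / (\<kappa> * (R / 2) powr \<alpha> - q)"
    by simp
  moreover have gen: "A - \<i> * V = - H" if "A + H + - (\<i> * V) = 0" for A H V :: complex
    using that unfolding eq_neg_iff_add_eq_0 by (simp add: algebra_simps)
  ultimately show ?thesis
    by (simp only: gen[OF zero[unfolded h v]] norm_minus_cancel)
qed

lemma set_integrable_exp_powr:
  fixes x p :: real
  assumes "0 < x" "0 \<le> p"
  shows "set_integrable lborel {0..} (\<lambda>s. exp (- x * s) * s powr p)"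
proof -
  have "(\<lambda>t. t powr p / exp t) absolutely_integrable_on {0::real..}"
    using Gamma_integral_real[of "p + 1"] assms
    by (intro nonnegative_absolutely_integrable_1) (auto simp: has_integral_iff)
  then have "integrable lborel (\<lambda>t::real. indicator {0..} t * (t powr p / exp t))"
    unfolding set_integrable_def by (subst (asm) integrable_completion) auto
  from lborel_integrable_real_affine[OF this, of x 0] assms
  have "integrable lborel (\<lambda>s. indicator {0..} (x * s) * ((x * s) powr p / exp (x * s)))" by simp
  then have "integrable lborel (\<lambda>s. (1 / x powr p) * (indicator {0..} (x * s) * ((x * s) powr p / exp (x * s))))"
    by (rule integrable_mult_right)
  also have "(\<lambda>s. (1 / x powr p) * (indicator {0..} (x * s) * ((x * s) powr p / exp (x * s)))) =
    (\<lambda>s. indicator {0..} s *\<^sub>R (exp (- x * s) * s powr p))"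
    using assms by (auto simp: fun_eq_iff powr_mult exp_minus field_simps indicator_def zero_le_mult_iff)
  finally show ?thesis unfolding set_integrable_def .
qed

lemma powr_of_real_imaginary:
  fixes \<alpha> s :: real
  assumes "0 < \<alpha>" "0 \<le> s"
  shows "(\<i> * of_real s) powr of_real \<alpha> = of_real (s powr \<alpha>) * cis (pi * \<alpha> / 2)"
proof (cases "s = 0")
  case False
  have "Arg (\<i> * of_real s) = pi / 2"
  proof (rule Arg_unique[where r = s])
    have "exp (\<i> * of_real (pi / 2)) = \<i>" by (simp only: cis_conv_exp[symmetric] cis_pi_half)
    then show "of_real s * exp (\<i> * of_real (pi / 2)) = \<i> * of_real s" by (simp only: mult.commute)
    show "0 < s" "- pi < pi / 2" "pi / 2 \<le> pi" using False assms by (auto intro: less_trans[of _ 0])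
  qed
  then show ?thesis
    using False assms powr_of_real_polar[of "\<i> * of_real s" \<alpha>] by (simp add: norm_mult mult.commute)
qed (use assms in auto)

text \<open>Both rays carry an absolutely convergent integral: on the real axis because \<open>\<alpha> > 1\<close>, on the
  imaginary axis because of the factor \<open>exp (- x * t)\<close>. So the hypotenuse estimate passes to the limit.\<close>

lemma rotate_resolvent_contour:
  fixes q \<kappa> \<alpha> x :: real
  assumes q: "0 < q" "0 < \<kappa>" "1 < \<alpha>" "\<alpha> < 2" and x: "0 < x"
  defines "h \<equiv> \<lambda>t. exp (\<i> * of_real (x * t)) / of_real (q + \<kappa> * t powr \<alpha>)"
    and "v \<equiv> \<lambda>t. of_real (exp (- x * t)) / (of_real q + of_real (\<kappa> * t powr \<alpha>) * cis (pi * \<alpha> / 2))"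
  shows "(LBINT t:{0..}. h t) = \<i> * (LBINT t:{0..}. v t)"
    and "set_integrable lborel {0..} h" "set_integrable lborel {0..} v"
proof -
  define \<beta> where "\<beta> = pi * \<alpha> / 2"
  let ?h = "\<lambda>t. exp (\<i> * of_real (x * t)) / of_real (q + \<kappa> * t powr \<alpha>) :: complex"
  let ?v = "\<lambda>t. of_real (exp (- x * t)) / (of_real q + of_real (\<kappa> * t powr \<alpha>) * cis \<beta>) :: complex"
  have hv: "h = ?h" "v = ?v" unfolding h_def v_def \<beta>_def by auto
  have \<beta>: "0 < sin \<beta>"
    unfolding \<beta>_def using q by (intro sin_gt_zero) auto
  have I1: "set_integrable lborel {0..} ?h"
    unfolding set_integrable_def
  proof (rule Bochner_Integration.integrable_bound[OF integrable_resolvent_symbol[OF q(1-3)]])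
    show "AE t in lborel. norm (indicat_real {0..} t *\<^sub>R (exp (\<i> * of_real (x * t)) / of_real (q + \<kappa> * t powr \<alpha>)))
          \<le> norm (1 / (q + \<kappa> * \<bar>t\<bar> powr \<alpha>))"
    proof (rule AE_I2)
      fix t
      have "norm (exp (\<i> * of_real (x * t)) / of_real (q + \<kappa> * t powr \<alpha>)) = 1 / \<bar>q + \<kappa> * t powr \<alpha>\<bar>"
        unfolding norm_divide norm_of_real by (simp only: norm_exp_i_times)
      then show "norm (indicat_real {0..} t *\<^sub>R (exp (\<i> * of_real (x * t)) / of_real (q + \<kappa> * t powr \<alpha>)))
          \<le> norm (1 / (q + \<kappa> * \<bar>t\<bar> powr \<alpha>))"
        by (cases "0 \<le> t") auto
    qed
  qed measurable
  have exp_int: "integrable lborel (\<lambda>t. 1 / (q * sin \<beta>) * (indicat_real {0..} t * (exp (- x * t) * t powr 0)))"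
    using set_integrable_exp_powr[OF x, of 0] unfolding set_integrable_def by simp
  have I2: "set_integrable lborel {0..} ?v"
    unfolding set_integrable_def
  proof (rule Bochner_Integration.integrable_bound[OF exp_int])
    show "AE t in lborel. norm (indicat_real {0..} t *\<^sub>R ?v t)
          \<le> norm (1 / (q * sin \<beta>) * (indicat_real {0..} t * (exp (- x * t) * t powr 0)))"
      using AE_lborel_singleton[of "0::real"]
    proof eventually_elim
      case (elim t)
      have "q * sin \<beta> \<le> norm (of_real q + of_real (\<kappa> * t powr \<alpha>) * cis \<beta>)"
        using norm_add_rotated_ge[of q \<beta> "\<kappa> * t powr \<alpha>"] q \<beta> by simp
      then have "norm (?v t) \<le> exp (- x * t) / (q * sin \<beta>)"
        unfolding norm_divide norm_of_real using q \<beta> by (intro frac_le) auto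
      then show ?case using elim q \<beta> by (auto simp: indicator_def)
    qed
  qed (unfold cis.ctr complex_eq_iff, measurable)
  define f where "f = (\<lambda>z. exp (\<i> * of_real x * z) / (of_real q + of_real \<kappa> * z powr of_real \<alpha>))"
  have fh: "f (of_real t) = ?h t" if "0 \<le> t" for t
    using that by (simp add: f_def powr_of_real mult.assoc)
  have fv: "f (\<i> * of_real t) = ?v t" if "0 \<le> t" for t
  proof -
    have "\<i> * of_real x * (\<i> * of_real t) = of_real (- x * t)" by (simp add: complex_eq_iff)
    then have e: "exp (\<i> * of_real x * (\<i> * of_real t)) = of_real (exp (- x * t))" by (simp only: exp_of_real)
    have p: "(\<i> * of_real t) powr of_real \<alpha> = of_real (t powr \<alpha>) * cis \<beta>"
      unfolding \<beta>_def using powr_of_real_imaginary[of \<alpha> t] that q by simp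
    show ?thesis unfolding f_def e p by (simp only: of_real_mult mult.assoc)
  qed
  have lim: "((\<lambda>R. (LBINT t:{0..R}. ?h t) - \<i> * (LBINT t:{0..R}. ?v t)) \<longlongrightarrow> (LBINT t:{0..}. ?h t) - \<i> * (LBINT t:{0..}. ?v t)) at_top"
    by (intro tendsto_intros tendsto_set_lebesgue_integral_at_top I1 I2) auto
  have "((\<lambda>R. (LBINT t:{0..R}. ?h t) - \<i> * (LBINT t:{0..R}. ?v t)) \<longlongrightarrow> 0) at_top"
  proof (rule Lim_null_comparison)
    have 1: "filterlim (\<lambda>R. \<kappa> * (R / 2) powr \<alpha>) at_top at_top"
      using q by real_asymp
    show "\<forall>\<^sub>F R in at_top. norm ((LBINT t:{0..R}. ?h t) - \<i> * (LBINT t:{0..R}. ?v t)) \<le> 2 * R / (\<kappa> * (R / 2) powr \<alpha> - q)"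
      using eventually_gt_at_top[of 0] filterlim_at_top_dense[THEN iffD1, OF 1, rule_format, of q]
    proof eventually_elim
      case (elim R)
      have "(LBINT t:{0..R}. ?h t) = integral {0..R} ?h"
        by (intro set_borel_integral_eq_integral set_integrable_subset[OF I1]) auto
      also have "\<dots> = integral {0..R} (\<lambda>t. f (of_real t))"
        by (intro Henstock_Kurzweil_Integration.integral_cong) (auto simp: fh)
      moreover have "(LBINT t:{0..R}. ?v t) = integral {0..R} ?v"
        by (intro set_borel_integral_eq_integral set_integrable_subset[OF I2]) auto
      moreover have "\<dots> = integral {0..R} (\<lambda>t. f (\<i> * of_real t))"
        by (intro Henstock_Kurzweil_Integration.integral_cong) (auto simp: fv)
      ultimately show ?case
        using quadrant_contour_estimate[of q \<kappa> \<alpha> x R] elim q x unfolding f_def by simp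
    qed
    show "((\<lambda>R. 2 * R / (\<kappa> * (R / 2) powr \<alpha> - q)) \<longlongrightarrow> 0) at_top"
      using q by real_asymp
  qed
  from tendsto_unique[OF _ lim this]
  show "(LBINT t:{0..}. h t) = \<i> * (LBINT t:{0..}. v t)" by (simp add: hv)
  show "set_integrable lborel {0..} h" "set_integrable lborel {0..} v"
    using I1 I2 by (simp_all only: hv)
qed

text \<open>The kernel is an integral over the real axis of the real part of \<open>exp (\<i> * x * \<theta>) / (q + \<kappa> * \<theta> powr \<alpha>)\<close>.
  After the rotation this becomes minus the imaginary part of \<open>exp (- x * s) / (q + r * cis \<beta>)\<close> with
  \<open>r = \<kappa> * s powr \<alpha>\<close>, a nonoscillating integrand.\<close>

lemma resolvent_kernel_rotated:
  fixes q \<kappa> \<alpha> x :: real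
  assumes q: "0 < q" "0 < \<kappa>" "1 < \<alpha>" "\<alpha> < 2" and x: "0 < x"
  defines "\<beta> \<equiv> pi * \<alpha> / 2"
  shows "resolvent_kernel \<kappa> \<alpha> q x = 2 * (LBINT s:{0..}. exp (- x * s) * (\<kappa> * s powr \<alpha> * sin \<beta>) /
     (q\<^sup>2 + 2 * q * (\<kappa> * s powr \<alpha>) * cos \<beta> + (\<kappa> * s powr \<alpha>)\<^sup>2))"
proof -
  note aux = rotate_resolvent_contour[OF q x, folded \<beta>_def]
  have Re_set: "(LBINT t:{0..}. Re (g t)) = Re (LBINT t:{0..}. g t)" if "set_integrable lborel {0..} g" for g :: "real \<Rightarrow> complex"
    using integral_Re[OF that[unfolded set_integrable_def]] unfolding set_lebesgue_integral_def by simp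
  have Im_set: "(LBINT t:{0..}. Im (g t)) = Im (LBINT t:{0..}. g t)" if "set_integrable lborel {0..} g" for g :: "real \<Rightarrow> complex"
    using integral_Im[OF that[unfolded set_integrable_def]] unfolding set_lebesgue_integral_def by simp
  have "resolvent_kernel \<kappa> \<alpha> q x = 2 * (LBINT \<theta>:{0..}. cos (x * \<theta>) / (q + \<kappa> * \<bar>\<theta>\<bar> powr \<alpha>))"
    unfolding resolvent_kernel_def
    by (rule lborel_integral_even[OF integrable_cos_resolvent_symbol[OF q(1-3)]]) auto
  also have "(LBINT \<theta>:{0..}. cos (x * \<theta>) / (q + \<kappa> * \<bar>\<theta>\<bar> powr \<alpha>)) =
    (LBINT t:{0..}. Re (exp (\<i> * of_real (x * t)) / of_real (q + \<kappa> * t powr \<alpha>)))"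
  proof (intro set_lebesgue_integral_cong allI impI)
    fix t :: real assume "t \<in> {0..}"
    then show "cos (x * t) / (q + \<kappa> * \<bar>t\<bar> powr \<alpha>) = Re (exp (\<i> * of_real (x * t)) / of_real (q + \<kappa> * t powr \<alpha>))"
      by (simp only: Re_divide_of_real cis_conv_exp[symmetric] cis.sel) simp
  qed auto
  also have "\<dots> = Re (\<i> * (LBINT t:{0..}. of_real (exp (- x * t)) / (of_real q + of_real (\<kappa> * t powr \<alpha>) * cis \<beta>)))"
    by (simp only: Re_set[OF aux(2)] aux(1))
  also have "\<dots> = - (LBINT t:{0..}. Im (of_real (exp (- x * t)) / (of_real q + of_real (\<kappa> * t powr \<alpha>) * cis \<beta>)))"
    by (simp only: Re_i_times Im_set[OF aux(3)])
  also have "\<dots> = (LBINT t:{0..}. - Im (of_real (exp (- x * t)) / (of_real q + of_real (\<kappa> * t powr \<alpha>) * cis \<beta>)))"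
    unfolding set_lebesgue_integral_def by simp
  also have "\<dots> = (LBINT s:{0..}. exp (- x * s) * (\<kappa> * s powr \<alpha> * sin \<beta>) /
     (q\<^sup>2 + 2 * q * (\<kappa> * s powr \<alpha>) * cos \<beta> + (\<kappa> * s powr \<alpha>)\<^sup>2))"
  proof (intro set_lebesgue_integral_cong allI impI)
    fix t :: real
    define r where "r = \<kappa> * t powr \<alpha>"
    have "Im (of_real (exp (- x * t)) / (of_real q + of_real r * cis \<beta>)) =
      - (exp (- x * t) * (r * sin \<beta>)) / (norm (of_real q + of_real r * cis \<beta>))\<^sup>2"
      unfolding Im_divide cmod_power2[symmetric] by simp
    then show "- Im (of_real (exp (- x * t)) / (of_real q + of_real (\<kappa> * t powr \<alpha>) * cis \<beta>)) =
      exp (- x * t) * (\<kappa> * t powr \<alpha> * sin \<beta>) / (q\<^sup>2 + 2 * q * (\<kappa> * t powr \<alpha>) * cos \<beta> + (\<kappa> * t powr \<alpha>)\<^sup>2)"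
      unfolding norm_add_rotated_sq r_def by simp
  qed auto
  finally show ?thesis .
qed

section \<open>Second-order asymptotics of the resolvent kernel\<close>

lemma rotated_denominator_bounds:
  fixes q r \<beta> :: real
  assumes "0 < q" "0 < sin \<beta>"
  defines "D \<equiv> q\<^sup>2 + 2 * q * r * cos \<beta> + r\<^sup>2"
  shows "0 < D" "q\<^sup>2 / D \<le> 1 / (sin \<beta>)\<^sup>2"
proof -
  have "(q * sin \<beta>)\<^sup>2 + (q * cos \<beta> + r)\<^sup>2 = D"
    unfolding D_def using sin_cos_squared_add[of \<beta>] by algebra
  then have "(q * sin \<beta>)\<^sup>2 \<le> D" using zero_le_power2[of "q * cos \<beta> + r"] by linarith
  moreover have "0 < (q * sin \<beta>)\<^sup>2" using assms by simp
  ultimately show D: "0 < D" by linarith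
  from \<open>(q * sin \<beta>)\<^sup>2 \<le> D\<close> have "q\<^sup>2 * (sin \<beta>)\<^sup>2 \<le> D" by (simp only: power_mult_distrib)
  then show "q\<^sup>2 / D \<le> 1 / (sin \<beta>)\<^sup>2"
    using D assms(1,2) by (simp add: divide_simps)
qed

lemma set_integral_exp_powr_pos:
  fixes x p :: real
  assumes "0 < x" "0 \<le> p"
  shows "0 < (LBINT s:{0..}. exp (- x * s) * s powr p)"
proof -
  note I = set_integrable_exp_powr[OF assms, unfolded set_integrable_def]
  have "(LBINT s:{0..}. exp (- x * s) * s powr p) \<noteq> 0"
  proof
    assume "(LBINT s:{0..}. exp (- x * s) * s powr p) = 0"
    then have "AE s in lborel. indicator {0..} s *\<^sub>R (exp (- x * s) * s powr p) = 0"
      unfolding set_lebesgue_integral_def by (subst (asm) integral_nonneg_eq_0_iff_AE[OF I]) auto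
    then have "AE s in lborel. s \<notin> {1..2::real}"
      by eventually_elim (auto simp: indicator_def split: if_splits)
    then have "emeasure lborel {1..2::real} = 0"
      by (subst (asm) AE_iff_measurable[of "{1..2}"]) auto
    then show False by simp
  qed
  moreover have "0 \<le> (LBINT s:{0..}. exp (- x * s) * s powr p)"
    unfolding set_lebesgue_integral_def by (intro integral_nonneg_AE AE_I2) auto
  ultimately show ?thesis by simp
qed

text \<open>With \<open>r = \<kappa> * s powr \<alpha>\<close> and \<open>D\<close> the denominator in the rotated integral,
  \<open>q * (q\<^sup>2 / D - 1) = (- 2 * r * cos \<beta> - r\<^sup>2 / q) * (q\<^sup>2 / D)\<close>, and \<open>q\<^sup>2 / D\<close> is bounded by
  \<open>1 / (sin \<beta>)\<^sup>2\<close> and tends to \<open>1\<close>. By dominated convergence \<open>q * (q\<^sup>2 * W - A)\<close> tends to an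
  integral with the sign of \<open>- cos \<beta>\<close>, which is positive as \<open>\<beta> = pi * \<alpha> / 2\<close> lies between
  \<open>pi / 2\<close> and \<open>pi\<close>.\<close>

lemma resolvent_kernel_asymptotics:
  fixes \<kappa> \<alpha> x :: real
  assumes \<kappa>: "0 < \<kappa>" and \<alpha>: "1 < \<alpha>" "\<alpha> < 2" and x: "0 < x"
  obtains A where "0 < A" "((\<lambda>q. q\<^sup>2 * resolvent_kernel \<kappa> \<alpha> q x) \<longlongrightarrow> A) at_top"
    "\<forall>\<^sub>F q in at_top. A < q\<^sup>2 * resolvent_kernel \<kappa> \<alpha> q x"
proof -
  define \<beta> where "\<beta> = pi * \<alpha> / 2"
  have sin: "0 < sin \<beta>"
    unfolding \<beta>_def using \<alpha> by (intro sin_gt_zero) auto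
  have "pi / 2 < \<beta>" "\<beta> < pi" unfolding \<beta>_def using \<alpha> by auto
  then have cos: "cos \<beta> < 0"
    using cos_monotone_0_pi[of "pi / 2" \<beta>] by auto
  define r where "r s = \<kappa> * s powr \<alpha>" for s
  define D where "D q s = q\<^sup>2 + 2 * q * r s * cos \<beta> + (r s)\<^sup>2" for q s
  have r: "0 \<le> r s" for s using \<kappa> by (simp add: r_def)
  have [measurable]: "r \<in> borel_measurable borel" unfolding r_def by measurable
  have [measurable]: "D q \<in> borel_measurable borel" for q unfolding D_def by measurable
  note Db = rotated_denominator_bounds[OF _ sin, of _ "r _", folded D_def]
  \<comment> \<open>The dominating function for all \<open>q \<ge> 1\<close>; bounding \<open>r\<^sup>2 / q\<close> by \<open>r\<^sup>2\<close> is what needs \<open>q \<ge> 1\<close>.\<close>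
  define w where "w s = indicator {0..} s * (exp (- x * s) * r s * (2 * r s + (r s)\<^sup>2) / (sin \<beta>)\<^sup>2)" for s
  have w_int: "integrable lborel w"
  proof -
    have "integrable lborel (\<lambda>s. 2 * \<kappa>\<^sup>2 / (sin \<beta>)\<^sup>2 * (indicator {0..} s *\<^sub>R (exp (- x * s) * s powr (2 * \<alpha>)))
      + \<kappa> ^ 3 / (sin \<beta>)\<^sup>2 * (indicator {0..} s *\<^sub>R (exp (- x * s) * s powr (3 * \<alpha>))))"
      using \<alpha> by (intro Bochner_Integration.integrable_add integrable_mult_right
        set_integrable_exp_powr[OF x, unfolded set_integrable_def]) auto
    also have "(\<lambda>s. 2 * \<kappa>\<^sup>2 / (sin \<beta>)\<^sup>2 * (indicator {0..} s *\<^sub>R (exp (- x * s) * s powr (2 * \<alpha>)))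
      + \<kappa> ^ 3 / (sin \<beta>)\<^sup>2 * (indicator {0..} s *\<^sub>R (exp (- x * s) * s powr (3 * \<alpha>)))) = w"
    proof
      fix s
      have "s powr (2 * \<alpha>) = (s powr \<alpha>)\<^sup>2" "s powr (3 * \<alpha>) = (s powr \<alpha>) ^ 3"
        by (simp_all add: power2_eq_square power3_eq_cube powr_add[symmetric])
      then show "2 * \<kappa>\<^sup>2 / (sin \<beta>)\<^sup>2 * (indicator {0..} s *\<^sub>R (exp (- x * s) * s powr (2 * \<alpha>)))
      + \<kappa> ^ 3 / (sin \<beta>)\<^sup>2 * (indicator {0..} s *\<^sub>R (exp (- x * s) * s powr (3 * \<alpha>))) = w s"
        unfolding w_def r_def by (simp add: power2_eq_square power3_eq_cube algebra_simps add_divide_distrib)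
    qed
    finally show ?thesis .
  qed
  define f where "f s = indicator {0..} s * (exp (- x * s) * r s * sin \<beta>)" for s
  define g where "g q s = indicator {0..} s * (exp (- x * s) * (r s * sin \<beta>) / D q s)" for q s
  have [measurable]: "f \<in> borel_measurable borel" "g q \<in> borel_measurable borel" for q
    unfolding f_def g_def by measurable
  have f_int: "integrable lborel f"
  proof -
    have "integrable lborel (\<lambda>s. \<kappa> * sin \<beta> * (indicator {0..} s *\<^sub>R (exp (- x * s) * s powr \<alpha>)))"
      using \<alpha> by (intro integrable_mult_right set_integrable_exp_powr[OF x, unfolded set_integrable_def]) auto
    also have "(\<lambda>s. \<kappa> * sin \<beta> * (indicator {0..} s *\<^sub>R (exp (- x * s) * s powr \<alpha>))) = f"
      by (auto simp: f_def r_def)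
    finally show ?thesis .
  qed
  have W: "resolvent_kernel \<kappa> \<alpha> q x = 2 * integral\<^sup>L lborel (g q)" if "0 < q" for q
    unfolding resolvent_kernel_rotated[OF that \<kappa> \<alpha> x] set_lebesgue_integral_def g_def D_def r_def \<beta>_def
    by simp
  have expand: "q * (q\<^sup>2 * g q s - f s) = f s * (- 2 * r s * cos \<beta> - (r s)\<^sup>2 / q) * (q\<^sup>2 / D q s)" if "0 < q" for q s
  proof -
    have "q * (q\<^sup>2 / D q s - 1) = (- 2 * r s * cos \<beta> - (r s)\<^sup>2 / q) * (q\<^sup>2 / D q s)"
      using Db(1)[OF that, of s] that
      by (simp add: field_simps) (simp add: D_def power2_eq_square algebra_simps)
    moreover have "q\<^sup>2 * g q s = f s * (q\<^sup>2 / D q s)" by (simp add: g_def f_def)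
    then have "q * (q\<^sup>2 * g q s - f s) = f s * (q * (q\<^sup>2 / D q s - 1))" by (simp only:) (simp add: algebra_simps)
    ultimately show ?thesis by (simp only: mult.assoc)
  qed
  have f0: "0 \<le> f s" for s using r[of s] sin by (simp add: f_def)
  have dom: "norm (q * (q\<^sup>2 * g q s - f s)) \<le> w s" if "1 \<le> q" for q s
  proof -
    have q: "0 < q" using that by simp
    have "\<bar>- 2 * r s * cos \<beta> - (r s)\<^sup>2 / q\<bar> \<le> 2 * r s * \<bar>cos \<beta>\<bar> + (r s)\<^sup>2 / q"
      using r[of s] q by (intro order_trans[OF abs_triangle_ineq4]) (simp add: abs_mult)
    also have "\<dots> \<le> 2 * r s * 1 + (r s)\<^sup>2 / 1"
      using r[of s] q that by (intro add_mono mult_left_mono divide_left_mono) (auto simp: abs_cos_le_one)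
    finally have 1: "\<bar>- 2 * r s * cos \<beta> - (r s)\<^sup>2 / q\<bar> \<le> 2 * r s + (r s)\<^sup>2" by simp
    have "norm (q * (q\<^sup>2 * g q s - f s)) = f s * \<bar>- 2 * r s * cos \<beta> - (r s)\<^sup>2 / q\<bar> * (q\<^sup>2 / D q s)"
      unfolding expand[OF q] using f0[of s] Db(1)[OF q, of s] by (simp add: abs_mult)
    also have "\<dots> \<le> f s * (2 * r s + (r s)\<^sup>2) * (1 / (sin \<beta>)\<^sup>2)"
      using 1 f0[of s] r[of s] Db[OF q, of s] by (intro mult_mono mult_nonneg_nonneg) auto
    also have "\<dots> \<le> w s"
    proof -
      have "f s \<le> indicator {0..} s * (exp (- x * s) * r s)"
        using r[of s] mult_left_mono[OF sin_le_one[of \<beta>], of "r s"] by (auto simp: f_def indicator_def)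
      then have "f s * ((2 * r s + (r s)\<^sup>2) / (sin \<beta>)\<^sup>2) \<le> indicator {0..} s * (exp (- x * s) * r s) * ((2 * r s + (r s)\<^sup>2) / (sin \<beta>)\<^sup>2)"
        using r[of s] by (intro mult_right_mono) auto
      then show ?thesis by (simp add: w_def mult.assoc)
    qed
    finally show ?thesis .
  qed
  have q2D: "((\<lambda>q. q\<^sup>2 / D q s) \<longlongrightarrow> 1) at_top" for s
    unfolding D_def by real_asymp
  have lim: "((\<lambda>q. LINT s|lborel. q * (q\<^sup>2 * g q s - f s)) \<longlongrightarrow> (LINT s|lborel. f s * (- 2 * r s * cos \<beta>))) at_top"
  proof (rule integral_dominated_convergence_at_top[OF _ _ w_int])
    show "\<forall>\<^sub>F q in at_top. AE s in lborel. norm (q * (q\<^sup>2 * g q s - f s)) \<le> w s"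
      using eventually_ge_at_top[of 1] by eventually_elim (use dom in auto)
    show "AE s in lborel. ((\<lambda>q. q * (q\<^sup>2 * g q s - f s)) \<longlongrightarrow> f s * (- 2 * r s * cos \<beta>)) at_top"
    proof (rule AE_I2, rule Lim_transform_eventually)
      fix s
      have "((\<lambda>q. f s * (- 2 * r s * cos \<beta> - (r s)\<^sup>2 / q) * (q\<^sup>2 / D q s)) \<longlongrightarrow> f s * (- 2 * r s * cos \<beta> - 0) * 1) at_top"
        by (intro tendsto_intros q2D tendsto_divide_0[OF tendsto_const] filterlim_at_top_imp_at_infinity filterlim_ident)
      then show "((\<lambda>q. f s * (- 2 * r s * cos \<beta> - (r s)\<^sup>2 / q) * (q\<^sup>2 / D q s)) \<longlongrightarrow> f s * (- 2 * r s * cos \<beta>)) at_top"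
        by simp
      show "\<forall>\<^sub>F q in at_top. f s * (- 2 * r s * cos \<beta> - (r s)\<^sup>2 / q) * (q\<^sup>2 / D q s) = q * (q\<^sup>2 * g q s - f s)"
        using eventually_gt_at_top[of 0] by eventually_elim (simp only: expand)
    qed
  qed measurable
  have B: "0 < (LINT s|lborel. f s * (- 2 * r s * cos \<beta>))"
  proof -
    have "(LINT s|lborel. f s * (- 2 * r s * cos \<beta>)) = (LINT s|lborel. (- 2 * cos \<beta> * sin \<beta> * \<kappa>\<^sup>2) * (indicator {0..} s *\<^sub>R (exp (- x * s) * s powr (2 * \<alpha>))))"
    proof (intro Bochner_Integration.integral_cong refl)
      fix s
      have "s powr (2 * \<alpha>) = (s powr \<alpha>)\<^sup>2" by (simp add: power2_eq_square powr_add[symmetric])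
      then show "f s * (- 2 * r s * cos \<beta>) = (- 2 * cos \<beta> * sin \<beta> * \<kappa>\<^sup>2) * (indicator {0..} s *\<^sub>R (exp (- x * s) * s powr (2 * \<alpha>)))"
        by (simp add: f_def r_def power2_eq_square algebra_simps)
    qed
    also have "\<dots> = (- 2 * cos \<beta> * sin \<beta> * \<kappa>\<^sup>2) * (LBINT s:{0..}. exp (- x * s) * s powr (2 * \<alpha>))"
      unfolding set_lebesgue_integral_def by simp
    also have "0 < \<dots>"
    proof (rule mult_pos_pos)
      show "0 < - 2 * cos \<beta> * sin \<beta> * \<kappa>\<^sup>2"
        using cos sin \<kappa> by (simp add: mult_neg_pos)
      show "0 < (LBINT s:{0..}. exp (- x * s) * s powr (2 * \<alpha>))"
        using \<alpha> by (intro set_integral_exp_powr_pos x) auto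
    qed
    finally show ?thesis .
  qed
  have A: "0 < integral\<^sup>L lborel f"
  proof -
    have "integral\<^sup>L lborel f = (LINT s|lborel. (sin \<beta> * \<kappa>) * (indicator {0..} s *\<^sub>R (exp (- x * s) * s powr \<alpha>)))"
      by (intro Bochner_Integration.integral_cong refl) (simp add: f_def r_def)
    also have "\<dots> = (sin \<beta> * \<kappa>) * (LBINT s:{0..}. exp (- x * s) * s powr \<alpha>)"
      unfolding set_lebesgue_integral_def by simp
    also have "0 < \<dots>"
      using sin \<kappa> \<alpha> by (intro mult_pos_pos set_integral_exp_powr_pos x) auto
    finally show ?thesis .
  qed
  have g_int: "integrable lborel (g q)" if "1 \<le> q" for q
  proof -
    have "integrable lborel (\<lambda>s. q * (q\<^sup>2 * g q s - f s))"
      by (rule Bochner_Integration.integrable_bound[OF w_int]) (use dom[OF that] in \<open>auto intro: order_trans[OF _ abs_ge_self]\<close>)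
    note h = this
    have "integrable lborel (\<lambda>s. (1 / q * (q * (q\<^sup>2 * g q s - f s)) + f s) * (1 / q\<^sup>2))"
      by (rule integrable_mult_left, rule Bochner_Integration.integrable_add, rule integrable_mult_right, rule h, rule f_int)
    also have "(\<lambda>s. (1 / q * (q * (q\<^sup>2 * g q s - f s)) + f s) * (1 / q\<^sup>2)) = g q" using that by auto
    finally show ?thesis .
  qed
  have ev: "\<forall>\<^sub>F q in at_top. (LINT s|lborel. q * (q\<^sup>2 * g q s - f s)) = q * ((q\<^sup>2 * resolvent_kernel \<kappa> \<alpha> q x - 2 * integral\<^sup>L lborel f) / 2)"
    using eventually_ge_at_top[of 1]
  proof eventually_elim
    case (elim q)
    show ?case
      using g_int[OF elim] f_int elim W[of q] by (simp add: algebra_simps)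
  qed
  from Lim_transform_eventually[OF lim ev]
  have lim2: "((\<lambda>q. q * ((q\<^sup>2 * resolvent_kernel \<kappa> \<alpha> q x - 2 * integral\<^sup>L lborel f) / 2)) \<longlongrightarrow> (LINT s|lborel. f s * (- 2 * r s * cos \<beta>))) at_top" .
  have inv: "((\<lambda>q::real. 2 / q) \<longlongrightarrow> 0) at_top" by real_asymp
  show ?thesis
  proof (rule that)
    show "0 < 2 * integral\<^sup>L lborel f" using A by simp
    show "((\<lambda>q. q\<^sup>2 * resolvent_kernel \<kappa> \<alpha> q x) \<longlongrightarrow> 2 * integral\<^sup>L lborel f) at_top"
    proof (rule Lim_transform_eventually)
      show "((\<lambda>q. q * ((q\<^sup>2 * resolvent_kernel \<kappa> \<alpha> q x - 2 * integral\<^sup>L lborel f) / 2) * (2 / q) + 2 * integral\<^sup>L lborel f) \<longlongrightarrow> 2 * integral\<^sup>L lborel f) at_top"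
        using tendsto_add[OF tendsto_mult[OF lim2 inv] tendsto_const, of "2 * integral\<^sup>L lborel f"] by simp
      show "\<forall>\<^sub>F q in at_top. q * ((q\<^sup>2 * resolvent_kernel \<kappa> \<alpha> q x - 2 * integral\<^sup>L lborel f) / 2) * (2 / q) + 2 * integral\<^sup>L lborel f = q\<^sup>2 * resolvent_kernel \<kappa> \<alpha> q x"
        using eventually_gt_at_top[of 0] by eventually_elim simp
    qed
    show "\<forall>\<^sub>F q in at_top. 2 * integral\<^sup>L lborel f < q\<^sup>2 * resolvent_kernel \<kappa> \<alpha> q x"
      using order_tendstoD(1)[OF lim2 B] eventually_gt_at_top[of 0]
      by eventually_elim (simp add: zero_less_mult_iff)
  qed
qed

section \<open>Fourier transforms of measures vanishing near a point\<close>

lemma integral_gaussian_cos: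
  fixes n z :: real
  assumes n: "0 < n"
  shows "(LBINT \<theta>. exp (- (\<theta> / n)\<^sup>2 / 2) * cos (\<theta> * z)) = n * sqrt (2 * pi) * exp (- (n * z)\<^sup>2 / 2)"
    and "integrable lborel (\<lambda>\<theta>. exp (- (\<theta> / n)\<^sup>2 / 2))"
proof -
  have I: "integrable lborel (\<lambda>x. std_normal_density x)"
    using integrable_std_normal_moment[of 0] by simp
  have "(LBINT x. std_normal_density x * cos (t * x)) = exp (- (t^2) / 2)" for t
  proof -
    have "complex_of_real (exp (- (t^2) / 2)) = (CLBINT x. of_real (std_normal_density x) * iexp (t * x))"
      unfolding char_std_normal_distribution[THEN fun_cong, symmetric] char_def
      by (subst integral_density) (auto simp: normal_density_nonneg scaleR_conv_of_real)
    then have "exp (- (t^2) / 2) = Re (CLBINT x. of_real (std_normal_density x) * iexp (t * x))"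
      by (metis Re_complex_of_real)
    also have "\<dots> = (LBINT x. Re (of_real (std_normal_density x) * iexp (t * x)))"
      by (intro integral_Re[symmetric] Bochner_Integration.integrable_bound[OF I]) (auto simp: norm_mult)
    also have "\<dots> = (LBINT x. std_normal_density x * cos (t * x))"
    proof (intro Bochner_Integration.integral_cong refl)
      fix x
      have "Re (iexp (t * x)) = cos (t * x)" by (simp only: cis_conv_exp[symmetric] cis.sel)
      then show "Re (of_real (std_normal_density x) * iexp (t * x)) = std_normal_density x * cos (t * x)"
        by (simp only: times_complex.sel Re_complex_of_real Im_complex_of_real mult_zero_left diff_zero)
    qed
    finally show ?thesis by simp
  qed
  then have g: "(LBINT x. std_normal_density x * cos ((n * z) * x)) = exp (- (n * z)\<^sup>2 / 2)" .
  have sd: "exp (- x\<^sup>2 / 2) = sqrt (2 * pi) * std_normal_density x" for x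
    unfolding std_normal_density_def by simp
  have "(LBINT \<theta>. exp (- (\<theta> / n)\<^sup>2 / 2) * cos (\<theta> * z)) = n * (LBINT x. exp (- x\<^sup>2 / 2) * cos ((n * z) * x))"
    using n by (subst lborel_integral_real_affine[where c = n and t = 0]) (auto simp: mult_ac)
  also have "\<dots> = n * (LBINT x. sqrt (2 * pi) * (std_normal_density x * cos ((n * z) * x)))"
    unfolding sd by (simp add: mult_ac)
  also have "\<dots> = n * (sqrt (2 * pi) * exp (- (n * z)\<^sup>2 / 2))"
    unfolding integral_mult_right_zero g ..
  finally show "(LBINT \<theta>. exp (- (\<theta> / n)\<^sup>2 / 2) * cos (\<theta> * z)) = n * sqrt (2 * pi) * exp (- (n * z)\<^sup>2 / 2)"
    by simp
  have "integrable lborel (\<lambda>x. sqrt (2 * pi) * std_normal_density x)"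
    using I by simp
  from lborel_integrable_real_affine[OF this, of "1 / n" 0] n
  have "integrable lborel (\<lambda>x. sqrt (2 * pi) * std_normal_density (x / n))" by simp
  then show "integrable lborel (\<lambda>\<theta>. exp (- (\<theta> / n)\<^sup>2 / 2))"
    unfolding sd .
qed

text \<open>This replaces Fourier inversion: a measure with integrable Fourier transform has a continuous
  density, and the left-hand side is \<open>2 * pi\<close> times the value at \<open>0\<close> of the (symmetrised) density of
  \<open>Z\<close>, which vanishes when \<open>Z\<close> avoids a neighbourhood of \<open>0\<close>. Inserting the Gaussian factor
  \<open>exp (- (\<theta> / n)\<^sup>2 / 2)\<close> and exchanging the integrals produces a Gaussian in \<open>Z\<close> of width \<open>1 / n\<close>,
  which is uniformly small for \<open>\<bar>Z\<bar> \<ge> \<epsilon>\<close>.\<close>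

lemma integral_cos_transform_eq_0:
  fixes Z :: "'a \<Rightarrow> real"
  assumes N: "finite_measure N" and Z[measurable]: "Z \<in> borel_measurable N"
    and eps: "0 < \<epsilon>" "AE \<omega> in N. \<epsilon> \<le> \<bar>Z \<omega>\<bar>"
    and I: "integrable lborel (\<lambda>\<theta>. LINT \<omega>|N. cos (\<theta> * Z \<omega>))"
  shows "(LBINT \<theta>. LINT \<omega>|N. cos (\<theta> * Z \<omega>)) = 0"
proof -
  interpret N: finite_measure N by (rule N)
  interpret P: pair_sigma_finite N lborel by standard
  define c where "c \<theta> = (LINT \<omega>|N. cos (\<theta> * Z \<omega>))" for \<theta>
  have c_meas[measurable]: "c \<in> borel_measurable borel"
    using I[THEN borel_measurable_integrable] unfolding c_def by simp
  define J where "J n = (LBINT \<theta>. exp (- (\<theta> / Suc n)\<^sup>2 / 2) * c \<theta>)" for n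
  have "J \<longlonglongrightarrow> (LBINT \<theta>. c \<theta>)"
    unfolding J_def
  proof (rule integral_dominated_convergence[where w = "\<lambda>\<theta>. \<bar>c \<theta>\<bar>"])
    show "integrable lborel (\<lambda>\<theta>. \<bar>c \<theta>\<bar>)" using I unfolding c_def by simp
    show "AE \<theta> in lborel. norm (exp (- (\<theta> / real (Suc n))\<^sup>2 / 2) * c \<theta>) \<le> \<bar>c \<theta>\<bar>" for n
      by (intro AE_I2) (simp add: abs_mult mult_left_le_one_le)
    show "AE \<theta> in lborel. (\<lambda>n. exp (- (\<theta> / real (Suc n))\<^sup>2 / 2) * c \<theta>) \<longlonglongrightarrow> c \<theta>"
    proof (rule AE_I2)
      fix \<theta> :: real
      have "(\<lambda>n. \<theta> / real (Suc n)) \<longlonglongrightarrow> 0" by (rule LIMSEQ_Suc[OF lim_const_over_n])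
      from tendsto_mult[OF tendsto_exp[OF tendsto_divide[OF tendsto_minus[OF tendsto_power[OF this, of 2]] tendsto_const[of 2]]] tendsto_const[of "c \<theta>"]]
      show "(\<lambda>n. exp (- (\<theta> / real (Suc n))\<^sup>2 / 2) * c \<theta>) \<longlonglongrightarrow> c \<theta>" by simp
    qed
  qed auto
  moreover have "J \<longlonglongrightarrow> 0"
  proof (rule Lim_null_comparison)
    show "\<forall>\<^sub>F n in sequentially. norm (J n) \<le> measure N (space N) * (real (Suc n) * sqrt (2 * pi) * exp (- (real (Suc n) * \<epsilon>)\<^sup>2 / 2))"
    proof (rule always_eventually, rule allI)
      fix n :: nat
      define m where "m = real (Suc n)"
      have m: "0 < m" by (simp add: m_def)
      note G = integral_gaussian_cos[OF m]
      have F: "integrable (N \<Otimes>\<^sub>M lborel) (\<lambda>(\<omega>, \<theta>). exp (- (\<theta> / m)\<^sup>2 / 2) * cos (\<theta> * Z \<omega>))"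
      proof (rule Bochner_Integration.integrable_bound)
        show "integrable (N \<Otimes>\<^sub>M lborel) (\<lambda>(\<omega>, \<theta>). exp (- (\<theta> / m)\<^sup>2 / 2))"
          using G(2) by (intro P.Fubini_integrable) auto
      qed (auto simp: abs_mult mult_left_le_one_le)
      \<comment> \<open>Fubini exchanges the integrals; the inner one is then a Gaussian transform.\<close>
      have "J n = (LBINT \<theta>. LINT \<omega>|N. exp (- (\<theta> / m)\<^sup>2 / 2) * cos (\<theta> * Z \<omega>))"
        unfolding J_def c_def m_def by simp
      also have "\<dots> = (LINT \<omega>|N. (LBINT \<theta>. exp (- (\<theta> / m)\<^sup>2 / 2) * cos (\<theta> * Z \<omega>)))"
        by (rule P.Fubini_integral[OF F])
      also have "\<dots> = (LINT \<omega>|N. m * sqrt (2 * pi) * exp (- (m * Z \<omega>)\<^sup>2 / 2))"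
        by (simp only: G(1))
      finally have J: "J n = (LINT \<omega>|N. m * sqrt (2 * pi) * exp (- (m * Z \<omega>)\<^sup>2 / 2))" .
      have "norm (J n) \<le> (LINT \<omega>|N. m * sqrt (2 * pi) * exp (- (m * \<epsilon>)\<^sup>2 / 2))"
        unfolding J
      proof (rule order_trans[OF integral_norm_bound integral_mono_AE])
        have "integrable N (\<lambda>\<omega>. m * sqrt (2 * pi) * exp (- (m * Z \<omega>)\<^sup>2 / 2))"
          using m by (intro N.integrable_const_bound[where B = "m * sqrt (2 * pi)"]) auto
        then show "integrable N (\<lambda>\<omega>. norm (m * sqrt (2 * pi) * exp (- (m * Z \<omega>)\<^sup>2 / 2)))"
          by (rule integrable_norm)
        show "AE \<omega> in N. norm (m * sqrt (2 * pi) * exp (- (m * Z \<omega>)\<^sup>2 / 2)) \<le> m * sqrt (2 * pi) * exp (- (m * \<epsilon>)\<^sup>2 / 2)"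
          using eps(2)
        proof eventually_elim
          case (elim \<omega>)
          have "(m * \<epsilon>)\<^sup>2 \<le> (m * Z \<omega>)\<^sup>2"
            using elim m eps(1) by (subst abs_le_square_iff[symmetric]) (auto simp: abs_mult)
          then show ?case using m by simp
        qed
      qed simp
      then show "norm (J n) \<le> measure N (space N) * (real (Suc n) * sqrt (2 * pi) * exp (- (real (Suc n) * \<epsilon>)\<^sup>2 / 2))"
        by (simp add: m_def mult_ac)
    qed
    have "((\<lambda>m. measure N (space N) * (m * sqrt (2 * pi) * exp (- (m * \<epsilon>)\<^sup>2 / 2))) \<longlongrightarrow> 0) at_top"
      using eps(1) by real_asymp
    from filterlim_compose[OF this filterlim_compose[OF filterlim_real_sequentially filterlim_Suc]]
    show "(\<lambda>n. measure N (space N) * (real (Suc n) * sqrt (2 * pi) * exp (- (real (Suc n) * \<epsilon>)\<^sup>2 / 2))) \<longlonglongrightarrow> 0" .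
  qed
  ultimately show ?thesis
    unfolding c_def by (rule LIMSEQ_unique)
qed

section \<open>Exponentially discounted time\<close>

text \<open>The unnormalised exponential distribution. Its total mass is \<open>1 / p\<close>, and integrating
  \<open>E f (X t)\<close> against it gives the resolvent of the process.\<close>

definition discount_measure :: "real \<Rightarrow> real measure" where
  "discount_measure p = density lborel (\<lambda>t. ennreal (indicator {0..} t * exp (- p * t)))"

lemma sets_discount_measure[measurable_cong, simp]: "sets (discount_measure p) = sets borel"
  and space_discount_measure[simp]: "space (discount_measure p) = UNIV"
  by (auto simp: discount_measure_def)

lemma integral_discount_measure:
  fixes f :: "real \<Rightarrow> real"
  assumes [measurable]: "f \<in> borel_measurable borel"
  shows "(LINT t|discount_measure p. f t) = (LBINT t:{0..}. exp (- p * t) * f t)"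
  unfolding discount_measure_def set_lebesgue_integral_def
  by (simp add: integral_density mult.assoc)

lemma AE_discount_measure: "AE t in discount_measure p. 0 \<le> t"
  unfolding discount_measure_def by (subst AE_density) (auto simp: indicator_def)

lemma emeasure_discount_measure:
  assumes "0 < p"
  shows "emeasure (discount_measure p) UNIV = ennreal (1 / p)"
proof -
  have "emeasure (discount_measure p) UNIV = (\<integral>\<^sup>+t. ennreal (indicator {0..} t * exp (- p * t)) \<partial>lborel)"
    unfolding discount_measure_def by (subst emeasure_density) auto
  also have "\<dots> = ennreal (exp (- p * 0) / p)"
    using has_integral_exp_minus_to_infinity[OF assms, of 0]
    by (intro nn_integral_has_integral_lebesgue) auto
  finally show ?thesis by simp
qed

lemma finite_discount_measure: "0 < p \<Longrightarrow> finite_measure (discount_measure p)"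
  by (rule finite_measureI) (simp add: emeasure_discount_measure)

lemma integral_exp_discount_measure:
  assumes "0 < p" "0 \<le> l"
  shows "(LINT t|discount_measure p. exp (- l * t)) = 1 / (p + l)"
proof -
  have "(LINT t|discount_measure p. exp (- l * t)) = (LINT t|discount_measure (p + l). 1)"
    by (subst (1 2) integral_discount_measure) (auto simp: exp_add[symmetric] algebra_simps)
  also have "\<dots> = measure (discount_measure (p + l)) UNIV" by simp
  also have "\<dots> = 1 / (p + l)"
    unfolding measure_def using assms by (subst emeasure_discount_measure) auto
  finally show ?thesis .
qed

text \<open>The memoryless property, which turns the resolvent restarted at time \<open>\<tau>\<close> into the part of the
  occupation measure after \<open>\<tau>\<close>.\<close>

lemma integral_discount_measure_shift:
  fixes f :: "real \<Rightarrow> real"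
  assumes [measurable]: "f \<in> borel_measurable borel" and "0 \<le> \<tau>"
  shows "(LINT t|discount_measure p. f (\<tau> + t)) = exp (p * \<tau>) * (LINT s|discount_measure p. indicator {\<tau>..} s * f s)"
proof -
  have "(LINT s|discount_measure p. indicator {\<tau>..} s * f s) = (LBINT s. indicator {0..} s * (exp (- p * s) * (indicator {\<tau>..} s * f s)))"
    by (subst integral_discount_measure) (auto simp: set_lebesgue_integral_def)
  also have "\<dots> = (LBINT t. indicator {0..} (\<tau> + t) * (exp (- p * (\<tau> + t)) * (indicator {\<tau>..} (\<tau> + t) * f (\<tau> + t))))"
    by (subst lborel_integral_real_affine[where c = 1 and t = \<tau>]) auto
  also have "\<dots> = (LBINT t. exp (- p * \<tau>) * (indicator {0..} t * (exp (- p * t) * f (\<tau> + t))))"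
    using assms by (intro Bochner_Integration.integral_cong) (auto simp: indicator_def exp_add[symmetric] algebra_simps)
  also have "\<dots> = exp (- p * \<tau>) * (LINT t|discount_measure p. f (\<tau> + t))"
    by (subst integral_discount_measure) (auto simp: set_lebesgue_integral_def)
  finally show ?thesis by (simp add: exp_minus)
qed

lemma integral_discount_measure_rescale:
  fixes f :: "real \<Rightarrow> real"
  assumes [measurable]: "f \<in> borel_measurable borel" and "0 < p"
  shows "p * (LINT t|discount_measure p. f t) = (LINT u|discount_measure 1. f (u / p))"
proof -
  have "(LINT t|discount_measure p. f t) = (LBINT t. indicator {0..} t * (exp (- p * t) * f t))"
    by (subst integral_discount_measure) (auto simp: set_lebesgue_integral_def)
  also have "\<dots> = 1 / p * (LBINT u. indicator {0..} u * (exp (- 1 * u) * f (u / p)))"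
    using assms by (subst lborel_integral_real_affine[where c = "1 / p" and t = 0]) (auto simp: indicator_def zero_le_divide_iff)
  also have "(LBINT u. indicator {0..} u * (exp (- 1 * u) * f (u / p))) = (LINT u|discount_measure 1. f (u / p))"
    by (subst integral_discount_measure) (auto simp: set_lebesgue_integral_def)
  finally show ?thesis using assms by simp
qed

lemma abs_integral_discount_measure_le:
  fixes f :: "real \<Rightarrow> real"
  assumes p: "0 < p" and f[measurable]: "f \<in> borel_measurable borel" and f1: "\<And>t. \<bar>f t\<bar> \<le> 1"
  shows "\<bar>LINT t|discount_measure p. f t\<bar> \<le> 1 / p"
proof -
  interpret finite_measure "discount_measure p" by (rule finite_discount_measure[OF p])
  have "integrable (discount_measure p) f"
    by (rule integrable_const_bound[where B = 1]) (use f1 in simp_all)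
  then have "\<bar>LINT t|discount_measure p. f t\<bar> \<le> (LINT t|discount_measure p. 1)"
    by (intro order_trans[OF integral_abs_bound integral_mono] integrable_abs f1) simp_all
  also have "\<dots> = 1 / p" using p by (simp add: measure_def emeasure_discount_measure)
  finally show ?thesis .
qed

section \<open>Entry times of right-continuous paths\<close>

definition right_continuous :: "(real \<Rightarrow> real) \<Rightarrow> bool" where
  "right_continuous x \<longleftrightarrow> (\<forall>t. (x \<longlongrightarrow> x t) (at_right t))"

lemma right_continuousD:
  assumes "right_continuous x" "\<And>n. t \<le> s n" "s \<longlonglongrightarrow> t"
  shows "(\<lambda>n. x (s n)) \<longlonglongrightarrow> x t"
proof -
  have "(x \<longlongrightarrow> x t) (at_right t)"
    using assms(1) unfolding right_continuous_def by blast
  then have "continuous (at t within {t..}) x"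
    unfolding continuous_within at_within_Ici_at_right .
  then show ?thesis
    using assms(2,3) by (simp add: continuous_within_sequentially o_def)
qed

lemma dyadic_above:
  fixes t :: real
  defines "g \<equiv> \<lambda>n. (of_int \<lfloor>t * 2 ^ n\<rfloor> + 1) / 2 ^ n"
  shows "t < g n" "g \<longlonglongrightarrow> t"
proof -
  have lt: "t < g n" for n
    unfolding g_def by (subst pos_less_divide_eq) (simp_all only: zero_less_power zero_less_numeral real_of_int_floor_add_one_gt)
  have le: "g n \<le> t + (1 / 2) ^ n" for n
  proof -
    have "of_int \<lfloor>t * 2 ^ n\<rfloor> + 1 \<le> t * 2 ^ n + 1" by (intro add_right_mono of_int_floor_le)
    then have "g n \<le> (t * 2 ^ n + 1) / 2 ^ n" unfolding g_def by (intro divide_right_mono) auto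
    also have "\<dots> = t + (1 / 2) ^ n" by (simp add: add_divide_distrib power_one_over)
    finally show ?thesis .
  qed
  show "t < g n" by (rule lt)
  show "g \<longlonglongrightarrow> t"
  proof (rule tendsto_sandwich[where f = "\<lambda>_. t" and h = "\<lambda>n. t + (1 / 2) ^ n"])
    have "(\<lambda>n. t + (1 / 2) ^ n) \<longlonglongrightarrow> t + 0"
      by (intro tendsto_intros LIMSEQ_realpow_zero) auto
    then show "(\<lambda>n. t + (1 / 2) ^ n) \<longlonglongrightarrow> t" by simp
    show "\<forall>\<^sub>F n in sequentially. t \<le> g n" by (intro always_eventually allI less_imp_le lt)
    show "\<forall>\<^sub>F n in sequentially. g n \<le> t + (1 / 2) ^ n" by (intro always_eventually allI le)
  qed (rule tendsto_const)
qed

text \<open>Approximate \<open>t\<close> from above by dyadic numbers; each approximation takes only countably many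
  time values.\<close>

lemma right_continuous_jointly_measurable:
  fixes Y :: "real \<Rightarrow> 'a \<Rightarrow> real"
  assumes [measurable]: "\<And>t. Y t \<in> borel_measurable M" and rc: "\<And>\<omega>. right_continuous (\<lambda>t. Y t \<omega>)"
  shows "(\<lambda>(t, \<omega>). Y t \<omega>) \<in> borel_measurable (borel \<Otimes>\<^sub>M M)"
proof -
  have "(\<lambda>p. Y (fst p) (snd p)) \<in> borel_measurable (borel \<Otimes>\<^sub>M M)"
  proof (rule borel_measurable_LIMSEQ_real)
    fix n :: nat
    show "(\<lambda>p::real \<times> 'a. (\<lambda>i p. Y ((of_int i + 1) / 2 ^ n) (snd p)) \<lfloor>fst p * 2 ^ n\<rfloor> p) \<in> borel_measurable (borel \<Otimes>\<^sub>M M)"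
    proof (rule measurable_compose_countable[where f = "\<lambda>i p. Y ((of_int i + 1) / 2 ^ n) (snd p)" and g = "\<lambda>p::real \<times> 'a. \<lfloor>fst p * 2 ^ n\<rfloor>"])
      show "(\<lambda>p. Y ((of_int i + 1) / 2 ^ n) (snd p)) \<in> borel_measurable (borel \<Otimes>\<^sub>M M)" for i :: int
        by (rule measurable_compose[OF measurable_snd]) (rule assms(1))
    qed (rule measurable_compose[OF _ measurable_real_floor], measurable)
  next
    fix p :: "real \<times> 'a"
    show "(\<lambda>n. (\<lambda>i p::real \<times> 'a. Y ((of_int i + 1) / 2 ^ n) (snd p)) \<lfloor>fst p * 2 ^ n\<rfloor> p) \<longlonglongrightarrow> Y (fst p) (snd p)"
      by (rule right_continuousD[OF rc less_imp_le[OF dyadic_above(1)] dyadic_above(2)])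
  qed
  then show ?thesis by (simp only: case_prod_beta')
qed

lemma right_continuous_borel_measurable:
  assumes "right_continuous x"
  shows "x \<in> borel_measurable borel"
proof -
  have "(\<lambda>(t, \<omega>). (\<lambda>t (_::unit). x t) t \<omega>) \<in> borel_measurable (borel \<Otimes>\<^sub>M count_space UNIV)"
    using assms by (intro right_continuous_jointly_measurable) auto
  then have "(\<lambda>t. (\<lambda>(t, \<omega>::unit). x t) (t, ())) \<in> borel_measurable borel"
    by (rule measurable_compose[rotated]) auto
  then show ?thesis by simp
qed

definition enters :: "real set \<Rightarrow> (real \<Rightarrow> real) \<Rightarrow> bool" where
  "enters U x \<longleftrightarrow> (\<exists>t\<ge>0. x t \<in> U)"

text \<open>The default \<open>0\<close> on paths that never enter keeps the type real, for use as a time argument; the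
  discount factors below are what tells these paths apart from those that start in \<open>U\<close>.\<close>

definition entry_time :: "real set \<Rightarrow> (real \<Rightarrow> real) \<Rightarrow> real" where
  "entry_time U x = (if enters U x then Inf {t. 0 \<le> t \<and> x t \<in> U} else 0)"

definition grid_enters :: "nat \<Rightarrow> real set \<Rightarrow> (real \<Rightarrow> real) \<Rightarrow> bool" where
  "grid_enters m U x \<longleftrightarrow> (\<exists>k::nat. x (k / 2 ^ m) \<in> U)"

definition grid_entry_index :: "nat \<Rightarrow> real set \<Rightarrow> (real \<Rightarrow> real) \<Rightarrow> nat" where
  "grid_entry_index m U x = (LEAST k. x (real k / 2 ^ m) \<in> U)"

definition grid_entry_time :: "nat \<Rightarrow> real set \<Rightarrow> (real \<Rightarrow> real) \<Rightarrow> real" where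
  "grid_entry_time m U x = (if grid_enters m U x then grid_entry_index m U x / 2 ^ m else 0)"

lemma entry_time_le:
  assumes "0 \<le> t" "x t \<in> U"
  shows "entry_time U x \<le> t"
  using assms unfolding entry_time_def enters_def
  by (auto intro!: cInf_lower bdd_belowI[of _ 0])

lemma entry_time_nonneg: "0 \<le> entry_time U x"
  unfolding entry_time_def enters_def by (auto intro!: cInf_greatest)

lemma before_entry:
  assumes "0 \<le> t" "enters U x \<longrightarrow> t < entry_time U x"
  shows "x t \<notin> U"
proof
  assume "x t \<in> U"
  with assms(1) have "enters U x" "entry_time U x \<le> t"
    by (auto simp: enters_def intro: entry_time_le)
  with assms(2) show False by simp
qed

lemma grid_enters_imp_enters: "grid_enters m U x \<Longrightarrow> enters U x"
  unfolding grid_enters_def enters_def by (meson of_nat_0_le_iff zero_le_divide_iff zero_le_numeral zero_le_power)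

lemma at_grid_entry:
  assumes "grid_enters m U x"
  shows "x (grid_entry_time m U x) \<in> U"
proof -
  have "x (real (grid_entry_index m U x) / 2 ^ m) \<in> U"
    using assms unfolding grid_entry_index_def grid_enters_def by (rule LeastI_ex)
  then show ?thesis using assms by (simp add: grid_entry_time_def)
qed

lemma grid_entry_time_nonneg: "0 \<le> grid_entry_time m U x"
  by (simp add: grid_entry_time_def)

lemma entry_le_grid_entry:
  assumes "grid_enters m U x"
  shows "entry_time U x \<le> grid_entry_time m U x"
  using grid_entry_time_nonneg at_grid_entry[OF assms] by (rule entry_time_le)

text \<open>A path that is in the open set \<open>U\<close> at time \<open>t\<close> stays there for a short while after \<open>t\<close>, and
  that period contains points of every sufficiently fine dyadic grid.\<close>

lemma grid_entry_approx:
  assumes x: "right_continuous x" and U: "open U" and "enters U x" and b: "entry_time U x < b"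
  shows "\<forall>\<^sub>F m in sequentially. grid_enters m U x \<and> grid_entry_time m U x < b"
proof -
  have "\<exists>t\<in>{t. 0 \<le> t \<and> x t \<in> U}. t < b"
  proof (rule ccontr)
    assume "\<not> ?thesis"
    then have "b \<le> Inf {t. 0 \<le> t \<and> x t \<in> U}"
      using \<open>enters U x\<close> by (intro cInf_greatest) (auto simp: enters_def not_less)
    then show False using b \<open>enters U x\<close> by (simp add: entry_time_def)
  qed
  then obtain t where t: "0 \<le> t" "x t \<in> U" "t < b" by auto
  have "(\<lambda>m. x ((of_int \<lfloor>t * 2 ^ m\<rfloor> + 1) / 2 ^ m)) \<longlonglongrightarrow> x t"
    by (rule right_continuousD[OF x _ dyadic_above(2)]) (rule less_imp_le[OF dyadic_above(1)])
  then have "\<forall>\<^sub>F m in sequentially. x ((of_int \<lfloor>t * 2 ^ m\<rfloor> + 1) / 2 ^ m) \<in> U"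
    using U t(2) by (rule topological_tendstoD)
  moreover have "\<forall>\<^sub>F m in sequentially. (of_int \<lfloor>t * 2 ^ m\<rfloor> + 1) / 2 ^ m < b"
    using order_tendstoD(2)[OF dyadic_above(2) t(3)] .
  ultimately show ?thesis
  proof eventually_elim
    case (elim m)
    define k where "k = nat (\<lfloor>t * 2 ^ m\<rfloor> + 1)"
    have k: "real k = of_int \<lfloor>t * 2 ^ m\<rfloor> + 1" unfolding k_def using t(1) by simp
    then have "x (real k / 2 ^ m) \<in> U" "real k / 2 ^ m < b" using elim by auto
    then have "grid_enters m U x" "grid_entry_index m U x \<le> k"
      unfolding grid_enters_def grid_entry_index_def by (auto intro: Least_le)
    moreover from this have "real (grid_entry_index m U x) / 2 ^ m \<le> real k / 2 ^ m"
      by (intro divide_right_mono) auto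
    ultimately show ?case
      using \<open>real k / 2 ^ m < b\<close> by (simp add: grid_entry_time_def)
  qed
qed

lemma grid_entry_time_tendsto:
  assumes x: "right_continuous x" and U: "open U" and e: "enters U x"
  shows "(\<lambda>m. grid_entry_time m U x) \<longlonglongrightarrow> entry_time U x"
proof (rule order_tendstoI)
  fix b assume "entry_time U x < b"
  from grid_entry_approx[OF x U e this]
  show "\<forall>\<^sub>F m in sequentially. grid_entry_time m U x < b" by eventually_elim auto
next
  fix b assume "b < entry_time U x"
  show "\<forall>\<^sub>F m in sequentially. b < grid_entry_time m U x"
    using grid_entry_approx[OF x U e less_add_one]
  proof eventually_elim
    case (elim m)
    then have "entry_time U x \<le> grid_entry_time m U x" by (intro entry_le_grid_entry) simp
    with \<open>b < entry_time U x\<close> show ?case by simp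
  qed
qed

text \<open>The grid entry times approach the entry time from above, so right-continuity applies.\<close>

lemma at_grid_entry_tendsto:
  assumes x: "right_continuous x" and U: "open U" and e: "enters U x"
  shows "(\<lambda>m. x (grid_entry_time m U x + t)) \<longlonglongrightarrow> x (entry_time U x + t)"
proof -
  let ?s = "\<lambda>m. max (entry_time U x) (grid_entry_time m U x)"
  have "(\<lambda>m. ?s m + t) \<longlonglongrightarrow> max (entry_time U x) (entry_time U x) + t"
    by (intro tendsto_intros grid_entry_time_tendsto x U e)
  then have "(\<lambda>m. x (?s m + t)) \<longlonglongrightarrow> x (entry_time U x + t)"
    by (intro right_continuousD[OF x]) auto
  moreover have "\<forall>\<^sub>F m in sequentially. x (?s m + t) = x (grid_entry_time m U x + t)"
    using grid_entry_approx[OF x U e less_add_one]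
  proof eventually_elim
    case (elim m)
    then have "entry_time U x \<le> grid_entry_time m U x" by (intro entry_le_grid_entry) simp
    then show ?case by (simp add: max_absorb2)
  qed
  ultimately show ?thesis by (rule Lim_transform_eventually)
qed

lemma entry_time_antimono:
  assumes "U \<subseteq> V" "enters U x"
  shows "entry_time V x \<le> entry_time U x" "enters V x"
proof -
  show "enters V x" using assms by (auto simp: enters_def)
  have "entry_time V x \<le> Inf {t. 0 \<le> t \<and> x t \<in> U}"
    using assms by (intro cInf_greatest entry_time_le) (auto simp: enters_def)
  then show "entry_time V x \<le> entry_time U x"
    using assms by (simp add: entry_time_def[of U])
qed

definition first_grid_entry :: "nat \<Rightarrow> real set \<Rightarrow> (real \<Rightarrow> real) \<Rightarrow> nat \<Rightarrow> bool" where
  "first_grid_entry m U x k \<longleftrightarrow> x (real k / 2 ^ m) \<in> U \<and> (\<forall>j<k. x (real j / 2 ^ m) \<notin> U)"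

lemma first_grid_entry_iff:
  "first_grid_entry m U x k \<longleftrightarrow> grid_enters m U x \<and> grid_entry_index m U x = k"
proof
  assume "first_grid_entry m U x k"
  then show "grid_enters m U x \<and> grid_entry_index m U x = k"
    unfolding first_grid_entry_def grid_enters_def grid_entry_index_def
    by (auto intro!: Least_equality leI)
next
  assume "grid_enters m U x \<and> grid_entry_index m U x = k"
  then have ex: "\<exists>k. x (real k / 2 ^ m) \<in> U" and k: "(LEAST k. x (real k / 2 ^ m) \<in> U) = k"
    unfolding grid_enters_def grid_entry_index_def by blast+
  show "first_grid_entry m U x k"
    unfolding first_grid_entry_def
  proof (intro conjI allI impI)
    show "x (real k / 2 ^ m) \<in> U" using LeastI_ex[OF ex] unfolding k .
    show "x (real j / 2 ^ m) \<notin> U" if "j < k" for j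
      using not_less_Least[of j "\<lambda>k. x (real k / 2 ^ m) \<in> U"] that unfolding k .
  qed
qed

text \<open>Decomposing according to the grid point of first entry reduces statements about the random
  time to statements about deterministic times.\<close>

lemma first_grid_entry_sums:
  fixes c :: "nat \<Rightarrow> real"
  shows "(\<lambda>k. of_bool (first_grid_entry m U x k) * c k) sums
    (of_bool (grid_enters m U x) * c (grid_entry_index m U x))"
proof -
  have "(\<lambda>k. of_bool (first_grid_entry m U x k) * c k) =
     (\<lambda>k. if k = grid_entry_index m U x then of_bool (grid_enters m U x) * c k else 0)"
    unfolding first_grid_entry_iff by (rule ext) auto
  then show ?thesis
    using sums_single[of "grid_entry_index m U x" "\<lambda>k. of_bool (grid_enters m U x) * c k"] by simp
qed

text \<open>The discount factor \<open>exp (- q * T)\<close> of the entry time \<open>T\<close>, with the convention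
  \<open>exp (- \<infinity>) = 0\<close> if the set is never entered.\<close>

definition entry_discount :: "real \<Rightarrow> real set \<Rightarrow> (real \<Rightarrow> real) \<Rightarrow> real" where
  "entry_discount q U x = of_bool (enters U x) * exp (- q * entry_time U x)"

definition grid_entry_discount :: "real \<Rightarrow> nat \<Rightarrow> real set \<Rightarrow> (real \<Rightarrow> real) \<Rightarrow> real" where
  "grid_entry_discount q m U x = of_bool (grid_enters m U x) * exp (- q * grid_entry_time m U x)"

lemma entry_discount_bounds:
  assumes "0 \<le> q"
  shows "0 \<le> entry_discount q U x" "entry_discount q U x \<le> 1"
  using assms entry_time_nonneg[of U x] unfolding entry_discount_def by (auto simp: of_bool_def)

lemma grid_entry_discount_bounds:
  assumes "0 \<le> q"
  shows "0 \<le> grid_entry_discount q m U x" "grid_entry_discount q m U x \<le> 1"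
  using assms grid_entry_time_nonneg[of m U x] unfolding grid_entry_discount_def by (auto simp: of_bool_def)

lemma grid_entry_discount_tendsto:
  assumes x: "right_continuous x" and U: "open U"
  shows "(\<lambda>m. grid_entry_discount q m U x) \<longlonglongrightarrow> entry_discount q U x"
proof (cases "enters U x")
  case True
  have "(\<lambda>m. exp (- q * grid_entry_time m U x)) \<longlonglongrightarrow> exp (- q * entry_time U x)"
    by (intro tendsto_intros grid_entry_time_tendsto x U True)
  moreover have "\<forall>\<^sub>F m in sequentially. exp (- q * grid_entry_time m U x) = grid_entry_discount q m U x"
    using grid_entry_approx[OF x U True less_add_one]
    by eventually_elim (simp add: grid_entry_discount_def)
  ultimately show ?thesis
    using True unfolding entry_discount_def by (simp only: of_bool_eq mult_1 Lim_transform_eventually)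
next
  case False
  then have "grid_entry_discount q m U x = 0" for m
    using grid_enters_imp_enters[of m U x] by (auto simp: grid_entry_discount_def)
  then show ?thesis using False by (simp add: entry_discount_def)
qed

lemma grid_entry_discount_mult_tendsto:
  assumes x: "right_continuous x" and U: "open U" and f: "\<And>y. isCont f y"
  shows "(\<lambda>m. grid_entry_discount q m U x * f (x (grid_entry_time m U x + t)))
     \<longlonglongrightarrow> entry_discount q U x * f (x (entry_time U x + t))"
proof (cases "enters U x")
  case True
  show ?thesis
    by (intro tendsto_mult grid_entry_discount_tendsto x U isCont_tendsto_compose[OF f] at_grid_entry_tendsto True)
next
  case False
  then have "grid_entry_discount q m U x = 0" for m
    using grid_enters_imp_enters[of m U x] by (auto simp: grid_entry_discount_def)
  then show ?thesis using False by (simp add: entry_discount_def)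
qed

section \<open>Limits of entry times into shrinking balls\<close>

definition shrinking_ball :: "real \<Rightarrow> nat \<Rightarrow> real set" where
  "shrinking_ball a n = ball a (1 / Suc n)"

lemma shrinking_ball_antimono: "m \<le> n \<Longrightarrow> shrinking_ball a n \<subseteq> shrinking_ball a m"
  unfolding shrinking_ball_def by (intro subset_ball divide_left_mono) auto

text \<open>The entry times into the balls of radius \<open>1 / Suc n\<close> increase with \<open>n\<close>; the predicate says that
  their limit, \<open>approach_time a x\<close> below, is finite.\<close>

definition approaches :: "real \<Rightarrow> (real \<Rightarrow> real) \<Rightarrow> bool" where
  "approaches a x \<longleftrightarrow> (\<exists>B. \<forall>n. enters (shrinking_ball a n) x \<and> entry_time (shrinking_ball a n) x \<le> B)"

definition approach_time :: "real \<Rightarrow> (real \<Rightarrow> real) \<Rightarrow> real" where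
  "approach_time a x = (if approaches a x then SUP n. entry_time (shrinking_ball a n) x else 0)"

definition approach_discount :: "real \<Rightarrow> real \<Rightarrow> (real \<Rightarrow> real) \<Rightarrow> real" where
  "approach_discount q a x = of_bool (approaches a x) * exp (- q * approach_time a x)"

lemma entry_time_incseq:
  assumes "\<And>n. enters (shrinking_ball a n) x"
  shows "incseq (\<lambda>n. entry_time (shrinking_ball a n) x)"
  unfolding incseq_def
  by (intro allI impI entry_time_antimono(1)[OF shrinking_ball_antimono assms])

lemma entry_time_le_approach_time:
  assumes "approaches a x"
  shows "entry_time (shrinking_ball a n) x \<le> approach_time a x"
  using assms unfolding approach_time_def approaches_def
  by (auto intro!: cSUP_upper bdd_aboveI2)

lemma approach_time_nonneg: "0 \<le> approach_time a x"
  using entry_time_le_approach_time[of a x 0] entry_time_nonneg[of "shrinking_ball a 0" x]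
  by (cases "approaches a x") (auto simp: approach_time_def)

lemma approach_discount_bounds:
  assumes "0 \<le> q"
  shows "0 \<le> approach_discount q a x" "approach_discount q a x \<le> 1"
  using assms approach_time_nonneg[of a x] unfolding approach_discount_def by (auto simp: of_bool_def)

lemma entry_time_tendsto_approach_time:
  assumes "approaches a x"
  shows "(\<lambda>n. entry_time (shrinking_ball a n) x) \<longlonglongrightarrow> approach_time a x"
proof -
  obtain B where B: "\<And>n. enters (shrinking_ball a n) x" "\<And>n. entry_time (shrinking_ball a n) x \<le> B"
    using assms unfolding approaches_def by blast
  have "(\<lambda>n. entry_time (shrinking_ball a n) x) \<longlonglongrightarrow> (SUP n. entry_time (shrinking_ball a n) x)"
    by (intro LIMSEQ_incseq_SUP entry_time_incseq bdd_aboveI2[of _ _ B] B)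
  then show ?thesis using assms by (simp add: approach_time_def)
qed

text \<open>Three cases: the entry times converge, they increase to infinity, or some ball is never entered.
  In the last two the discount factors tend to \<open>0\<close>.\<close>

lemma entry_discount_tendsto_approach_discount:
  assumes q: "0 < q"
  shows "(\<lambda>n. entry_discount q (shrinking_ball a n) x) \<longlonglongrightarrow> approach_discount q a x"
proof (cases "\<forall>n. enters (shrinking_ball a n) x")
  case True
  then have D: "entry_discount q (shrinking_ball a n) x = exp (- q * entry_time (shrinking_ball a n) x)" for n
    by (simp add: entry_discount_def)
  show ?thesis
  proof (cases "approaches a x")
    case app: True
    have "(\<lambda>n. exp (- q * entry_time (shrinking_ball a n) x)) \<longlonglongrightarrow> exp (- q * approach_time a x)"
      by (intro tendsto_intros entry_time_tendsto_approach_time app)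
    then show ?thesis using app unfolding D approach_discount_def by simp
  next
    case False
    have "filterlim (\<lambda>n. entry_time (shrinking_ball a n) x) at_top sequentially"
      unfolding filterlim_at_top_dense
    proof
      fix B
      obtain n where n: "B < entry_time (shrinking_ball a n) x"
        using False True unfolding approaches_def by (auto simp: not_le)
      show "\<forall>\<^sub>F n in sequentially. B < entry_time (shrinking_ball a n) x"
        using eventually_ge_at_top[of n]
      proof eventually_elim
        case (elim k)
        show ?case using n incseqD[OF entry_time_incseq elim, of a x] True by simp
      qed
    qed
    then have "filterlim (\<lambda>n. q * entry_time (shrinking_ball a n) x) at_top sequentially"
      by (rule filterlim_tendsto_pos_mult_at_top[OF tendsto_const q])
    then have "filterlim (\<lambda>n. - (q * entry_time (shrinking_ball a n) x)) at_bot sequentially"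
      by (simp only: filterlim_uminus_at_bot minus_minus)
    from filterlim_compose[OF exp_at_bot this]
    have "(\<lambda>n. exp (- q * entry_time (shrinking_ball a n) x)) \<longlonglongrightarrow> 0" by simp
    then show ?thesis using False unfolding D approach_discount_def by simp
  qed
next
  case False
  then obtain n where n: "\<not> enters (shrinking_ball a n) x" by auto
  have "\<forall>\<^sub>F k in sequentially. 0 = entry_discount q (shrinking_ball a k) x"
    using eventually_ge_at_top[of n]
  proof eventually_elim
    case (elim k)
    have "\<not> enters (shrinking_ball a k) x"
      using n entry_time_antimono(2)[OF shrinking_ball_antimono[OF elim]] by blast
    then show ?case by (simp add: entry_discount_def)
  qed
  then have "(\<lambda>n. entry_discount q (shrinking_ball a n) x) \<longlonglongrightarrow> 0"
    by (rule Lim_transform_eventually[OF tendsto_const])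
  moreover have "\<not> approaches a x" using n by (auto simp: approaches_def)
  ultimately show ?thesis by (simp add: approach_discount_def)
qed

text \<open>As the entry times increase to their limit, the values of \<open>f\<close> at these times need not converge
  to its value at the limit. The discounted average over the future does, because by the shift formula
  it is a factor times an integral over \<open>[T, \<infinity>)\<close>, which depends continuously on its lower end.\<close>

lemma integral_after_entry_tendsto:
  fixes f :: "real \<Rightarrow> real"
  assumes p: "0 < p" and f[measurable]: "f \<in> borel_measurable borel" and f1: "\<And>t. \<bar>f t\<bar> \<le> 1"
    and app: "approaches a x"
  shows "(\<lambda>n. LINT t|discount_measure p. f (entry_time (shrinking_ball a n) x + t))
    \<longlonglongrightarrow> (LINT t|discount_measure p. f (approach_time a x + t))"
proof -
  interpret finite_measure "discount_measure p" by (rule finite_discount_measure[OF p])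
  let ?\<tau> = "\<lambda>n. entry_time (shrinking_ball a n) x" and ?T = "approach_time a x"
  have "(\<lambda>n. LINT s|discount_measure p. indicator {?\<tau> n..} s * f s) \<longlonglongrightarrow> (LINT s|discount_measure p. indicator {?T..} s * f s)"
  proof (rule integral_dominated_convergence[where w = "\<lambda>_. 1"])
    show "AE s in discount_measure p. (\<lambda>n. indicator {?\<tau> n..} s * f s) \<longlonglongrightarrow> indicator {?T..} s * f s"
    proof (rule AE_I2, rule tendsto_eventually)
      fix s
      show "\<forall>\<^sub>F n in sequentially. indicator {?\<tau> n..} s * f s = indicator {?T..} s * f s"
      proof (cases "?T \<le> s")
        case True
        have "?\<tau> n \<le> s" for n using entry_time_le_approach_time[OF app, of n] True by linarith
        then show ?thesis using True by simp
      next
        case False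
        then have "\<forall>\<^sub>F n in sequentially. s < ?\<tau> n"
          using order_tendstoD(1)[OF entry_time_tendsto_approach_time[OF app], of s] by simp
        then show ?thesis by eventually_elim (use False in simp)
      qed
    qed
    show "AE s in discount_measure p. norm (indicator {?\<tau> n..} s * f s) \<le> 1" for n
      using f1 by (intro AE_I2) (simp add: indicator_def)
  qed simp_all
  from tendsto_mult[OF tendsto_exp[OF tendsto_mult[OF tendsto_const[of p] entry_time_tendsto_approach_time[OF app]]] this]
  show ?thesis
    unfolding integral_discount_measure_shift[OF f entry_time_nonneg] integral_discount_measure_shift[OF f approach_time_nonneg] .
qed

text \<open>For large rates the discount measure concentrates at \<open>0\<close>, so that right-continuity recovers
  the value at time \<open>\<tau>\<close> from the averages over the future of \<open>\<tau>\<close>.\<close>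

lemma discount_measure_average_tendsto:
  fixes x :: "real \<Rightarrow> real" and f :: "real \<Rightarrow> real"
  assumes x: "right_continuous x" and f: "\<And>y. isCont f y" and f1: "\<And>y. \<bar>f y\<bar> \<le> 1"
  shows "(\<lambda>n. real (Suc n) * (LINT t|discount_measure (Suc n). f (x (\<tau> + t)))) \<longlonglongrightarrow> f (x \<tau>)"
proof -
  interpret finite_measure "discount_measure 1" by (rule finite_discount_measure) simp
  have [measurable]: "x \<in> borel_measurable borel" by (rule right_continuous_borel_measurable[OF x])
  have [measurable]: "f \<in> borel_measurable borel"
    using f by (intro borel_measurable_continuous_onI) (simp add: continuous_on_eq_continuous_at)
  have "(\<lambda>n. LINT u|discount_measure 1. f (x (\<tau> + u / Suc n))) \<longlonglongrightarrow> (LINT u|discount_measure 1. f (x \<tau>))"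
  proof (rule integral_dominated_convergence[where w = "\<lambda>_. 1"])
    show "AE u in discount_measure 1. (\<lambda>n. f (x (\<tau> + u / Suc n))) \<longlonglongrightarrow> f (x \<tau>)"
      using AE_discount_measure[of 1]
    proof eventually_elim
      case (elim u)
      have "(\<lambda>n. \<tau> + u / real (Suc n)) \<longlonglongrightarrow> \<tau> + 0"
        by (intro tendsto_add tendsto_const LIMSEQ_Suc[OF lim_const_over_n])
      then have "(\<lambda>n. x (\<tau> + u / Suc n)) \<longlonglongrightarrow> x \<tau>"
        using elim by (intro right_continuousD[OF x]) simp_all
      then show ?case by (rule isCont_tendsto_compose[OF f])
    qed
    show "AE u in discount_measure 1. norm (f (x (\<tau> + u / Suc n))) \<le> 1" for n
      using f1 by (intro AE_I2) simp
  qed simp_all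
  moreover have "measure (discount_measure 1) UNIV = 1"
    by (simp add: measure_def emeasure_discount_measure)
  then have "(LINT u|discount_measure 1. f (x \<tau>)) = f (x \<tau>)" by simp
  moreover have "real (Suc n) * (LINT t|discount_measure (Suc n). f (x (\<tau> + t))) = (LINT u|discount_measure 1. f (x (\<tau> + u / Suc n)))" for n
    by (rule integral_discount_measure_rescale[where f = "\<lambda>t. f (x (\<tau> + t))"]) simp_all
  ultimately show ?thesis by (simp only:)
qed

section \<open>The Markov property at entry times\<close>

lemma abs_cos_minus_1_le: "\<bar>cos y - 1\<bar> \<le> min 2 \<bar>y\<bar>" for y :: real
proof -
  have "\<bar>cos y - cos 0\<bar> \<le> \<bar>y - 0\<bar>"
  proof -
    have "\<bar>cos y - cos 0\<bar> = 2 * (\<bar>sin (y / 2)\<bar> * \<bar>sin (y / 2)\<bar>)"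
      using cos_double_sin[of "y / 2"] by (simp add: power2_eq_square abs_mult)
    also have "\<dots> \<le> 2 * (\<bar>y / 2\<bar> * 1)"
      by (intro mult_left_mono mult_mono abs_sin_le_one abs_sin_x_le_abs_x) auto
    finally show ?thesis by simp
  qed
  moreover have "\<bar>cos y - 1\<bar> \<le> 2" using cos_le_one[of y] cos_ge_minus_one[of y] by linarith
  ultimately show ?thesis by simp
qed

text \<open>A version of the process all of whose paths are right-continuous and start at \<open>0\<close>. The last
  assumption is the Markov property at a dyadic time: the next increment is independent of the values
  on the grid up to that time and has the stable characteristic function.\<close>

locale right_continuous_stable_process = prob_space M for M :: "'a measure" +
  fixes Y :: "real \<Rightarrow> 'a \<Rightarrow> real" and \<alpha> \<kappa> :: real
  assumes \<kappa>_pos: "0 < \<kappa>"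
    and \<alpha>_gt_1: "1 < \<alpha>"
    and Y_measurable[measurable]: "\<And>t. Y t \<in> borel_measurable M"
    and Y_right_continuous: "\<And>\<omega>. right_continuous (\<lambda>t. Y t \<omega>)"
    and Y_0: "\<And>\<omega>. Y 0 \<omega> = 0"
    and Y_markov: "\<And>m k t \<theta> (G :: (nat \<Rightarrow> real) \<Rightarrow> complex). 0 < t \<Longrightarrow>
      G \<in> borel_measurable (PiM {..k} (\<lambda>_. borel)) \<Longrightarrow> (\<And>y. norm (G y) \<le> 1) \<Longrightarrow>
      (LINT \<omega>|M. G (\<lambda>j\<in>{..k}. Y (real j / 2 ^ m) \<omega>) * iexp (\<theta> * (Y (real k / 2 ^ m + t) \<omega> - Y (real k / 2 ^ m) \<omega>))) =
      (LINT \<omega>|M. G (\<lambda>j\<in>{..k}. Y (real j / 2 ^ m) \<omega>)) * of_real (exp (- \<kappa> * t * \<bar>\<theta>\<bar> powr \<alpha>))"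
begin

abbreviation traj :: "'a \<Rightarrow> real \<Rightarrow> real" where
  "traj \<omega> \<equiv> (\<lambda>t. Y t \<omega>)"

lemma Y_jointly_measurable[measurable]: "(\<lambda>p. Y (fst p) (snd p)) \<in> borel_measurable (borel \<Otimes>\<^sub>M M)"
  using right_continuous_jointly_measurable[OF Y_measurable Y_right_continuous]
  by (simp only: case_prod_beta')

lemma Y_at_measurable:
  assumes [measurable]: "T \<in> borel_measurable N" "g \<in> N \<rightarrow>\<^sub>M M"
  shows "(\<lambda>\<omega>. Y (T \<omega>) (g \<omega>)) \<in> borel_measurable N"
proof -
  have "(\<lambda>\<omega>. (T \<omega>, g \<omega>)) \<in> N \<rightarrow>\<^sub>M borel \<Otimes>\<^sub>M M" by measurable
  from measurable_compose[OF this Y_jointly_measurable] show ?thesis by simp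
qed

lemma first_grid_entry_measurable[measurable]:
  assumes [measurable]: "U \<in> sets borel"
  shows "Measurable.pred M (\<lambda>\<omega>. first_grid_entry m U (traj \<omega>) k)"
  unfolding first_grid_entry_def by measurable

lemma grid_enters_measurable[measurable]:
  assumes [measurable]: "U \<in> sets borel"
  shows "Measurable.pred M (\<lambda>\<omega>. grid_enters m U (traj \<omega>))"
  unfolding grid_enters_def by measurable

lemma at_grid_index_measurable:
  fixes c :: "nat \<Rightarrow> 'a \<Rightarrow> real"
  assumes [measurable]: "U \<in> sets borel" "\<And>k. c k \<in> borel_measurable M"
  shows "(\<lambda>\<omega>. of_bool (grid_enters m U (traj \<omega>)) * c (grid_entry_index m U (traj \<omega>)) \<omega>) \<in> borel_measurable M"
proof -
  have "(\<lambda>\<omega>. \<Sum>k. of_bool (first_grid_entry m U (traj \<omega>) k) * c k \<omega>) \<in> borel_measurable M"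
    unfolding of_bool_def by measurable
  also have "(\<lambda>\<omega>. \<Sum>k. of_bool (first_grid_entry m U (traj \<omega>) k) * c k \<omega>) =
    (\<lambda>\<omega>. of_bool (grid_enters m U (traj \<omega>)) * c (grid_entry_index m U (traj \<omega>)) \<omega>)"
    by (intro ext sums_unique[symmetric] first_grid_entry_sums)
  finally show ?thesis .
qed

lemma grid_entry_time_measurable[measurable]:
  assumes [measurable]: "U \<in> sets borel"
  shows "(\<lambda>\<omega>. grid_entry_time m U (traj \<omega>)) \<in> borel_measurable M"
proof -
  have "(\<lambda>\<omega>. of_bool (grid_enters m U (traj \<omega>)) * (real (grid_entry_index m U (traj \<omega>)) / 2 ^ m)) \<in> borel_measurable M"
    by (rule at_grid_index_measurable[where c = "\<lambda>k \<omega>. real k / 2 ^ m"]) auto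
  also have "(\<lambda>\<omega>. of_bool (grid_enters m U (traj \<omega>)) * (real (grid_entry_index m U (traj \<omega>)) / 2 ^ m)) =
    (\<lambda>\<omega>. grid_entry_time m U (traj \<omega>))"
    by (rule ext) (simp add: grid_entry_time_def)
  finally show ?thesis .
qed

lemma grid_entry_discount_measurable[measurable]:
  assumes [measurable]: "U \<in> sets borel"
  shows "(\<lambda>\<omega>. grid_entry_discount q m U (traj \<omega>)) \<in> borel_measurable M"
  unfolding grid_entry_discount_def of_bool_def by measurable

lemma entry_discount_measurable[measurable]:
  assumes "open U"
  shows "(\<lambda>\<omega>. entry_discount q U (traj \<omega>)) \<in> borel_measurable M"
proof (rule borel_measurable_LIMSEQ_real)
  show "(\<lambda>\<omega>. grid_entry_discount q m U (traj \<omega>)) \<in> borel_measurable M" for m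
    using assms by (intro grid_entry_discount_measurable) auto
  show "(\<lambda>m. grid_entry_discount q m U (traj \<omega>)) \<longlonglongrightarrow> entry_discount q U (traj \<omega>)" for \<omega>
    by (rule grid_entry_discount_tendsto[OF Y_right_continuous assms])
qed

lemma entry_time_measurable[measurable]:
  assumes "open U"
  shows "(\<lambda>\<omega>. entry_time U (traj \<omega>)) \<in> borel_measurable M"
proof (rule borel_measurable_LIMSEQ_real)
  show "(\<lambda>\<omega>. grid_entry_time m U (traj \<omega>)) \<in> borel_measurable M" for m
    using assms by (intro grid_entry_time_measurable) auto
  show "(\<lambda>m. grid_entry_time m U (traj \<omega>)) \<longlonglongrightarrow> entry_time U (traj \<omega>)" for \<omega>
  proof (cases "enters U (traj \<omega>)")
    case True
    then show ?thesis by (rule grid_entry_time_tendsto[OF Y_right_continuous assms])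
  next
    case False
    then have "grid_entry_time m U (traj \<omega>) = 0" for m
      using grid_enters_imp_enters[of m U "traj \<omega>"] by (auto simp: grid_entry_time_def)
    then show ?thesis using False by (simp add: entry_time_def)
  qed
qed

text \<open>On the event that the first visit to \<open>U\<close> along the grid is at its \<open>k\<close>-th point, which is determined
  by the values on the grid up to this point, \<open>iexp (\<theta> * (Y - a))\<close> at the later time is its value at the
  grid point times \<open>iexp (\<theta> * d)\<close> with \<open>d\<close> the increment, which is independent of these values. The
  claim is the real part of the resulting identity, the characteristic function of \<open>d\<close> being real.\<close>

lemma first_grid_entry_markov:
  assumes [measurable]: "U \<in> sets borel" and t: "0 \<le> t"
  shows "(LINT \<omega>|M. of_bool (first_grid_entry m U (traj \<omega>) k) * cos (\<theta> * (Y (real k / 2 ^ m + t) \<omega> - a))) =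
    exp (- \<kappa> * t * \<bar>\<theta>\<bar> powr \<alpha>) * (LINT \<omega>|M. of_bool (first_grid_entry m U (traj \<omega>) k) * cos (\<theta> * (Y (real k / 2 ^ m) \<omega> - a)))"
proof (cases "t = 0")
  case False
  define B where "B y \<longleftrightarrow> y k \<in> U \<and> (\<forall>j<k. y j \<notin> U)" for y :: "nat \<Rightarrow> real"
  define G :: "(nat \<Rightarrow> real) \<Rightarrow> complex" where "G y = of_bool (B y) * iexp (\<theta> * (y k - a))" for y
  have comp: "(\<lambda>y. y j) \<in> borel_measurable (PiM {..k} (\<lambda>_. borel :: real measure))" if "j \<le> k" for j
    using that by (intro measurable_component_singleton) auto
  have 1: "Measurable.pred (PiM {..k} (\<lambda>_. borel :: real measure)) (\<lambda>y. y k \<in> U)"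
    by (rule pred_sets2[OF assms(1) comp]) simp
  have 2: "Measurable.pred (PiM {..k} (\<lambda>_. borel :: real measure)) (\<lambda>y. \<forall>j\<in>{..<k}. \<not> y j \<in> U)"
  proof (rule pred_intros_finite(3))
    fix j assume j: "j \<in> {..<k}"
    have [measurable]: "(\<lambda>y. y j) \<in> borel_measurable (PiM {..k} (\<lambda>_. borel :: real measure))"
      by (rule comp) (use j in simp)
    show "Measurable.pred (PiM {..k} (\<lambda>_. borel :: real measure)) (\<lambda>y. \<not> y j \<in> U)" by measurable
  qed simp
  have pred_B: "Measurable.pred (PiM {..k} (\<lambda>_. borel :: real measure)) (\<lambda>y. y k \<in> U \<and> (\<forall>j\<in>{..<k}. \<not> y j \<in> U))"
    using 1 2 by (rule pred_intros_logic)
  have [measurable]: "Measurable.pred (PiM {..k} (\<lambda>_. borel :: real measure)) B"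
    using pred_B by (simp add: B_def[abs_def] Ball_def)
  have [measurable]: "(\<lambda>y. y k) \<in> borel_measurable (PiM {..k} (\<lambda>_. borel :: real measure))"
    by (rule comp) simp
  have G_meas: "G \<in> borel_measurable (PiM {..k} (\<lambda>_. borel))"
    unfolding G_def[abs_def] of_bool_def by measurable
  have G1: "norm (G y) \<le> 1" for y
    unfolding G_def by (simp add: norm_mult)
  have path_B: "B (\<lambda>j\<in>{..k}. Y (real j / 2 ^ m) \<omega>) = first_grid_entry m U (traj \<omega>) k" for \<omega>
    by (auto simp: B_def first_grid_entry_def)
  have G_path: "G (\<lambda>j\<in>{..k}. Y (real j / 2 ^ m) \<omega>) =
      of_bool (first_grid_entry m U (traj \<omega>) k) * iexp (\<theta> * (Y (real k / 2 ^ m) \<omega> - a))" for \<omega>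
    unfolding G_def path_B by simp
  have Re_iexp: "Re (of_bool b * iexp y) = of_bool b * cos y" for b y
    unfolding cis_conv_exp[symmetric] by (simp add: of_bool_def)
  have Re_mult: "Re (z * of_real r) = Re z * r" for z r by simp
  have int: "integrable M (\<lambda>\<omega>. of_bool (first_grid_entry m U (traj \<omega>) k) * iexp (\<theta> * (Y s \<omega> - a)))" for s
    unfolding of_bool_def by (intro integrable_const_bound[where B = 1]) (auto simp: norm_mult)
  have "(LINT \<omega>|M. G (\<lambda>j\<in>{..k}. Y (real j / 2 ^ m) \<omega>) * iexp (\<theta> * (Y (real k / 2 ^ m + t) \<omega> - Y (real k / 2 ^ m) \<omega>))) =
      (LINT \<omega>|M. G (\<lambda>j\<in>{..k}. Y (real j / 2 ^ m) \<omega>)) * of_real (exp (- \<kappa> * t * \<bar>\<theta>\<bar> powr \<alpha>))"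
    using False t by (intro Y_markov G_meas G1) auto
  also have "(\<lambda>\<omega>. G (\<lambda>j\<in>{..k}. Y (real j / 2 ^ m) \<omega>) * iexp (\<theta> * (Y (real k / 2 ^ m + t) \<omega> - Y (real k / 2 ^ m) \<omega>))) =
     (\<lambda>\<omega>. of_bool (first_grid_entry m U (traj \<omega>) k) * iexp (\<theta> * (Y (real k / 2 ^ m + t) \<omega> - a)))"
  proof
    fix \<omega>
    have e: "iexp (x - a) * iexp (y - x) = iexp (y - a)" for x y a :: real
      by (simp add: exp_add[symmetric] algebra_simps)
    show "G (\<lambda>j\<in>{..k}. Y (real j / 2 ^ m) \<omega>) * iexp (\<theta> * (Y (real k / 2 ^ m + t) \<omega> - Y (real k / 2 ^ m) \<omega>)) =
      of_bool (first_grid_entry m U (traj \<omega>) k) * iexp (\<theta> * (Y (real k / 2 ^ m + t) \<omega> - a))"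
      unfolding G_path mult.assoc right_diff_distrib e ..
  qed
  finally have "Re (LINT \<omega>|M. of_bool (first_grid_entry m U (traj \<omega>) k) * iexp (\<theta> * (Y (real k / 2 ^ m + t) \<omega> - a))) =
     Re ((LINT \<omega>|M. of_bool (first_grid_entry m U (traj \<omega>) k) * iexp (\<theta> * (Y (real k / 2 ^ m) \<omega> - a))) * of_real (exp (- \<kappa> * t * \<bar>\<theta>\<bar> powr \<alpha>)))"
    unfolding G_path by (rule arg_cong)
  then show ?thesis
    unfolding Re_mult integral_Re[OF int, symmetric] Re_iexp by (simp only: mult.commute)
qed simp

lemma expectation_at_grid_entry_sums:
  fixes f :: "nat \<Rightarrow> 'a \<Rightarrow> real"
  assumes [measurable]: "U \<in> sets borel" "\<And>k. f k \<in> borel_measurable M"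
    and f: "\<And>k \<omega>. \<bar>f k \<omega>\<bar> \<le> 1" and q: "0 < q"
  shows "(\<lambda>k. exp (- q * (real k / 2 ^ m)) * (LINT \<omega>|M. of_bool (first_grid_entry m U (traj \<omega>) k) * f k \<omega>)) sums
    (LINT \<omega>|M. grid_entry_discount q m U (traj \<omega>) * f (grid_entry_index m U (traj \<omega>)) \<omega>)"
proof -
  define c where "c k \<omega> = of_bool (first_grid_entry m U (traj \<omega>) k) * (exp (- q * (real k / 2 ^ m)) * f k \<omega>)" for k \<omega>
  have [measurable]: "c k \<in> borel_measurable M" for k unfolding c_def of_bool_def by measurable
  have c_le: "\<bar>c k \<omega>\<bar> \<le> exp (- q / 2 ^ m) ^ k" for k \<omega>
  proof -
    have "\<bar>c k \<omega>\<bar> \<le> 1 * (exp (- q * (real k / 2 ^ m)) * 1)"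
      unfolding c_def abs_mult using f by (intro mult_mono) auto
    also have "\<dots> = exp (- q / 2 ^ m) ^ k" by (simp add: exp_of_nat_mult[symmetric])
    finally show ?thesis .
  qed
  have geo: "summable (\<lambda>k. exp (- q / 2 ^ m) ^ k)"
    using q by (intro summable_geometric) simp
  have c_int: "integrable M (c k)" for k
    using c_le by (intro integrable_const_bound[where B = "exp (- q / 2 ^ m) ^ k"]) auto
  have "(\<lambda>k. LINT \<omega>|M. c k \<omega>) sums (LINT \<omega>|M. (\<Sum>k. c k \<omega>))"
  proof (rule sums_integral[OF c_int])
    show "AE \<omega> in M. summable (\<lambda>k. norm (c k \<omega>))"
      by (intro AE_I2 summable_comparison_test'[OF geo]) (use c_le in simp)
    show "summable (\<lambda>k. LINT \<omega>|M. norm (c k \<omega>))"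
    proof (rule summable_comparison_test'[OF geo])
      fix k :: nat
      have "(LINT \<omega>|M. norm (c k \<omega>)) \<le> (LINT \<omega>|M. exp (- q / 2 ^ m) ^ k)"
        using c_int c_le by (intro integral_mono) auto
      then show "norm (LINT \<omega>|M. norm (c k \<omega>)) \<le> exp (- q / 2 ^ m) ^ k"
        by (simp add: prob_space)
    qed
  qed
  also have "(\<lambda>\<omega>. (\<Sum>k. c k \<omega>)) = (\<lambda>\<omega>. grid_entry_discount q m U (traj \<omega>) * f (grid_entry_index m U (traj \<omega>)) \<omega>)"
  proof
    fix \<omega>
    have "(\<lambda>k. c k \<omega>) sums (of_bool (grid_enters m U (traj \<omega>)) * (exp (- q * (real (grid_entry_index m U (traj \<omega>)) / 2 ^ m)) * f (grid_entry_index m U (traj \<omega>)) \<omega>))"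
      unfolding c_def by (rule first_grid_entry_sums)
    then show "(\<Sum>k. c k \<omega>) = grid_entry_discount q m U (traj \<omega>) * f (grid_entry_index m U (traj \<omega>)) \<omega>"
      by (simp add: sums_iff grid_entry_discount_def grid_entry_time_def)
  qed
  also have "(\<lambda>k. LINT \<omega>|M. c k \<omega>) = (\<lambda>k. exp (- q * (real k / 2 ^ m)) * (LINT \<omega>|M. of_bool (first_grid_entry m U (traj \<omega>) k) * f k \<omega>))"
    unfolding c_def mult.left_commute[of "of_bool _"] integral_mult_right_zero ..
  finally show ?thesis .
qed

lemma grid_entry_markov:
  assumes U[measurable]: "U \<in> sets borel" and q: "0 < q" and t: "0 \<le> t"
  shows "(LINT \<omega>|M. grid_entry_discount q m U (traj \<omega>) * cos (\<theta> * (Y (grid_entry_time m U (traj \<omega>) + t) \<omega> - a))) =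
    exp (- \<kappa> * t * \<bar>\<theta>\<bar> powr \<alpha>) *
    (LINT \<omega>|M. grid_entry_discount q m U (traj \<omega>) * cos (\<theta> * (Y (grid_entry_time m U (traj \<omega>)) \<omega> - a)))"
proof -
  have *: "(LINT \<omega>|M. grid_entry_discount q m U (traj \<omega>) * cos (\<theta> * (Y (real (grid_entry_index m U (traj \<omega>)) / 2 ^ m + s) \<omega> - a))) =
     (LINT \<omega>|M. grid_entry_discount q m U (traj \<omega>) * cos (\<theta> * (Y (grid_entry_time m U (traj \<omega>) + s) \<omega> - a)))" for s
    by (intro Bochner_Integration.integral_cong refl) (simp add: grid_entry_discount_def grid_entry_time_def)
  have S: "(\<lambda>k. exp (- q * (real k / 2 ^ m)) * (LINT \<omega>|M. of_bool (first_grid_entry m U (traj \<omega>) k) * cos (\<theta> * (Y (real k / 2 ^ m + s) \<omega> - a)))) sums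
    (LINT \<omega>|M. grid_entry_discount q m U (traj \<omega>) * cos (\<theta> * (Y (grid_entry_time m U (traj \<omega>) + s) \<omega> - a)))" for s
    unfolding *[symmetric]
    by (rule expectation_at_grid_entry_sums[where f = "\<lambda>k \<omega>. cos (\<theta> * (Y (real k / 2 ^ m + s) \<omega> - a))", OF U _ _ q]) auto
  have "(\<lambda>k. exp (- \<kappa> * t * \<bar>\<theta>\<bar> powr \<alpha>) * (exp (- q * (real k / 2 ^ m)) * (LINT \<omega>|M. of_bool (first_grid_entry m U (traj \<omega>) k) * cos (\<theta> * (Y (real k / 2 ^ m + 0) \<omega> - a))))) sums
    (exp (- \<kappa> * t * \<bar>\<theta>\<bar> powr \<alpha>) * (LINT \<omega>|M. grid_entry_discount q m U (traj \<omega>) * cos (\<theta> * (Y (grid_entry_time m U (traj \<omega>) + 0) \<omega> - a))))"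
    by (rule sums_mult[OF S])
  then show ?thesis
    using S[of t] unfolding first_grid_entry_markov[OF U t] add_0_right mult.left_commute[of "exp (- q * _)"]
    by (rule sums_unique2[symmetric])
qed

text \<open>On the grid, the process is in the ball at its entry time, so replacing \<open>cos (\<theta> * (Y - a))\<close> by
  \<open>1\<close> costs at most \<open>\<bar>\<theta>\<bar> * \<epsilon>\<close>. The bound by \<open>2\<close> keeps the error integrable in \<open>\<theta>\<close> later on.
  The grid is then refined.\<close>

lemma entry_markov_approx:
  fixes a \<epsilon> q t \<theta> :: real
  assumes q: "0 < q" and t: "0 \<le> t" and \<epsilon>: "0 < \<epsilon>"
  defines "U \<equiv> ball a \<epsilon>"
  shows "\<bar>(LINT \<omega>|M. entry_discount q U (traj \<omega>) * cos (\<theta> * (Y (entry_time U (traj \<omega>) + t) \<omega> - a))) -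
      exp (- \<kappa> * t * \<bar>\<theta>\<bar> powr \<alpha>) * (LINT \<omega>|M. entry_discount q U (traj \<omega>))\<bar>
    \<le> exp (- \<kappa> * t * \<bar>\<theta>\<bar> powr \<alpha>) * min 2 (\<bar>\<theta>\<bar> * \<epsilon>)"
proof -
  have U: "open U" "U \<in> sets borel" unfolding U_def by auto
  let ?A = "\<lambda>m. LINT \<omega>|M. grid_entry_discount q m U (traj \<omega>) * cos (\<theta> * (Y (grid_entry_time m U (traj \<omega>) + t) \<omega> - a))"
  let ?B = "\<lambda>m. LINT \<omega>|M. grid_entry_discount q m U (traj \<omega>)"
  let ?e = "exp (- \<kappa> * t * \<bar>\<theta>\<bar> powr \<alpha>)"
  have b: "\<bar>grid_entry_discount q m U x\<bar> \<le> 1" for m x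
    using grid_entry_discount_bounds[of q m U x] q by auto
  have b': "\<bar>grid_entry_discount q m U x * cos y\<bar> \<le> 1" for m x y
    unfolding abs_mult using b[of m x] abs_cos_le_one[of y] by (intro mult_le_one) auto
  have meas[measurable]: "(\<lambda>\<omega>. grid_entry_discount q m U (traj \<omega>)) \<in> borel_measurable M"
      "(\<lambda>\<omega>. Y (grid_entry_time m U (traj \<omega>) + s) \<omega>) \<in> borel_measurable M" for m s
    using U by (intro grid_entry_discount_measurable Y_at_measurable borel_measurable_add
        grid_entry_time_measurable measurable_const measurable_ident_sets refl; simp)+
  have meas'[measurable]: "(\<lambda>\<omega>. entry_discount q U (traj \<omega>)) \<in> borel_measurable M"
      "(\<lambda>\<omega>. Y (entry_time U (traj \<omega>) + s) \<omega>) \<in> borel_measurable M" for s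
    using U by (intro entry_discount_measurable Y_at_measurable borel_measurable_add
        entry_time_measurable measurable_const measurable_ident_sets refl; simp)+
  have limA: "?A \<longlonglongrightarrow> (LINT \<omega>|M. entry_discount q U (traj \<omega>) * cos (\<theta> * (Y (entry_time U (traj \<omega>) + t) \<omega> - a)))"
  proof (rule integral_dominated_convergence[where w = "\<lambda>_. 1"])
    show "AE \<omega> in M. (\<lambda>m. grid_entry_discount q m U (traj \<omega>) * cos (\<theta> * (Y (grid_entry_time m U (traj \<omega>) + t) \<omega> - a)))
        \<longlonglongrightarrow> entry_discount q U (traj \<omega>) * cos (\<theta> * (Y (entry_time U (traj \<omega>) + t) \<omega> - a))"
      by (intro AE_I2 grid_entry_discount_mult_tendsto[where f = "\<lambda>y. cos (\<theta> * (y - a))"] Y_right_continuous U)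
         (intro continuous_intros)
  qed (use b' in simp_all)
  have limB: "?B \<longlonglongrightarrow> (LINT \<omega>|M. entry_discount q U (traj \<omega>))"
  proof (rule integral_dominated_convergence[where w = "\<lambda>_. 1"])
    show "AE \<omega> in M. (\<lambda>m. grid_entry_discount q m U (traj \<omega>)) \<longlonglongrightarrow> entry_discount q U (traj \<omega>)"
      by (intro AE_I2 grid_entry_discount_tendsto Y_right_continuous U)
  qed (use b in simp_all)
  have bound: "\<bar>?A m - ?e * ?B m\<bar> \<le> ?e * min 2 (\<bar>\<theta>\<bar> * \<epsilon>)" for m
  proof -
    let ?C = "LINT \<omega>|M. grid_entry_discount q m U (traj \<omega>) * cos (\<theta> * (Y (grid_entry_time m U (traj \<omega>) + 0) \<omega> - a))"
    have I1: "integrable M (\<lambda>\<omega>. grid_entry_discount q m U (traj \<omega>) * cos (\<theta> * (Y (grid_entry_time m U (traj \<omega>) + 0) \<omega> - a)))"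
      by (rule integrable_const_bound[where B = 1]) (use b' in simp, measurable)
    have I2: "integrable M (\<lambda>\<omega>. grid_entry_discount q m U (traj \<omega>))"
      by (rule integrable_const_bound[where B = 1]) (use b in simp, measurable)
    have "\<bar>?C - ?B m\<bar> = \<bar>LINT \<omega>|M. grid_entry_discount q m U (traj \<omega>) * cos (\<theta> * (Y (grid_entry_time m U (traj \<omega>) + 0) \<omega> - a)) - grid_entry_discount q m U (traj \<omega>)\<bar>"
      by (subst Bochner_Integration.integral_diff[OF I1 I2]) (rule refl)
    also have "\<dots> \<le> (LINT \<omega>|M. min 2 (\<bar>\<theta>\<bar> * \<epsilon>))"
    proof (rule order_trans[OF integral_abs_bound integral_mono])
      show "integrable M (\<lambda>\<omega>. \<bar>grid_entry_discount q m U (traj \<omega>) * cos (\<theta> * (Y (grid_entry_time m U (traj \<omega>) + 0) \<omega> - a)) - grid_entry_discount q m U (traj \<omega>)\<bar>)"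
        by (intro integrable_abs Bochner_Integration.integrable_diff I1 I2)
      fix \<omega>
      let ?y = "\<theta> * (Y (grid_entry_time m U (traj \<omega>) + 0) \<omega> - a)"
      show "\<bar>grid_entry_discount q m U (traj \<omega>) * cos ?y - grid_entry_discount q m U (traj \<omega>)\<bar> \<le> min 2 (\<bar>\<theta>\<bar> * \<epsilon>)"
      proof (cases "grid_enters m U (traj \<omega>)")
        case True
        have "dist a (Y (grid_entry_time m U (traj \<omega>)) \<omega>) < \<epsilon>"
          using at_grid_entry[OF True] by (simp add: U_def)
        then have "\<bar>?y\<bar> \<le> \<bar>\<theta>\<bar> * \<epsilon>"
          unfolding abs_mult by (intro mult_left_mono) (auto simp: dist_real_def)
        then have "\<bar>cos ?y - 1\<bar> \<le> min 2 (\<bar>\<theta>\<bar> * \<epsilon>)"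
          using abs_cos_minus_1_le[of ?y] by linarith
        then have "\<bar>grid_entry_discount q m U (traj \<omega>)\<bar> * \<bar>cos ?y - 1\<bar> \<le> 1 * min 2 (\<bar>\<theta>\<bar> * \<epsilon>)"
          using b[of m "traj \<omega>"] by (intro mult_mono) auto
        moreover have "grid_entry_discount q m U (traj \<omega>) * cos ?y - grid_entry_discount q m U (traj \<omega>) =
           grid_entry_discount q m U (traj \<omega>) * (cos ?y - 1)" by (simp only: right_diff_distrib mult_1_right)
        ultimately show ?thesis by (simp only: abs_mult mult_1)
      next
        case False
        have "0 \<le> min 2 (\<bar>\<theta>\<bar> * \<epsilon>)" using \<epsilon> by simp
        then show ?thesis using False by (simp add: grid_entry_discount_def)
      qed
    qed simp
    also have "\<dots> = min 2 (\<bar>\<theta>\<bar> * \<epsilon>)" by (simp add: prob_space)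
    finally have "?e * \<bar>?C - ?B m\<bar> \<le> ?e * min 2 (\<bar>\<theta>\<bar> * \<epsilon>)" by (intro mult_left_mono) auto
    moreover have "?A m = ?e * ?C"
      using grid_entry_markov[OF U(2) q t] by simp
    ultimately show ?thesis by (simp add: abs_mult right_diff_distrib[symmetric])
  qed
  show ?thesis
    by (rule LIMSEQ_le_const2[OF tendsto_rabs[OF tendsto_diff[OF limA tendsto_mult[OF tendsto_const limB]]]])
       (use bound in blast)
qed

text \<open>Integrated over the discounted time \<open>t\<close> elapsed since the entry, the exponential decay in \<open>t\<close>
  becomes the resolvent symbol \<open>1 / (p + \<kappa> * \<bar>\<theta>\<bar> powr \<alpha>)\<close>.\<close>

lemma entry_resolvent_approx:
  fixes a \<epsilon> p q \<theta> :: real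
  assumes q: "0 < q" and p: "0 < p" and \<epsilon>: "0 < \<epsilon>"
  defines "U \<equiv> ball a \<epsilon>"
  shows "\<bar>(LINT \<omega>|M. entry_discount q U (traj \<omega>) * (LINT t|discount_measure p. cos (\<theta> * (Y (entry_time U (traj \<omega>) + t) \<omega> - a)))) -
      (LINT \<omega>|M. entry_discount q U (traj \<omega>)) / (p + \<kappa> * \<bar>\<theta>\<bar> powr \<alpha>)\<bar>
    \<le> min 2 (\<bar>\<theta>\<bar> * \<epsilon>) / (p + \<kappa> * \<bar>\<theta>\<bar> powr \<alpha>)"
proof -
  let ?\<mu> = "discount_measure p"
  interpret \<mu>: finite_measure ?\<mu> by (rule finite_discount_measure[OF p])
  interpret P: pair_sigma_finite M ?\<mu> by standard
  interpret PF: finite_measure "M \<Otimes>\<^sub>M ?\<mu>"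
    by (intro finite_measure_pair_measure) (rule \<mu>.finite_measure_axioms finite_measure_axioms)+
  have U: "open U" unfolding U_def by auto
  have [measurable]: "(\<lambda>\<omega>. entry_discount q U (traj \<omega>)) \<in> borel_measurable M" "(\<lambda>\<omega>. entry_time U (traj \<omega>)) \<in> borel_measurable M"
    using U by (auto intro: entry_discount_measurable entry_time_measurable)
  have b: "\<bar>entry_discount q U x * cos y\<bar> \<le> 1" for x y
    unfolding abs_mult using entry_discount_bounds[of q U x] q abs_cos_le_one[of y] by (intro mult_le_one) auto
  have [measurable]: "(\<lambda>z. Y (entry_time U (traj (fst z)) + snd z) (fst z)) \<in> borel_measurable (M \<Otimes>\<^sub>M ?\<mu>)"
    by (rule Y_at_measurable) measurable
  have I: "integrable (M \<Otimes>\<^sub>M ?\<mu>) (\<lambda>(\<omega>, t). entry_discount q U (traj \<omega>) * cos (\<theta> * (Y (entry_time U (traj \<omega>) + t) \<omega> - a)))"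
    unfolding case_prod_beta' by (rule PF.integrable_const_bound[where B = 1]) (use b in simp, measurable)
  define l where "l = \<kappa> * \<bar>\<theta>\<bar> powr \<alpha>"
  have l: "0 \<le> l" using \<kappa>_pos by (simp add: l_def)
  have e: "exp (- \<kappa> * t * \<bar>\<theta>\<bar> powr \<alpha>) = exp (- l * t)" for t by (simp add: l_def mult_ac)
  let ?A = "\<lambda>t. LINT \<omega>|M. entry_discount q U (traj \<omega>) * cos (\<theta> * (Y (entry_time U (traj \<omega>) + t) \<omega> - a))"
  let ?D = "LINT \<omega>|M. entry_discount q U (traj \<omega>)"
  let ?m = "min 2 (\<bar>\<theta>\<bar> * \<epsilon>)"
  have A_int: "integrable ?\<mu> ?A" by (rule P.integrable_snd[OF I])
  have exp_int: "integrable ?\<mu> (\<lambda>t. exp (- l * t))"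
    by (rule \<mu>.integrable_const_bound[where B = 1])
       (use AE_discount_measure[of p] in \<open>auto elim!: eventually_mono simp: l\<close>)
  have "(LINT \<omega>|M. entry_discount q U (traj \<omega>) * (LINT t|?\<mu>. cos (\<theta> * (Y (entry_time U (traj \<omega>) + t) \<omega> - a)))) =
     (LINT \<omega>|M. (LINT t|?\<mu>. entry_discount q U (traj \<omega>) * cos (\<theta> * (Y (entry_time U (traj \<omega>) + t) \<omega> - a))))"
    by simp
  also have "\<dots> = (LINT t|?\<mu>. ?A t)" by (rule P.Fubini_integral[OF I, symmetric])
  finally have 1: "(LINT \<omega>|M. entry_discount q U (traj \<omega>) * (LINT t|?\<mu>. cos (\<theta> * (Y (entry_time U (traj \<omega>) + t) \<omega> - a)))) = (LINT t|?\<mu>. ?A t)" .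
  have 2: "?D / (p + l) = (LINT t|?\<mu>. exp (- l * t) * ?D)"
    unfolding integral_mult_left_zero integral_exp_discount_measure[OF p l] by simp
  have "\<bar>(LINT t|?\<mu>. ?A t) - (LINT t|?\<mu>. exp (- l * t) * ?D)\<bar> = \<bar>LINT t|?\<mu>. ?A t - exp (- l * t) * ?D\<bar>"
    by (subst Bochner_Integration.integral_diff[OF A_int integrable_mult_left[OF exp_int]]) (rule refl)
  also have "\<dots> \<le> (LINT t|?\<mu>. exp (- l * t) * ?m)"
  proof (rule order_trans[OF integral_abs_bound integral_mono_AE])
    show "integrable ?\<mu> (\<lambda>t. \<bar>?A t - exp (- l * t) * ?D\<bar>)"
      by (intro integrable_abs Bochner_Integration.integrable_diff A_int integrable_mult_left exp_int)
    show "integrable ?\<mu> (\<lambda>t. exp (- l * t) * ?m)" by (intro integrable_mult_left exp_int)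
    show "AE t in ?\<mu>. \<bar>?A t - exp (- l * t) * ?D\<bar> \<le> exp (- l * t) * ?m"
      using AE_discount_measure[of p]
    proof eventually_elim
      case (elim t)
      show ?case using entry_markov_approx[OF q elim \<epsilon>, of a \<theta>] unfolding e U_def .
    qed
  qed
  also have "\<dots> = ?m / (p + l)"
    unfolding integral_mult_left_zero integral_exp_discount_measure[OF p l] by simp
  finally show ?thesis unfolding 1 2 l_def[symmetric] .
qed

section \<open>The Laplace transform of the hitting time\<close>

lemma expectation_cos:
  assumes "0 \<le> t"
  shows "(LINT \<omega>|M. cos (\<theta> * (Y t \<omega> - a))) = exp (- (\<kappa> * \<bar>\<theta>\<bar> powr \<alpha>) * t) * cos (\<theta> * a)"
proof -
  have [simp]: "first_grid_entry 0 UNIV x 0" for x by (simp add: first_grid_entry_def)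
  show ?thesis
    using first_grid_entry_markov[of UNIV t 0 0 \<theta> a] assms
    by (simp add: Y_0 prob_space mult_ac)
qed

text \<open>The resolvent started at \<open>0\<close> is the discounted occupation measure before the entry into the
  ball (the measure \<open>N\<close> of the proof) plus the one after it. In terms of Fourier transforms centred
  at \<open>a\<close>, the whole is \<open>cos (\<theta> * a) / (q + \<kappa> * \<bar>\<theta>\<bar> powr \<alpha>)\<close>, the second part is
  \<open>D / (q + \<kappa> * \<bar>\<theta>\<bar> powr \<alpha>)\<close> up to the error of \<open>entry_resolvent_approx\<close>, and the integral over
  \<open>\<theta>\<close> of the first part vanishes because it does not charge the ball.\<close>

lemma entry_resolvent_identity_approx:
  fixes a \<epsilon> q :: real
  assumes q: "0 < q" and \<epsilon>: "0 < \<epsilon>"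
  defines "D \<equiv> LINT \<omega>|M. entry_discount q (ball a \<epsilon>) (traj \<omega>)"
  shows "\<bar>resolvent_kernel \<kappa> \<alpha> q a - D * resolvent_kernel \<kappa> \<alpha> q 0\<bar>
    \<le> (LBINT \<theta>. min 2 (\<bar>\<theta>\<bar> * \<epsilon>) / (q + \<kappa> * \<bar>\<theta>\<bar> powr \<alpha>))"
proof -
  define U where "U = ball a \<epsilon>"
  have U: "open U" unfolding U_def by auto
  let ?\<mu> = "discount_measure q"
  let ?P = "M \<Otimes>\<^sub>M ?\<mu>"
  interpret \<mu>: finite_measure ?\<mu> by (rule finite_discount_measure[OF q])
  interpret P: pair_sigma_finite M ?\<mu> by standard
  interpret PF: finite_measure ?P
    by (intro finite_measure_pair_measure) (rule \<mu>.finite_measure_axioms finite_measure_axioms)+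
  have [measurable]: "(\<lambda>\<omega>. entry_time U (traj \<omega>)) \<in> borel_measurable M"
    using U by (auto intro: entry_time_measurable)
  have [measurable]: "(\<lambda>z. Y (snd z) (fst z)) \<in> borel_measurable ?P"
    by (rule Y_at_measurable) measurable
  have enters_pred[measurable]: "Measurable.pred M (\<lambda>\<omega>. enters U (traj \<omega>))"
  proof -
    have [measurable]: "(\<lambda>\<omega>. entry_discount 1 U (traj \<omega>)) \<in> borel_measurable M" by (rule entry_discount_measurable[OF U])
    have "Measurable.pred M (\<lambda>\<omega>. entry_discount 1 U (traj \<omega>) \<noteq> 0)" by measurable
    then show ?thesis by (simp add: entry_discount_def)
  qed
  define E where "E z \<longleftrightarrow> enters U (traj (fst z)) \<and> entry_time U (traj (fst z)) \<le> snd z" for z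
  have [measurable]: "Measurable.pred ?P E" unfolding E_def by measurable
  define N where "N = density ?P (\<lambda>z. ennreal (of_bool (\<not> E z)))"
  have N_fin: "finite_measure N"
  proof (rule finite_measureI)
    have "emeasure N (space N) = (\<integral>\<^sup>+z. ennreal (of_bool (\<not> E z)) * indicator (space ?P) z \<partial>?P)"
      unfolding N_def space_density of_bool_def by (subst emeasure_density[OF _ sets.top]) simp_all
    also have "\<dots> \<le> (\<integral>\<^sup>+z. 1 \<partial>?P)"
      by (intro nn_integral_mono) (simp add: indicator_def of_bool_def)
    also have "\<dots> = emeasure ?P (space ?P)" by simp
    finally show "emeasure N (space N) \<noteq> \<infinity>"
      using PF.emeasure_finite[of "space ?P"] by (auto simp: top_unique)
  qed
  define Z where "Z z = Y (snd z) (fst z) - a" for z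
  have Z_meas[measurable]: "Z \<in> borel_measurable ?P" unfolding Z_def by measurable
  have Z_meas': "Z \<in> borel_measurable N" unfolding N_def by simp
  have AE_pos: "AE z in ?P. 0 \<le> snd z"
  proof (rule P.AE_pair_measure)
    show "{z \<in> space ?P. 0 \<le> snd z} \<in> sets ?P" by measurable
    show "AE \<omega> in M. AE t in ?\<mu>. 0 \<le> snd (\<omega>, t)"
      using AE_discount_measure[of q] by simp
  qed
  have Z_large: "AE z in N. \<epsilon> \<le> \<bar>Z z\<bar>"
    unfolding N_def
  proof (subst AE_density)
    show "AE z in ?P. 0 < ennreal (of_bool (\<not> E z)) \<longrightarrow> \<epsilon> \<le> \<bar>Z z\<bar>"
      using AE_pos
    proof eventually_elim
      case (elim z)
      show ?case
      proof
        assume "0 < ennreal (of_bool (\<not> E z))"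
        then have "enters U (traj (fst z)) \<longrightarrow> snd z < entry_time U (traj (fst z))"
          by (auto simp: E_def of_bool_def split: if_splits)
        from before_entry[OF elim this] show "\<epsilon> \<le> \<bar>Z z\<bar>"
          unfolding U_def Z_def by (simp add: dist_real_def abs_minus_commute)
      qed
    qed
  qed measurable
  define F where "F \<theta> = (LINT \<omega>|M. entry_discount q U (traj \<omega>) * (LINT t|?\<mu>. cos (\<theta> * (Y (entry_time U (traj \<omega>) + t) \<omega> - a))))" for \<theta>
  have transform: "(LINT z|N. cos (\<theta> * Z z)) = cos (\<theta> * a) / (q + \<kappa> * \<bar>\<theta>\<bar> powr \<alpha>) - F \<theta>" for \<theta>
  proof -
    have I1: "integrable ?P (\<lambda>(\<omega>, t). cos (\<theta> * (Y t \<omega> - a)))"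
      unfolding case_prod_beta' by (rule PF.integrable_const_bound[where B = 1]) simp_all
    have I2: "integrable ?P (\<lambda>(\<omega>, t). of_bool (E (\<omega>, t)) * cos (\<theta> * (Y t \<omega> - a)))"
      unfolding case_prod_beta' of_bool_def by (rule PF.integrable_const_bound[where B = 1]) simp_all
    have "(LINT z|N. cos (\<theta> * Z z)) = (LINT z|?P. of_bool (\<not> E z) * cos (\<theta> * Z z))"
      unfolding N_def of_bool_def by (subst integral_density) auto
    also have "\<dots> = (LINT z|?P. (case z of (\<omega>, t) \<Rightarrow> cos (\<theta> * (Y t \<omega> - a))) - (case z of (\<omega>, t) \<Rightarrow> of_bool (E (\<omega>, t)) * cos (\<theta> * (Y t \<omega> - a))))"
      by (intro Bochner_Integration.integral_cong refl) (simp add: Z_def of_bool_def case_prod_beta')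
    also have "\<dots> = (LINT z|?P. (case z of (\<omega>, t) \<Rightarrow> cos (\<theta> * (Y t \<omega> - a)))) - (LINT z|?P. (case z of (\<omega>, t) \<Rightarrow> of_bool (E (\<omega>, t)) * cos (\<theta> * (Y t \<omega> - a))))"
      by (rule Bochner_Integration.integral_diff[OF I1 I2])
    also have "(LINT z|?P. (case z of (\<omega>, t) \<Rightarrow> cos (\<theta> * (Y t \<omega> - a)))) = (LINT t|?\<mu>. LINT \<omega>|M. cos (\<theta> * (Y t \<omega> - a)))"
      using P.integral_snd[OF I1] by simp
    also have "\<dots> = (LINT t|?\<mu>. exp (- (\<kappa> * \<bar>\<theta>\<bar> powr \<alpha>) * t) * cos (\<theta> * a))"
    proof (rule integral_cong_AE)
      show "(\<lambda>t. LINT \<omega>|M. cos (\<theta> * (Y t \<omega> - a))) \<in> borel_measurable ?\<mu>"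
        using P.integrable_snd[OF I1] by (rule borel_measurable_integrable)
      show "AE t in ?\<mu>. (LINT \<omega>|M. cos (\<theta> * (Y t \<omega> - a))) = exp (- (\<kappa> * \<bar>\<theta>\<bar> powr \<alpha>) * t) * cos (\<theta> * a)"
        using AE_discount_measure[of q] by eventually_elim (rule expectation_cos)
    qed simp
    also have "\<dots> = cos (\<theta> * a) / (q + \<kappa> * \<bar>\<theta>\<bar> powr \<alpha>)"
      using \<kappa>_pos integral_exp_discount_measure[OF q, of "\<kappa> * \<bar>\<theta>\<bar> powr \<alpha>"] by simp
    also have "(LINT z|?P. (case z of (\<omega>, t) \<Rightarrow> of_bool (E (\<omega>, t)) * cos (\<theta> * (Y t \<omega> - a)))) =
       (LINT \<omega>|M. (LINT t|?\<mu>. of_bool (E (\<omega>, t)) * cos (\<theta> * (Y t \<omega> - a))))"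
      using P.integral_fst[OF I2] by simp
    also have "\<dots> = F \<theta>"
      unfolding F_def
    proof (intro Bochner_Integration.integral_cong refl)
      fix \<omega>
      let ?\<tau> = "entry_time U (traj \<omega>)"
      have [measurable]: "traj \<omega> \<in> borel_measurable borel"
        by (rule right_continuous_borel_measurable[OF Y_right_continuous])
      have "(LINT t|?\<mu>. of_bool (E (\<omega>, t)) * cos (\<theta> * (Y t \<omega> - a))) =
        (LINT t|?\<mu>. of_bool (enters U (traj \<omega>)) * (indicator {?\<tau>..} t * cos (\<theta> * (Y t \<omega> - a))))"
        by (intro Bochner_Integration.integral_cong refl) (simp add: E_def indicator_def)
      also have "\<dots> = of_bool (enters U (traj \<omega>)) * (LINT t|?\<mu>. indicator {?\<tau>..} t * cos (\<theta> * (Y t \<omega> - a)))"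
        by (rule integral_mult_right_zero)
      also have "(LINT t|?\<mu>. indicator {?\<tau>..} t * cos (\<theta> * (Y t \<omega> - a))) =
         exp (- q * ?\<tau>) * (exp (q * ?\<tau>) * (LINT t|?\<mu>. indicator {?\<tau>..} t * cos (\<theta> * (Y t \<omega> - a))))"
        by (simp add: mult.assoc[symmetric] exp_add[symmetric])
      also have "\<dots> = exp (- q * ?\<tau>) * (LINT t|?\<mu>. cos (\<theta> * (Y (?\<tau> + t) \<omega> - a)))"
        by (subst integral_discount_measure_shift[of "\<lambda>t. cos (\<theta> * (Y t \<omega> - a))", OF _ entry_time_nonneg]) simp_all
      finally show "(LINT t|?\<mu>. of_bool (E (\<omega>, t)) * cos (\<theta> * (Y t \<omega> - a))) =
         entry_discount q U (traj \<omega>) * (LINT t|?\<mu>. cos (\<theta> * (Y (?\<tau> + t) \<omega> - a)))"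
        by (simp only: entry_discount_def mult.assoc)
    qed
    finally show ?thesis .
  qed
  have D: "D = (LINT \<omega>|M. entry_discount q U (traj \<omega>))" by (simp add: D_def U_def)
  let ?h = "\<lambda>\<theta>. q + \<kappa> * \<bar>\<theta>\<bar> powr \<alpha>"
  have h: "0 < ?h \<theta>" for \<theta> by (rule powr_add_const_ge[OF q \<kappa>_pos])
  note hI = integrable_resolvent_symbol[OF q \<kappa>_pos \<alpha>_gt_1]
  have bound_int: "integrable lborel (\<lambda>\<theta>. min 2 (\<bar>\<theta>\<bar> * \<epsilon>) / ?h \<theta>)"
  proof (rule Bochner_Integration.integrable_bound[OF integrable_mult_right[OF hI, of 2]])
    show "AE \<theta> in lborel. norm (min 2 (\<bar>\<theta>\<bar> * \<epsilon>) / ?h \<theta>) \<le> norm (2 * (1 / ?h \<theta>))"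
      using h \<epsilon> by (intro AE_I2) (auto simp: abs_of_pos intro!: divide_right_mono less_imp_le[OF h])
  qed measurable
  have cosI: "integrable lborel (\<lambda>\<theta>. cos (a * \<theta>) / ?h \<theta>)"
    by (rule integrable_cos_resolvent_symbol[OF q \<kappa>_pos \<alpha>_gt_1])
  define R where "R \<theta> = (LINT z|N. cos (\<theta> * Z z)) - (cos (a * \<theta>) / ?h \<theta> - D / ?h \<theta>)" for \<theta>
  have R: "R \<theta> = D / ?h \<theta> - F \<theta>" for \<theta>
    unfolding R_def transform by (simp add: mult.commute)
  have R_le: "\<bar>R \<theta>\<bar> \<le> min 2 (\<bar>\<theta>\<bar> * \<epsilon>) / ?h \<theta>" for \<theta>
    using entry_resolvent_approx[OF q q \<epsilon>, of a \<theta>] unfolding R_def transform D F_def U_def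
    by (simp add: abs_minus_commute mult.commute)
  have R_meas: "R \<in> borel_measurable lborel"
  proof -
    interpret N: finite_measure N by (rule N_fin)
    have "(\<lambda>p. cos (fst p * Z (snd p))) \<in> borel_measurable (borel \<Otimes>\<^sub>M N)"
      using Z_meas' by measurable
    then have "(\<lambda>\<theta>. LINT z|N. cos (\<theta> * Z z)) \<in> borel_measurable borel"
      by (intro N.borel_measurable_lebesgue_integral) (simp add: case_prod_beta')
    then show ?thesis unfolding R_def by simp
  qed
  have RI: "integrable lborel R"
    by (rule Bochner_Integration.integrable_bound[OF bound_int R_meas])
       (intro AE_I2, unfold real_norm_def, rule order_trans[OF R_le abs_ge_self])
  have DI: "integrable lborel (\<lambda>\<theta>. D / ?h \<theta>)"
    using integrable_mult_right[OF hI, of D] by simp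
  have tI: "integrable lborel (\<lambda>\<theta>. LINT z|N. cos (\<theta> * Z z))"
  proof -
    have "integrable lborel (\<lambda>\<theta>. R \<theta> + (cos (a * \<theta>) / ?h \<theta> - D / ?h \<theta>))"
      by (intro Bochner_Integration.integrable_add Bochner_Integration.integrable_diff RI cosI DI)
    then show ?thesis by (simp add: R_def)
  qed
  have "(LBINT \<theta>. LINT z|N. cos (\<theta> * Z z)) = 0"
    by (rule integral_cos_transform_eq_0[OF N_fin Z_meas' \<epsilon> Z_large tI])
  moreover have "(LBINT \<theta>. R \<theta>) = (LBINT \<theta>. LINT z|N. cos (\<theta> * Z z)) - ((LBINT \<theta>. cos (a * \<theta>) / ?h \<theta>) - (LBINT \<theta>. D / ?h \<theta>))"
    unfolding R_def by (simp only: Bochner_Integration.integral_diff tI cosI DI Bochner_Integration.integrable_diff)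
  moreover have "(LBINT \<theta>. D / ?h \<theta>) = D * resolvent_kernel \<kappa> \<alpha> q 0"
    unfolding resolvent_kernel_def by (simp only: mult_zero_left cos_zero divide_inverse mult_1 integral_mult_right_zero)
  ultimately have "(LBINT \<theta>. R \<theta>) = - (resolvent_kernel \<kappa> \<alpha> q a - D * resolvent_kernel \<kappa> \<alpha> q 0)"
    unfolding resolvent_kernel_def by simp
  then have "\<bar>resolvent_kernel \<kappa> \<alpha> q a - D * resolvent_kernel \<kappa> \<alpha> q 0\<bar> = \<bar>LBINT \<theta>. R \<theta>\<bar>" by simp
  also have "\<dots> \<le> (LBINT \<theta>. min 2 (\<bar>\<theta>\<bar> * \<epsilon>) / ?h \<theta>)"
    by (rule order_trans[OF integral_abs_bound integral_mono[OF integrable_abs[OF RI] bound_int R_le]])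
  finally show ?thesis .
qed

lemma shrinking_ball_entry_measurable[measurable]:
  "(\<lambda>\<omega>. entry_discount q (shrinking_ball a n) (traj \<omega>)) \<in> borel_measurable M"
  "(\<lambda>\<omega>. entry_time (shrinking_ball a n) (traj \<omega>)) \<in> borel_measurable M"
  unfolding shrinking_ball_def by (rule entry_discount_measurable entry_time_measurable, simp)+

lemma approach_discount_measurable:
  "0 < q \<Longrightarrow> (\<lambda>\<omega>. approach_discount q a (traj \<omega>)) \<in> borel_measurable M"
  by (rule borel_measurable_LIMSEQ_real[OF entry_discount_tendsto_approach_discount]) auto

lemma approaches_measurable[measurable]: "Measurable.pred M (\<lambda>\<omega>. approaches a (traj \<omega>))"
proof -
  have [measurable]: "(\<lambda>\<omega>. approach_discount 1 a (traj \<omega>)) \<in> borel_measurable M"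
    by (rule approach_discount_measurable) simp
  have "Measurable.pred M (\<lambda>\<omega>. approach_discount 1 a (traj \<omega>) \<noteq> 0)" by measurable
  then show ?thesis by (simp add: approach_discount_def)
qed

lemma approach_time_measurable[measurable]: "(\<lambda>\<omega>. approach_time a (traj \<omega>)) \<in> borel_measurable M"
proof (rule borel_measurable_LIMSEQ_real)
  show "(\<lambda>\<omega>. of_bool (approaches a (traj \<omega>)) * entry_time (shrinking_ball a n) (traj \<omega>)) \<in> borel_measurable M" for n
    unfolding of_bool_def by measurable
  show "(\<lambda>n. of_bool (approaches a (traj \<omega>)) * entry_time (shrinking_ball a n) (traj \<omega>)) \<longlonglongrightarrow> approach_time a (traj \<omega>)" for \<omega>
    using entry_time_tendsto_approach_time[of a "traj \<omega>"]
    by (cases "approaches a (traj \<omega>)") (simp_all add: approach_time_def)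
qed

lemma approach_discount_measurable'[measurable]:
  "(\<lambda>\<omega>. approach_discount q a (traj \<omega>)) \<in> borel_measurable M"
  unfolding approach_discount_def of_bool_def by measurable

lemma expectation_entry_discount_tendsto:
  assumes q: "0 < q"
  shows "(\<lambda>n. LINT \<omega>|M. entry_discount q (shrinking_ball a n) (traj \<omega>)) \<longlonglongrightarrow> (LINT \<omega>|M. approach_discount q a (traj \<omega>))"
proof (rule integral_dominated_convergence[where w = "\<lambda>_. 1"])
  show "AE \<omega> in M. (\<lambda>n. entry_discount q (shrinking_ball a n) (traj \<omega>)) \<longlonglongrightarrow> approach_discount q a (traj \<omega>)"
    by (intro AE_I2 entry_discount_tendsto_approach_discount q)
  show "AE \<omega> in M. norm (entry_discount q (shrinking_ball a n) (traj \<omega>)) \<le> 1" for n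
    using entry_discount_bounds[of q "shrinking_ball a n"] q by (intro AE_I2) simp
qed simp_all

lemma approach_Laplace:
  assumes q: "0 < q"
  shows "(LINT \<omega>|M. approach_discount q a (traj \<omega>)) = resolvent_kernel \<kappa> \<alpha> q a / resolvent_kernel \<kappa> \<alpha> q 0"
proof -
  let ?h = "\<lambda>\<theta>. q + \<kappa> * \<bar>\<theta>\<bar> powr \<alpha>"
  have h: "0 < ?h \<theta>" for \<theta> by (rule powr_add_const_ge[OF q \<kappa>_pos])
  let ?e = "\<lambda>n. LBINT \<theta>. min 2 (\<bar>\<theta>\<bar> * (1 / Suc n)) / ?h \<theta>"
  have "?e \<longlonglongrightarrow> (LBINT \<theta>::real. 0)"
  proof (rule integral_dominated_convergence)
    show "integrable lborel (\<lambda>\<theta>. 2 * (1 / ?h \<theta>))"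
      by (intro integrable_mult_right integrable_resolvent_symbol q \<kappa>_pos \<alpha>_gt_1)
    show "AE \<theta> in lborel. (\<lambda>n. min 2 (\<bar>\<theta>\<bar> * (1 / Suc n)) / ?h \<theta>) \<longlonglongrightarrow> 0"
    proof (rule AE_I2)
      fix \<theta> :: real
      have "(\<lambda>n. \<bar>\<theta>\<bar> * (1 / real (Suc n))) \<longlonglongrightarrow> \<bar>\<theta>\<bar> * 0"
        by (intro tendsto_mult tendsto_const LIMSEQ_Suc[OF lim_const_over_n])
      from tendsto_divide[OF tendsto_min[OF tendsto_const[of 2] this] tendsto_const[of "?h \<theta>"]] h[of \<theta>]
      show "(\<lambda>n. min 2 (\<bar>\<theta>\<bar> * (1 / Suc n)) / ?h \<theta>) \<longlonglongrightarrow> 0" by simp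
    qed
    show "AE \<theta> in lborel. norm (min 2 (\<bar>\<theta>\<bar> * (1 / Suc n)) / ?h \<theta>) \<le> 2 * (1 / ?h \<theta>)" for n
    proof (rule AE_I2)
      fix \<theta> :: real
      have "norm (min 2 (\<bar>\<theta>\<bar> * (1 / Suc n)) / ?h \<theta>) = min 2 (\<bar>\<theta>\<bar> * (1 / Suc n)) / ?h \<theta>"
        using h[of \<theta>] by simp
      also have "\<dots> \<le> 2 / ?h \<theta>" using less_imp_le[OF h] by (intro divide_right_mono) simp_all
      finally show "norm (min 2 (\<bar>\<theta>\<bar> * (1 / Suc n)) / ?h \<theta>) \<le> 2 * (1 / ?h \<theta>)" by simp
    qed
  qed simp_all
  then have e0: "?e \<longlonglongrightarrow> 0" by simp
  let ?W = "resolvent_kernel \<kappa> \<alpha> q"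
  have "\<bar>?W a - (LINT \<omega>|M. approach_discount q a (traj \<omega>)) * ?W 0\<bar> \<le> 0"
  proof (rule LIMSEQ_le)
    show "(\<lambda>n. \<bar>?W a - (LINT \<omega>|M. entry_discount q (shrinking_ball a n) (traj \<omega>)) * ?W 0\<bar>)
      \<longlonglongrightarrow> \<bar>?W a - (LINT \<omega>|M. approach_discount q a (traj \<omega>)) * ?W 0\<bar>"
      by (intro tendsto_rabs tendsto_diff tendsto_mult tendsto_const expectation_entry_discount_tendsto q)
    show "\<exists>N. \<forall>n\<ge>N. \<bar>?W a - (LINT \<omega>|M. entry_discount q (shrinking_ball a n) (traj \<omega>)) * ?W 0\<bar> \<le> ?e n"
      unfolding shrinking_ball_def by (intro exI allI impI entry_resolvent_identity_approx q) simp
  qed (rule e0)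
  then show ?thesis
    using resolvent_kernel_0_pos[OF q \<kappa>_pos \<alpha>_gt_1] by (simp add: field_simps)
qed

text \<open>The Markov property at the limit of the entry times, as if the process started afresh from \<open>a\<close>
  there. Only averages over the future of that time enter, so that this holds before it is known
  where the process is at that time.\<close>

lemma approach_resolvent:
  assumes q: "0 < q" and p: "0 < p"
  shows "(LINT \<omega>|M. approach_discount q a (traj \<omega>) * (LINT t|discount_measure p. cos (\<theta> * (Y (approach_time a (traj \<omega>) + t) \<omega> - a)))) =
    (LINT \<omega>|M. approach_discount q a (traj \<omega>)) / (p + \<kappa> * \<bar>\<theta>\<bar> powr \<alpha>)"
proof -
  interpret \<mu>: finite_measure "discount_measure p" by (rule finite_discount_measure[OF p])
  have [measurable]: "traj \<omega> \<in> borel_measurable borel" for \<omega>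
    by (rule right_continuous_borel_measurable[OF Y_right_continuous])
  let ?J = "\<lambda>\<tau> \<omega>. LINT t|discount_measure p. cos (\<theta> * (Y (\<tau> + t) \<omega> - a))"
  have J_le: "\<bar>?J \<tau> \<omega>\<bar> \<le> 1 / p" for \<tau> \<omega>
    by (rule abs_integral_discount_measure_le[OF p]) simp_all
  have J_meas: "(\<lambda>\<omega>. ?J (T \<omega>) \<omega>) \<in> borel_measurable M" if [measurable]: "T \<in> borel_measurable M" for T
  proof (rule \<mu>.borel_measurable_lebesgue_integral)
    have [measurable]: "(\<lambda>z. Y (T (fst z) + snd z) (fst z)) \<in> borel_measurable (M \<Otimes>\<^sub>M discount_measure p)"
      by (rule Y_at_measurable) measurable
    show "(\<lambda>(\<omega>, t). cos (\<theta> * (Y (T \<omega> + t) \<omega> - a))) \<in> borel_measurable (M \<Otimes>\<^sub>M discount_measure p)"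
      unfolding case_prod_beta' by measurable
  qed
  let ?D = "\<lambda>n \<omega>. entry_discount q (shrinking_ball a n) (traj \<omega>)"
  let ?A = "\<lambda>n. LINT \<omega>|M. ?D n \<omega> * ?J (entry_time (shrinking_ball a n) (traj \<omega>)) \<omega>"
  let ?l = "p + \<kappa> * \<bar>\<theta>\<bar> powr \<alpha>"
  have limA: "?A \<longlonglongrightarrow> (LINT \<omega>|M. approach_discount q a (traj \<omega>) * ?J (approach_time a (traj \<omega>)) \<omega>)"
  proof (rule integral_dominated_convergence[where w = "\<lambda>_. 1 / p"])
    show "AE \<omega> in M. (\<lambda>n. ?D n \<omega> * ?J (entry_time (shrinking_ball a n) (traj \<omega>)) \<omega>) \<longlonglongrightarrow>
        approach_discount q a (traj \<omega>) * ?J (approach_time a (traj \<omega>)) \<omega>"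
    proof (rule AE_I2)
      fix \<omega>
      have lD: "(\<lambda>n. ?D n \<omega>) \<longlonglongrightarrow> approach_discount q a (traj \<omega>)"
        by (rule entry_discount_tendsto_approach_discount[OF q])
      show "(\<lambda>n. ?D n \<omega> * ?J (entry_time (shrinking_ball a n) (traj \<omega>)) \<omega>) \<longlonglongrightarrow>
        approach_discount q a (traj \<omega>) * ?J (approach_time a (traj \<omega>)) \<omega>"
      proof (cases "approaches a (traj \<omega>)")
        case True
        show ?thesis
          by (intro tendsto_mult lD integral_after_entry_tendsto[where f = "\<lambda>s. cos (\<theta> * (Y s \<omega> - a))" and x = "traj \<omega>", OF p _ _ True])
             simp_all
      next
        case False
        then have z: "approach_discount q a (traj \<omega>) = 0" by (simp add: approach_discount_def)
        have "(\<lambda>n. ?D n \<omega> * ?J (entry_time (shrinking_ball a n) (traj \<omega>)) \<omega>) \<longlonglongrightarrow> 0"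
        proof (rule Lim_null_comparison)
          show "\<forall>\<^sub>F n in sequentially. norm (?D n \<omega> * ?J (entry_time (shrinking_ball a n) (traj \<omega>)) \<omega>) \<le> ?D n \<omega> * (1 / p)"
          proof (intro always_eventually allI)
            fix n
            have D0: "0 \<le> ?D n \<omega>" using entry_discount_bounds(1) q by simp
            from mult_left_mono[OF J_le this]
            show "norm (?D n \<omega> * ?J (entry_time (shrinking_ball a n) (traj \<omega>)) \<omega>) \<le> ?D n \<omega> * (1 / p)"
              by (simp only: real_norm_def abs_mult abs_of_nonneg[OF D0])
          qed
          show "(\<lambda>n. ?D n \<omega> * (1 / p)) \<longlonglongrightarrow> 0"
            using tendsto_mult[OF lD tendsto_const[of "1 / p"]] unfolding z by simp
        qed
        then show ?thesis unfolding z by simp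
      qed
    qed
    show "AE \<omega> in M. norm (?D n \<omega> * ?J (entry_time (shrinking_ball a n) (traj \<omega>)) \<omega>) \<le> 1 / p" for n
    proof (rule AE_I2)
      fix \<omega>
      have "\<bar>?D n \<omega>\<bar> * \<bar>?J (entry_time (shrinking_ball a n) (traj \<omega>)) \<omega>\<bar> \<le> 1 * (1 / p)"
        using entry_discount_bounds[of q "shrinking_ball a n" "traj \<omega>"] q by (intro mult_mono J_le) auto
      then show "norm (?D n \<omega> * ?J (entry_time (shrinking_ball a n) (traj \<omega>)) \<omega>) \<le> 1 / p"
        by (simp only: real_norm_def abs_mult mult_1)
    qed
    show "(\<lambda>\<omega>. ?D n \<omega> * ?J (entry_time (shrinking_ball a n) (traj \<omega>)) \<omega>) \<in> borel_measurable M" for n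
      by (intro borel_measurable_times J_meas shrinking_ball_entry_measurable)
    show "(\<lambda>\<omega>. approach_discount q a (traj \<omega>) * ?J (approach_time a (traj \<omega>)) \<omega>) \<in> borel_measurable M"
      by (intro borel_measurable_times J_meas approach_discount_measurable' approach_time_measurable)
  qed simp_all
  have limB: "(\<lambda>n. (LINT \<omega>|M. ?D n \<omega>) / ?l) \<longlonglongrightarrow> (LINT \<omega>|M. approach_discount q a (traj \<omega>)) / ?l"
    using powr_add_const_ge(2)[OF p \<kappa>_pos, of \<theta> \<alpha>]
    by (intro tendsto_divide tendsto_const expectation_entry_discount_tendsto q) simp
  have e0: "(\<lambda>n. min 2 (\<bar>\<theta>\<bar> * (1 / Suc n)) / ?l) \<longlonglongrightarrow> 0"
  proof -
    have "(\<lambda>n. \<bar>\<theta>\<bar> * (1 / real (Suc n))) \<longlonglongrightarrow> \<bar>\<theta>\<bar> * 0"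
      by (intro tendsto_mult tendsto_const LIMSEQ_Suc[OF lim_const_over_n])
    from tendsto_divide[OF tendsto_min[OF tendsto_const[of 2] this] tendsto_const[of ?l]]
    show ?thesis using powr_add_const_ge(2)[OF p \<kappa>_pos, of \<theta> \<alpha>] by simp
  qed
  have "\<bar>(LINT \<omega>|M. approach_discount q a (traj \<omega>) * ?J (approach_time a (traj \<omega>)) \<omega>) - (LINT \<omega>|M. approach_discount q a (traj \<omega>)) / ?l\<bar> \<le> 0"
  proof (rule LIMSEQ_le[OF tendsto_rabs[OF tendsto_diff[OF limA limB]] e0])
    show "\<exists>N. \<forall>n\<ge>N. \<bar>?A n - (LINT \<omega>|M. ?D n \<omega>) / ?l\<bar> \<le> min 2 (\<bar>\<theta>\<bar> * (1 / Suc n)) / ?l"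
      unfolding shrinking_ball_def by (intro exI allI impI entry_resolvent_approx q p) simp
  qed
  then show ?thesis by simp
qed

section \<open>The process sits at the point at the limiting entry time\<close>

lemma cos_eq_1_all_scales:
  fixes y :: real
  assumes "\<And>n. cos (1 / real (Suc n) * y) = 1"
  shows "y = 0"
proof (rule ccontr)
  assume "y \<noteq> 0"
  obtain n where n: "\<bar>y\<bar> / 2 < real n" using reals_Archimedean2 by blast
  define z where "z = 1 / real (Suc n) * y"
  have z: "z \<noteq> 0" "\<bar>z\<bar> < 2" using \<open>y \<noteq> 0\<close> n by (auto simp: z_def abs_mult field_simps)
  have "cos 0 > cos \<bar>z\<bar>"
    using z pi_gt3 by (intro cos_monotone_0_pi) auto
  moreover have "cos z = 1" using assms[of n] by (simp only: z_def)
  ultimately show False by simp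
qed

text \<open>Letting \<open>p\<close> tend to infinity in \<open>approach_resolvent\<close> shows that the average of
  \<open>cos (\<theta> * (Y - a))\<close> at the limiting time, weighted by the discount factor, is as large as if the
  cosine were \<open>1\<close>. So the cosine is \<open>1\<close> almost surely, for countably many \<open>\<theta>\<close> at once.\<close>

lemma AE_at_approach_time: "AE \<omega> in M. approaches a (traj \<omega>) \<longrightarrow> Y (approach_time a (traj \<omega>)) \<omega> = a"
proof -
  let ?D = "\<lambda>\<omega>. approach_discount 1 a (traj \<omega>)" and ?T = "\<lambda>\<omega>. approach_time a (traj \<omega>)"
  have [measurable]: "(\<lambda>\<omega>. Y (?T \<omega>) \<omega>) \<in> borel_measurable M" by (rule Y_at_measurable) measurable
  have D_int: "integrable M ?D"
    by (rule integrable_const_bound[where B = 1]) (use approach_discount_bounds[of 1] in simp_all)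
  have D_le: "\<bar>?D \<omega>\<bar> \<le> 1" for \<omega> using approach_discount_bounds[of 1 a "traj \<omega>"] by simp
  have cos_int: "integrable M (\<lambda>\<omega>. ?D \<omega> * cos (\<theta> * (Y (?T \<omega>) \<omega> - a)))" for \<theta>
  proof (rule integrable_const_bound[where B = 1])
    show "AE \<omega> in M. norm (?D \<omega> * cos (\<theta> * (Y (?T \<omega>) \<omega> - a))) \<le> 1"
      using D_le by (intro AE_I2) (simp add: abs_mult mult_le_one)
  qed measurable
  have key: "(LINT \<omega>|M. ?D \<omega> * cos (\<theta> * (Y (?T \<omega>) \<omega> - a))) = (LINT \<omega>|M. ?D \<omega>)" for \<theta>
  proof (rule LIMSEQ_unique)
    let ?J = "\<lambda>n \<omega>. real (Suc n) * (LINT t|discount_measure (Suc n). cos (\<theta> * (Y (?T \<omega> + t) \<omega> - a)))"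
    have J_le: "\<bar>?J n \<omega>\<bar> \<le> 1" for n \<omega>
    proof -
      have [measurable]: "traj \<omega> \<in> borel_measurable borel"
        by (rule right_continuous_borel_measurable[OF Y_right_continuous])
      have "\<bar>LINT t|discount_measure (Suc n). cos (\<theta> * (Y (?T \<omega> + t) \<omega> - a))\<bar> \<le> 1 / real (Suc n)"
        by (rule abs_integral_discount_measure_le) simp_all
      then have "real (Suc n) * \<bar>LINT t|discount_measure (Suc n). cos (\<theta> * (Y (?T \<omega> + t) \<omega> - a))\<bar> \<le> real (Suc n) * (1 / real (Suc n))"
        by (rule mult_left_mono) simp
      also have "\<dots> = 1" by simp
      finally show ?thesis by (simp only: abs_mult abs_of_nat)
    qed
    have J_meas: "(\<lambda>\<omega>. ?J n \<omega>) \<in> borel_measurable M" for n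
    proof -
      interpret \<mu>: finite_measure "discount_measure (Suc n)" by (rule finite_discount_measure) simp
      have [measurable]: "(\<lambda>z. Y (?T (fst z) + snd z) (fst z)) \<in> borel_measurable (M \<Otimes>\<^sub>M discount_measure (Suc n))"
        by (rule Y_at_measurable) measurable
      show ?thesis
        by (intro borel_measurable_times borel_measurable_const \<mu>.borel_measurable_lebesgue_integral)
           (unfold case_prod_beta', measurable)
    qed
    show "(\<lambda>n. LINT \<omega>|M. ?D \<omega> * ?J n \<omega>) \<longlonglongrightarrow> (LINT \<omega>|M. ?D \<omega> * cos (\<theta> * (Y (?T \<omega>) \<omega> - a)))"
    proof (rule integral_dominated_convergence[where w = "\<lambda>_. 1"])
      show "AE \<omega> in M. (\<lambda>n. ?D \<omega> * ?J n \<omega>) \<longlonglongrightarrow> ?D \<omega> * cos (\<theta> * (Y (?T \<omega>) \<omega> - a))"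
        by (intro AE_I2 tendsto_mult tendsto_const
              discount_measure_average_tendsto[where f = "\<lambda>y. cos (\<theta> * (y - a))", OF Y_right_continuous])
           (auto intro!: continuous_intros)
      show "AE \<omega> in M. norm (?D \<omega> * ?J n \<omega>) \<le> 1" for n
        using mult_le_one[OF D_le abs_ge_zero J_le] by (intro AE_I2) (simp only: real_norm_def abs_mult)
      show "(\<lambda>\<omega>. ?D \<omega> * ?J n \<omega>) \<in> borel_measurable M" for n
        by (intro borel_measurable_times[OF approach_discount_measurable' J_meas])
      show "(\<lambda>\<omega>. ?D \<omega> * cos (\<theta> * (Y (?T \<omega>) \<omega> - a))) \<in> borel_measurable M" by measurable
    qed simp
    have "(LINT \<omega>|M. ?D \<omega> * ?J n \<omega>) = (LINT \<omega>|M. ?D \<omega>) * (real (Suc n) / (real (Suc n) + \<kappa> * \<bar>\<theta>\<bar> powr \<alpha>))" for n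
      unfolding mult.left_commute[of _ "real (Suc n)"] integral_mult_right_zero
      by (subst approach_resolvent) (simp_all add: mult.commute)
    moreover have "((\<lambda>p. p / (p + \<kappa> * \<bar>\<theta>\<bar> powr \<alpha>)) \<longlongrightarrow> 1) at_top" by real_asymp
    from filterlim_compose[OF this filterlim_compose[OF filterlim_real_sequentially filterlim_Suc]]
    have "(\<lambda>n. real (Suc n) / (real (Suc n) + \<kappa> * \<bar>\<theta>\<bar> powr \<alpha>)) \<longlonglongrightarrow> 1" .
    from tendsto_mult[OF tendsto_const this, of "LINT \<omega>|M. ?D \<omega>"]
    have "(\<lambda>n. (LINT \<omega>|M. ?D \<omega>) * (real (Suc n) / (real (Suc n) + \<kappa> * \<bar>\<theta>\<bar> powr \<alpha>))) \<longlonglongrightarrow> (LINT \<omega>|M. ?D \<omega>)" by simp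
    ultimately show "(\<lambda>n. LINT \<omega>|M. ?D \<omega> * ?J n \<omega>) \<longlonglongrightarrow> (LINT \<omega>|M. ?D \<omega>)" by simp
  qed
  have AE_cos: "AE \<omega> in M. ?D \<omega> - ?D \<omega> * cos (\<theta> * (Y (?T \<omega>) \<omega> - a)) = 0" for \<theta>
  proof -
    have I: "integrable M (\<lambda>\<omega>. ?D \<omega> - ?D \<omega> * cos (\<theta> * (Y (?T \<omega>) \<omega> - a)))"
      by (intro Bochner_Integration.integrable_diff D_int cos_int)
    have nn: "0 \<le> ?D \<omega> - ?D \<omega> * cos (\<theta> * (Y (?T \<omega>) \<omega> - a))" for \<omega>
      using mult_left_mono[OF cos_le_one approach_discount_bounds(1)[of 1 a "traj \<omega>"]] by simp
    have "(LINT \<omega>|M. ?D \<omega> - ?D \<omega> * cos (\<theta> * (Y (?T \<omega>) \<omega> - a))) = 0"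
      by (subst Bochner_Integration.integral_diff[OF D_int cos_int]) (simp only: key diff_self)
    then show ?thesis
      using integral_nonneg_eq_0_iff_AE[OF I AE_I2[OF nn]] by simp
  qed
  have "AE \<omega> in M. \<forall>n. ?D \<omega> - ?D \<omega> * cos (1 / real (Suc n) * (Y (?T \<omega>) \<omega> - a)) = 0"
    unfolding AE_all_countable using AE_cos by blast
  then show ?thesis
  proof eventually_elim
    case (elim \<omega>)
    show ?case
    proof
      assume "approaches a (traj \<omega>)"
      then have "?D \<omega> \<noteq> 0" by (simp add: approach_discount_def)
      then have "cos (1 / real (Suc n) * (Y (?T \<omega>) \<omega> - a)) = 1" for n
        using elim[rule_format, of n] by simp
      then have "Y (?T \<omega>) \<omega> - a = 0" by (rule cos_eq_1_all_scales)
      then show "Y (?T \<omega>) \<omega> = a" by simp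
    qed
  qed
qed

text \<open>The probability of approaching \<open>a\<close> is at least \<open>W q a / W q 0\<close> for every \<open>q > 0\<close>. By scaling
  this ratio is \<open>W 1 (q powr (1 / \<alpha>) * a) / W 1 0\<close>, which tends to \<open>1\<close> as \<open>q\<close> tends to \<open>0\<close>.\<close>

lemma AE_approaches: "AE \<omega> in M. approaches a (traj \<omega>)"
proof -
  let ?W = "resolvent_kernel \<kappa> \<alpha>"
  \<comment> \<open>Chosen so that \<open>q n powr (1 / \<alpha>)\<close> is \<open>1 / Suc n\<close>.\<close>
  define q where "q n = (1 / real (Suc n)) powr \<alpha>" for n
  have q: "0 < q n" for n by (simp add: q_def)
  have qr: "q n powr (1 / \<alpha>) = 1 / real (Suc n)" for n
    using \<alpha>_gt_1 by (simp add: q_def powr_powr)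
  have S: "{\<omega> \<in> space M. approaches a (traj \<omega>)} \<in> events" by measurable
  have le: "?W (q n) a / ?W (q n) 0 \<le> prob {\<omega> \<in> space M. approaches a (traj \<omega>)}" for n
  proof -
    have "?W (q n) a / ?W (q n) 0 = (LINT \<omega>|M. approach_discount (q n) a (traj \<omega>))"
      by (rule approach_Laplace[OF q, symmetric])
    also have "\<dots> \<le> (LINT \<omega>|M. indicator {\<omega> \<in> space M. approaches a (traj \<omega>)} \<omega>)"
    proof (rule integral_mono)
      show "integrable M (\<lambda>\<omega>. approach_discount (q n) a (traj \<omega>))"
        by (rule integrable_const_bound[where B = 1]) (use approach_discount_bounds[of "q n"] q[of n] in simp_all)
      fix \<omega> assume "\<omega> \<in> space M"
      then show "approach_discount (q n) a (traj \<omega>) \<le> indicator {\<omega> \<in> space M. approaches a (traj \<omega>)} \<omega>"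
        using approach_discount_bounds(2)[of "q n" a "traj \<omega>"] q[of n]
        by (auto simp: indicator_def approach_discount_def)
    next
      show "integrable M (indicator {\<omega> \<in> space M. approaches a (traj \<omega>)} :: 'a \<Rightarrow> real)"
        using S by (intro integrable_real_indicator) (auto simp: less_top[symmetric])
    qed
    also have "\<dots> = prob {\<omega> \<in> space M. approaches a (traj \<omega>)}" using S by simp
    finally show ?thesis .
  qed
  have ratio: "?W (q n) a / ?W (q n) 0 = ?W 1 (a / real (Suc n)) / ?W 1 0" for n
    using resolvent_kernel_scaling[OF q[of n], of \<alpha> \<kappa> a] resolvent_kernel_scaling[OF q[of n], of \<alpha> \<kappa> 0] \<alpha>_gt_1 q[of n]
    by (simp add: qr)
  have "(\<lambda>n. ?W 1 (a / real (Suc n))) \<longlonglongrightarrow> ?W 1 0"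
    by (intro resolvent_kernel_tendsto_at_0 \<kappa>_pos \<alpha>_gt_1 LIMSEQ_Suc[OF lim_const_over_n]) simp
  from tendsto_divide[OF this tendsto_const[of "?W 1 0"]] resolvent_kernel_0_pos[OF _ \<kappa>_pos \<alpha>_gt_1, of 1]
  have "(\<lambda>n. ?W (q n) a / ?W (q n) 0) \<longlonglongrightarrow> 1" unfolding ratio by simp
  then have "1 \<le> prob {\<omega> \<in> space M. approaches a (traj \<omega>)}"
    by (rule LIMSEQ_le_const2) (use le in blast)
  then have "prob {\<omega> \<in> space M. approaches a (traj \<omega>)} = 1"
    using prob_le_1[of "{\<omega> \<in> space M. approaches a (traj \<omega>)}"] by linarith
  then show ?thesis
    by (subst (asm) prob_Collect_eq_1) simp_all
qed

lemma hitting_time_eq_approach_time: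
  assumes "a \<noteq> 0"
  shows "AE \<omega> in M. hitting_time Y a \<omega> = ereal (approach_time a (traj \<omega>))"
  using AE_approaches[of a] AE_at_approach_time[of a]
proof eventually_elim
  case (elim \<omega>)
  let ?T = "approach_time a (traj \<omega>)"
  have hit: "Y ?T \<omega> = a" using elim by simp
  have "?T \<noteq> 0" using hit Y_0[of \<omega>] assms by metis
  then have pos: "0 < ?T" using approach_time_nonneg[of a "traj \<omega>"] by simp
  have "?T \<le> t" if "0 < t" "Y t \<omega> = a" for t
  proof (rule LIMSEQ_le_const2[OF entry_time_tendsto_approach_time[OF elim(1)]])
    show "\<exists>N. \<forall>n\<ge>N. entry_time (shrinking_ball a n) (traj \<omega>) \<le> t"
      using that by (intro exI allI impI entry_time_le) (simp_all add: shrinking_ball_def)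
  qed
  then show ?case
    unfolding hitting_time_def using hit pos by (intro antisym Inf_lower Inf_greatest) auto
qed

lemma approach_time_Laplace:
  assumes "0 < q"
  shows "(LINT \<omega>|M. exp (- q * approach_time a (traj \<omega>))) = resolvent_kernel \<kappa> \<alpha> q a / resolvent_kernel \<kappa> \<alpha> q 0"
proof -
  have "(LINT \<omega>|M. exp (- q * approach_time a (traj \<omega>))) = (LINT \<omega>|M. approach_discount q a (traj \<omega>))"
    by (rule integral_cong_AE) (use AE_approaches[of a] in \<open>auto elim!: eventually_mono simp: approach_discount_def\<close>)
  then show ?thesis using approach_Laplace[OF assms] by simp
qed

end

section \<open>Right-continuous versions and the completed measure\<close>

text \<open>The process starts at \<open>0\<close> almost surely, so the values on the grid up to \<open>k * h\<close> are partial
  sums of the increments over it, and these are independent of the next increment.\<close>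

lemma levy_process_increment_independent:
  fixes X :: "real \<Rightarrow> 'a \<Rightarrow> real" and G :: "(nat \<Rightarrow> real) \<Rightarrow> complex"
  assumes L: "levy_process M X" and t: "0 < t" and h: "0 < h"
    and G[measurable]: "G \<in> borel_measurable (PiM {..k} (\<lambda>_. borel))" and G1: "\<And>y. norm (G y) \<le> 1"
  shows "(LINT \<omega>|M. G (\<lambda>j\<in>{..k}. X (real j * h) \<omega>) * iexp (\<theta> * (X (real k * h + t) \<omega> - X (real k * h) \<omega>))) =
    (LINT \<omega>|M. G (\<lambda>j\<in>{..k}. X (real j * h) \<omega>)) * char (distr M borel (X t)) \<theta>"
proof -
  interpret prob_space M using L by (simp add: levy_process_def)
  have X_meas: "X s \<in> borel_measurable M" if "0 \<le> s" for s
    using L that by (simp add: levy_process_def)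
  have X0: "AE \<omega> in M. X 0 \<omega> = 0"
    using L by (simp add: levy_process_def)
  \<comment> \<open>The grid, then the single time \<open>k * h + t\<close>; the values beyond that only make \<open>s\<close> increasing.\<close>
  define s where "s i = (if i \<le> k then real i * h else real k * h + real (i - k) * t)" for i
  define D where "D i \<omega> = X (s (Suc i)) \<omega> - X (s i) \<omega>" for i \<omega>
  have s_mono: "s i < s (Suc i)" for i
  proof (cases "i \<le> k")
    case True
    then show ?thesis using t h by (cases "i = k") (auto simp: s_def algebra_simps)
  next
    case False
    then have "real (i - k) * t < real (Suc i - k) * t" using t by (intro mult_strict_right_mono) auto
    then show ?thesis using False by (simp add: s_def)
  qed
  have s0: "0 \<le> s i" for i using t h by (simp add: s_def)
  have D_indep: "indep_vars (\<lambda>_. borel) D {..<Suc k}"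
  proof -
    have "\<forall>n (t :: nat \<Rightarrow> real). 0 \<le> t 0 \<longrightarrow> (\<forall>i<n. t i < t (Suc i)) \<longrightarrow>
        indep_vars (\<lambda>_. borel) (\<lambda>i \<omega>. X (t (Suc i)) \<omega> - X (t i) \<omega>) {..<n}"
      using L by (simp add: levy_process_def)
    then show ?thesis unfolding D_def[abs_def] using s0[of 0] s_mono by blast
  qed
  define F where "F d = G (\<lambda>j\<in>{..k}. \<Sum>i<j. d i)" for d
  have F_meas: "F \<in> borel_measurable (PiM {..<k} (\<lambda>_. borel))"
    unfolding F_def
  proof (rule measurable_compose[OF measurable_restrict G])
    fix j assume "j \<in> {..k}"
    then show "(\<lambda>d. \<Sum>i<j. d i) \<in> borel_measurable (PiM {..<k} (\<lambda>_. borel :: real measure))"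
      by (intro borel_measurable_sum measurable_component_singleton) auto
  qed
  have E_meas: "(\<lambda>d. iexp (\<theta> * d k)) \<in> borel_measurable (PiM {k} (\<lambda>_. borel :: real measure))"
  proof -
    have [measurable]: "(\<lambda>d. d k) \<in> borel_measurable (PiM {k} (\<lambda>_. borel :: real measure))"
      by (rule measurable_component_singleton) simp
    show ?thesis by measurable
  qed
  have "indep_var (PiM {..<k} (\<lambda>_. borel)) (\<lambda>\<omega>. restrict (\<lambda>i. D i \<omega>) {..<k})
      (PiM {k} (\<lambda>_. borel)) (\<lambda>\<omega>. restrict (\<lambda>i. D i \<omega>) {k})"
    by (rule indep_var_restrict[OF D_indep]) auto
  from indep_var_compose[OF this F_meas E_meas]
  have ind: "indep_var borel (\<lambda>\<omega>. F (\<lambda>i\<in>{..<k}. D i \<omega>)) borel (\<lambda>\<omega>. iexp (\<theta> * D k \<omega>))"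
    by (simp add: o_def)
  have telescope: "F (\<lambda>i\<in>{..<k}. D i \<omega>) = G (\<lambda>j\<in>{..k}. X (real j * h) \<omega>)" if "X 0 \<omega> = 0" for \<omega>
  proof -
    have "(\<Sum>i<j. (\<lambda>i\<in>{..<k}. D i \<omega>) i) = X (real j * h) \<omega>" if "j \<le> k" for j
    proof -
      have "(\<Sum>i<j. (\<lambda>i\<in>{..<k}. D i \<omega>) i) = (\<Sum>i<j. X (s (Suc i)) \<omega> - X (s i) \<omega>)"
        using that by (intro sum.cong) (auto simp: D_def)
      also have "\<dots> = X (s j) \<omega> - X (s 0) \<omega>" by (rule sum_lessThan_telescope)
      finally show ?thesis using that \<open>X 0 \<omega> = 0\<close> by (simp add: s_def)
    qed
    then show ?thesis unfolding F_def by (intro arg_cong[of _ _ G] restrict_ext) simp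
  qed
  have Dk: "D k \<omega> = X (real k * h + t) \<omega> - X (real k * h) \<omega>" for \<omega>
    by (simp add: D_def s_def)
  have D_meas[measurable]: "D i \<in> borel_measurable M" for i
    unfolding D_def using X_meas s0 by (intro borel_measurable_diff) auto
  have F_rv[measurable]: "(\<lambda>\<omega>. F (\<lambda>i\<in>{..<k}. D i \<omega>)) \<in> borel_measurable M"
    by (rule indep_var_rv1[OF ind])
  have X_rv[measurable]: "(\<lambda>\<omega>. G (\<lambda>j\<in>{..k}. X (real j * h) \<omega>)) \<in> borel_measurable M"
    using h by (intro measurable_compose[OF measurable_restrict G] X_meas) auto
  have X_diff[measurable]: "(\<lambda>\<omega>. X (real k * h + t) \<omega> - X (real k * h) \<omega>) \<in> borel_measurable M"
    using D_meas[of k] unfolding Dk .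
  have "(LINT \<omega>|M. G (\<lambda>j\<in>{..k}. X (real j * h) \<omega>) * iexp (\<theta> * (X (real k * h + t) \<omega> - X (real k * h) \<omega>))) =
     (LINT \<omega>|M. F (\<lambda>i\<in>{..<k}. D i \<omega>) * iexp (\<theta> * D k \<omega>))"
  proof (rule integral_cong_AE)
    show "AE \<omega> in M. G (\<lambda>j\<in>{..k}. X (real j * h) \<omega>) * iexp (\<theta> * (X (real k * h + t) \<omega> - X (real k * h) \<omega>)) =
       F (\<lambda>i\<in>{..<k}. D i \<omega>) * iexp (\<theta> * D k \<omega>)"
      using X0 by eventually_elim (simp only: telescope Dk)
  qed measurable
  also have "\<dots> = (LINT \<omega>|M. F (\<lambda>i\<in>{..<k}. D i \<omega>)) * (LINT \<omega>|M. iexp (\<theta> * D k \<omega>))"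
  proof (rule indep_var_lebesgue_integral[OF ind])
    show "integrable M (\<lambda>\<omega>. F (\<lambda>i\<in>{..<k}. D i \<omega>))"
      using G1 by (intro integrable_const_bound[where B = 1] F_rv AE_I2) (simp add: F_def)
    show "integrable M (\<lambda>\<omega>. iexp (\<theta> * D k \<omega>))"
      by (rule integrable_const_bound[where B = 1]) simp_all
  qed
  also have "(LINT \<omega>|M. F (\<lambda>i\<in>{..<k}. D i \<omega>)) = (LINT \<omega>|M. G (\<lambda>j\<in>{..k}. X (real j * h) \<omega>))"
    by (rule integral_cong_AE[OF F_rv X_rv]) (use X0 in \<open>eventually_elim\<close>, simp only: telescope)
  also have "(LINT \<omega>|M. iexp (\<theta> * D k \<omega>)) = char (distr M borel (D k)) \<theta>"
    unfolding char_def by (subst integral_distr) simp_all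
  also have "distr M borel (D k) = distr M borel (X t)"
  proof -
    have "distr M borel (\<lambda>\<omega>. X (real k * h + t) \<omega> - X (real k * h) \<omega>) = distr M borel (X t)"
      using L t h unfolding levy_process_def by simp
    then show ?thesis unfolding Dk[symmetric] by simp
  qed
  finally show ?thesis .
qed

text \<open>With the next lemma, the law under the completed measure of the hitting time, which itself may not be
  measurable with respect to \<open>M\<close>, becomes the law of a measurable random variable under \<open>M\<close>.\<close>

lemma borel_measurable_completion_AE_eq:
  fixes f g :: "'a \<Rightarrow> real"
  assumes f[measurable]: "f \<in> borel_measurable M" and eq: "AE \<omega> in M. g \<omega> = f \<omega>"
  shows "g \<in> borel_measurable (completion M)"
proof (rule measurableI)
  fix A :: "real set" assume A[measurable]: "A \<in> sets borel"
  have [measurable]: "f \<in> borel_measurable (completion M)" by (rule measurable_completion[OF f])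
  have [measurable]: "Measurable.pred (completion M) (\<lambda>\<omega>. g \<omega> \<noteq> f \<omega>)"
      "Measurable.pred (completion M) (\<lambda>\<omega>. g \<omega> \<in> A \<and> g \<omega> \<noteq> f \<omega>)"
    using eq by (intro sets_completion_AE; eventually_elim; simp)+
  have "Measurable.pred (completion M) (\<lambda>\<omega>. (f \<omega> \<in> A \<and> \<not> g \<omega> \<noteq> f \<omega>) \<or> (g \<omega> \<in> A \<and> g \<omega> \<noteq> f \<omega>))"
    by measurable
  also have "(\<lambda>\<omega>. (f \<omega> \<in> A \<and> \<not> g \<omega> \<noteq> f \<omega>) \<or> (g \<omega> \<in> A \<and> g \<omega> \<noteq> f \<omega>)) = (\<lambda>\<omega>. g \<omega> \<in> A)"
    by auto
  finally show "g -` A \<inter> space (completion M) \<in> sets (completion M)"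
    by (simp add: pred_def vimage_def Int_def conj_commute)
qed simp

lemma distr_completion_AE_eq:
  fixes f g :: "'a \<Rightarrow> real"
  assumes f[measurable]: "f \<in> borel_measurable M" and eq: "AE \<omega> in M. g \<omega> = f \<omega>"
  shows "distr (completion M) borel g = distr M borel f"
proof -
  have "distr (completion M) borel g = distr (completion M) borel f"
    by (rule distr_cong_AE[OF refl refl AE_completion[OF eq] borel_measurable_completion_AE_eq[OF f eq] measurable_completion[OF f]])
  also have "\<dots> = distr M borel f"
  proof (rule measure_eqI)
    fix A assume "A \<in> sets (distr (completion M) borel f)"
    then show "emeasure (distr (completion M) borel f) A = emeasure (distr M borel f) A"
      using measurable_completion[OF f] measurable_sets[OF f, of A] by (simp add: emeasure_distr)
  qed simp
  finally show ?thesis .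
qed

text \<open>Replace the path by \<open>0\<close> on a measurable null set outside of which it is cadlag and starts at
  \<open>0\<close>, and at negative times.\<close>

lemma right_continuous_version:
  assumes X: "levy_process M X"
    and char: "\<And>t \<theta>. 0 \<le> t \<Longrightarrow> char (distr M borel (X t)) \<theta> = of_real (exp (- \<kappa> * t * \<bar>\<theta>\<bar> powr \<alpha>))"
    and \<kappa>: "0 < \<kappa>" and \<alpha>: "1 < \<alpha>"
  obtains Y where "right_continuous_stable_process M Y \<alpha> \<kappa>"
    "AE \<omega> in M. \<forall>t\<ge>0. Y t \<omega> = X t \<omega>"
proof -
  interpret prob_space M using X by (simp add: levy_process_def)
  have "AE \<omega> in M. X 0 \<omega> = 0 \<and> cadlag (\<lambda>t. X t \<omega>)"
    using X by (simp add: levy_process_def)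
  then obtain N where N: "{\<omega> \<in> space M. \<not> (X 0 \<omega> = 0 \<and> cadlag (\<lambda>t. X t \<omega>))} \<subseteq> N" "emeasure M N = 0" "N \<in> sets M"
    by (rule AE_E)
  define Y where "Y t \<omega> = (if 0 \<le> t \<and> \<omega> \<in> space M - N then X t \<omega> else 0)" for t \<omega>
  have X_meas: "X t \<in> borel_measurable M" if "0 \<le> t" for t
    using X that by (simp add: levy_process_def)
  have AE_N: "AE \<omega> in M. \<omega> \<in> space M - N"
    using N by (intro AE_I[of _ _ N]) auto
  then have AE_eq: "AE \<omega> in M. \<forall>t\<ge>0. Y t \<omega> = X t \<omega>"
    by eventually_elim (simp add: Y_def)
  have Y_meas: "Y t \<in> borel_measurable M" for t
  proof (cases "0 \<le> t")
    case True
    have "(\<lambda>\<omega>. if \<omega> \<in> space M - N then X t \<omega> else 0) \<in> borel_measurable M"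
      using N(3) by (intro measurable_If_set X_meas True measurable_const) auto
    then show ?thesis using True by (simp add: Y_def[abs_def])
  qed (simp add: Y_def[abs_def])
  have Y_rc: "right_continuous (\<lambda>t. Y t \<omega>)" for \<omega>
    unfolding right_continuous_def
  proof
    fix t
    show "((\<lambda>t. Y t \<omega>) \<longlongrightarrow> Y t \<omega>) (at_right t)"
    proof (cases "0 \<le> t \<and> \<omega> \<in> space M - N")
      case True
      then have "cadlag (\<lambda>t. X t \<omega>)" using N(1) by blast
      then have "((\<lambda>t. X t \<omega>) \<longlongrightarrow> X t \<omega>) (at_right t)" using True unfolding cadlag_def by blast
      moreover have "\<forall>\<^sub>F u in at_right t. X u \<omega> = Y u \<omega>"
        using eventually_at_right_less[of t] by eventually_elim (use True in \<open>simp add: Y_def\<close>)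
      ultimately have "((\<lambda>u. Y u \<omega>) \<longlongrightarrow> X t \<omega>) (at_right t)" by (rule Lim_transform_eventually)
      moreover have "Y t \<omega> = X t \<omega>" using True by (simp add: Y_def)
      ultimately show ?thesis by (simp only:)
    next
      case False
      have "\<forall>\<^sub>F u in at_right t. 0 = Y u \<omega>"
      proof (cases "\<omega> \<in> space M - N")
        case True
        then have "t < 0" using False by simp
        then have "\<forall>\<^sub>F u in at_right t. u < 0"
          by (rule order_tendstoD(2)[OF tendsto_ident_at])
        then show ?thesis by eventually_elim (simp add: Y_def)
      next
        case False
        then show ?thesis by (intro always_eventually allI) (auto simp: Y_def)
      qed
      then have "((\<lambda>u. Y u \<omega>) \<longlongrightarrow> 0) (at_right t)" by (rule Lim_transform_eventually[OF tendsto_const])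
      moreover have "Y t \<omega> = 0" using False by (auto simp: Y_def)
      ultimately show ?thesis by (simp only:)
    qed
  qed
  have Y0: "Y 0 \<omega> = 0" for \<omega> using N(1) by (auto simp: Y_def)
  have "right_continuous_stable_process M Y \<alpha> \<kappa>"
  proof (unfold_locales)
    fix m k :: nat and t \<theta> :: real and G :: "(nat \<Rightarrow> real) \<Rightarrow> complex"
    assume t: "0 < t" and G: "G \<in> borel_measurable (PiM {..k} (\<lambda>_. borel))" and G1: "\<And>y. norm (G y) \<le> 1"
    have h: "0 < 1 / (2::real) ^ m" by simp
    have grid: "real j * (1 / 2 ^ m) = real j / 2 ^ m" for j by simp
    have Xj: "X (real j / 2 ^ m) \<in> borel_measurable M" for j by (rule X_meas) simp
    have GX: "(\<lambda>\<omega>. G (\<lambda>j\<in>{..k}. X (real j / 2 ^ m) \<omega>)) \<in> borel_measurable M"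
      by (intro measurable_compose[OF measurable_restrict G] Xj)
    have GY: "(\<lambda>\<omega>. G (\<lambda>j\<in>{..k}. Y (real j / 2 ^ m) \<omega>)) \<in> borel_measurable M"
      by (intro measurable_compose[OF measurable_restrict G] Y_meas)
    have [measurable]: "X (real k / 2 ^ m + t) \<in> borel_measurable M" using t by (intro X_meas) simp
    note [measurable] = GX GY Xj Y_meas
    have GXY: "AE \<omega> in M. G (\<lambda>j\<in>{..k}. Y (real j / 2 ^ m) \<omega>) = G (\<lambda>j\<in>{..k}. X (real j / 2 ^ m) \<omega>)"
      using AE_eq by eventually_elim simp
    have "(LINT \<omega>|M. G (\<lambda>j\<in>{..k}. Y (real j / 2 ^ m) \<omega>) * iexp (\<theta> * (Y (real k / 2 ^ m + t) \<omega> - Y (real k / 2 ^ m) \<omega>))) =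
      (LINT \<omega>|M. G (\<lambda>j\<in>{..k}. X (real j / 2 ^ m) \<omega>) * iexp (\<theta> * (X (real k / 2 ^ m + t) \<omega> - X (real k / 2 ^ m) \<omega>)))"
    proof (rule integral_cong_AE)
      show "AE \<omega> in M. G (\<lambda>j\<in>{..k}. Y (real j / 2 ^ m) \<omega>) * iexp (\<theta> * (Y (real k / 2 ^ m + t) \<omega> - Y (real k / 2 ^ m) \<omega>)) =
        G (\<lambda>j\<in>{..k}. X (real j / 2 ^ m) \<omega>) * iexp (\<theta> * (X (real k / 2 ^ m + t) \<omega> - X (real k / 2 ^ m) \<omega>))"
        using AE_eq GXY by eventually_elim (use t in simp)
    qed measurable
    also have "\<dots> = (LINT \<omega>|M. G (\<lambda>j\<in>{..k}. X (real j / 2 ^ m) \<omega>)) * char (distr M borel (X t)) \<theta>"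
      using levy_process_increment_independent[OF X t h G G1, of \<theta>] unfolding grid .
    also have "(LINT \<omega>|M. G (\<lambda>j\<in>{..k}. X (real j / 2 ^ m) \<omega>)) = (LINT \<omega>|M. G (\<lambda>j\<in>{..k}. Y (real j / 2 ^ m) \<omega>))"
      by (rule integral_cong_AE[OF GX GY]) (use GXY in \<open>eventually_elim\<close>, simp only:)
    finally show "(LINT \<omega>|M. G (\<lambda>j\<in>{..k}. Y (real j / 2 ^ m) \<omega>) * iexp (\<theta> * (Y (real k / 2 ^ m + t) \<omega> - Y (real k / 2 ^ m) \<omega>))) =
      (LINT \<omega>|M. G (\<lambda>j\<in>{..k}. Y (real j / 2 ^ m) \<omega>)) * of_real (exp (- \<kappa> * t * \<bar>\<theta>\<bar> powr \<alpha>))"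
      using t by (simp only: char less_imp_le)
  qed (fact \<kappa> \<alpha> Y_meas Y_rc Y0)+
  then show ?thesis using AE_eq by (rule that)
qed

theorem corollary1p2:
  fixes \<alpha> a :: real and M :: "'a measure" and X :: "real \<Rightarrow> 'a \<Rightarrow> real"
  assumes "1 < \<alpha>" and "\<alpha> < 2"
    and "symmetric_stable_levy_process \<alpha> M X"
    and "a \<noteq> 0"
  shows "\<not> self_decomposable (completion M) (\<lambda>\<omega>. real_of_ereal (hitting_time X a \<omega>))"
proof
  assume SD: "self_decomposable (completion M) (\<lambda>\<omega>. real_of_ereal (hitting_time X a \<omega>))"
  obtain \<kappa> where X: "levy_process M X" and \<kappa>: "0 < \<kappa>"
    and char: "\<And>t \<theta>. 0 \<le> t \<Longrightarrow> char (distr M borel (X t)) \<theta> = of_real (exp (- \<kappa> * t * \<bar>\<theta>\<bar> powr \<alpha>))"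
    using assms(3) unfolding symmetric_stable_levy_process_def by blast
  obtain Y where Y: "right_continuous_stable_process M Y \<alpha> \<kappa>" and YX: "AE \<omega> in M. \<forall>t\<ge>0. Y t \<omega> = X t \<omega>"
    using right_continuous_version[OF X char \<kappa> assms(1)] by blast
  interpret right_continuous_stable_process M Y \<alpha> \<kappa> by (rule Y)
  define T where "T \<omega> = approach_time a (traj \<omega>)" for \<omega>
  have T_meas: "T \<in> borel_measurable M" unfolding T_def[abs_def] by (rule approach_time_measurable)
  have T_eq: "AE \<omega> in M. real_of_ereal (hitting_time X a \<omega>) = T \<omega>"
    using hitting_time_eq_approach_time[OF assms(4)] YX
  proof eventually_elim
    case (elim \<omega>)
    have "{t. 0 < t \<and> X t \<omega> = a} = {t. 0 < t \<and> Y t \<omega> = a}" using elim(2) by auto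
    then have "hitting_time X a \<omega> = hitting_time Y a \<omega>" unfolding hitting_time_def by (simp only:)
    then show ?case using elim(1) by (simp add: T_def)
  qed
  have SD_T: "self_decomposable M T"
    using SD unfolding self_decomposable_def distr_completion_AE_eq[OF T_meas T_eq] .
  let ?W = "resolvent_kernel \<kappa> \<alpha>" and ?\<gamma> = "1 + 1 / \<alpha>"
  \<comment> \<open>The rotated integral is for positive arguments only; the kernel is even.\<close>
  have W_abs: "?W q a = ?W q \<bar>a\<bar>" for q
    unfolding resolvent_kernel_def by (simp add: abs_if)
  obtain A where A: "0 < A" and lim: "((\<lambda>q. q\<^sup>2 * ?W q \<bar>a\<bar>) \<longlongrightarrow> A) at_top"
    and above: "\<forall>\<^sub>F q in at_top. A < q\<^sup>2 * ?W q \<bar>a\<bar>"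
    using resolvent_kernel_asymptotics[OF \<kappa> assms(1,2)] assms(4) by (metis zero_less_abs_iff)
  have W0: "0 < ?W 1 0" by (rule resolvent_kernel_0_pos[OF zero_less_one \<kappa> assms(1)])
  have g: "q powr ?\<gamma> * (LINT \<omega>|M. exp (- q * T \<omega>)) = q\<^sup>2 * ?W q \<bar>a\<bar> / ?W 1 0" if q: "0 < q" for q
  proof -
    have "?W q 0 = q powr (1 / \<alpha> - 1) * ?W 1 0"
      using resolvent_kernel_scaling[OF q, of \<alpha> \<kappa> 0] assms(1) by simp
    moreover have "q powr ?\<gamma> = q\<^sup>2 * q powr (1 / \<alpha> - 1)"
      using q by (simp add: powr_add[symmetric] powr_numeral[symmetric] del: powr_numeral)
    ultimately show ?thesis
      unfolding T_def approach_time_Laplace[OF q] W_abs using q by simp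
  qed
  have lim': "((\<lambda>q. q powr ?\<gamma> * (LINT \<omega>|M. exp (- q * T \<omega>))) \<longlongrightarrow> A / ?W 1 0) at_top"
  proof (rule Lim_transform_eventually)
    show "((\<lambda>q. q\<^sup>2 * ?W q \<bar>a\<bar> / ?W 1 0) \<longlongrightarrow> A / ?W 1 0) at_top"
      using W0 by (intro tendsto_divide lim tendsto_const) simp
    show "\<forall>\<^sub>F q in at_top. q\<^sup>2 * ?W q \<bar>a\<bar> / ?W 1 0 = q powr ?\<gamma> * (LINT \<omega>|M. exp (- q * T \<omega>))"
      using eventually_gt_at_top[of 0] by eventually_elim (simp only: g)
  qed
  have T0: "AE \<omega> in M. 0 \<le> T \<omega>" by (simp add: T_def approach_time_nonneg)
  have le: "q\<^sup>2 * ?W q \<bar>a\<bar> / ?W 1 0 \<le> A / ?W 1 0" if "0 < q" for q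
    using self_decomposable_Laplace_le_limit[OF prob_space_axioms T_meas T0 SD_T divide_pos_pos[OF A W0] lim' that]
    unfolding g[OF that] .
  obtain q where q: "A < q\<^sup>2 * ?W q \<bar>a\<bar>" "0 < q"
    using eventually_conj[OF above eventually_gt_at_top[of 0]]
    unfolding eventually_at_top_linorder by blast
  then show False using le[OF q(2)] W0 by (simp add: divide_le_cancel)
qed

end
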